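(* Let $\mathcal P$ be a labelled link pattern of size $m$ and rank $r$. The function $$\sigma^\mu\,\mathfrak C_w^{\diamond}(\mathcal E\ell\ell(\mathcal P^{\min}_{m,r}))$$ does not depend on $(\sigma,w)\in\mathfrak S_r\times\mathfrak S_m$, provided that $w$ has minimal length among all the possible pairs $(\sigma,w)$ satisfying $\mathcal P=\sigma^\mu w\mathcal P^{\min}_{m,r}$.
   Context: For $\operatorname{Im}\tau>0$, $q=e^{2\pi i\tau}$, put $\theta_\tau(x)=2q^{1/8}\sin(\pi x)\prod_{n\ge1}(1-q^n)(1-q^ne^{2\pi i x})(1-q^ne^{-2\pi i x})$, $F_\tau(x,y)=\frac{\theta_\tau'(0)\theta_\tau(x+y)}{\theta_\tau(x)\theta_\tau(y)}$, and let $\delta=\delta_\tau$ be the function on $\mathbb C^*\times\mathbb C^*$ with $\delta(e^{2\pi i x},e^{2\pi i y})=F_\tau(x,y)$. Functions are meromorphic in $u,x_1,\dots,x_m,h,\mu_1,\dots,\mu_r\in\mathbb C^*$. Link patterns: for $r\ge0$, $m\ge2r$, a labelled link pattern of size $m$ and rank $r$ is a sequence $((a_1,b_1),\dots,(a_r,b_r))$ of pairs (source, target) with all $a_i,b_i\in\{1,\dots,m\}$ distinct. $w\in\mathfrak S_m$ acts by applying $w$ to all $a_i,b_i$; $\sigma\in\mathfrak S_r$ acts by relabelling: $\sigma^\mu$ gives label $\sigma(i)$ to the arrow labelled $i$. On functions $\sigma^\mu$ replaces $\mu_i$ by $\mu_{\sigma(i)}$. The minimal pattern is $\mathcal P^{\min}_{m,r}=((m-r+1,1),\dots,(m,r))$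 and $$\mathcal E\ell\ell(\mathcal P^{\min}_{m,r})=\prod_{i=1}^r\Big(\delta(u\tfrac{x_i}{x_{m-r+i}},\mu_i)\prod_{j=m-r+i+1}^m\delta(u\tfrac{x_i}{x_j},h)\Big).$$ Types: in arguments of $\delta$ variables are written multiplicatively, in quadratic forms additively. The theta function $\theta(\ell)$ of an integral linear combination $\ell$ of variables has type $\tfrac12\ell^2$; types add under products and subtract under quotients; in particular $\operatorname{type}(\delta(\ell_1,\ell_2))=\ell_1\ell_2$. A Laurent polynomial in such theta functions is pure if all its summands have the same type, and this common quadratic form is its type. Characters are Laurent monomials in $h,\mu_1,\dots,\mu_r$, written additively as integral linear forms. Operations: for a nontrivial character $\mu$, $\mathfrak C_i^\mu(f)=\delta(\tfrac{x_{i+1}}{x_i},\mu)f+\delta(\tfrac{x_i}{x_{i+1}},h)s_if$, where $s_i$ exchanges $x_i$ and $x_{i+1}$ only. For pure $g$ the admissible parameter is $\nu=\partial_i(\operatorname{type}(g))-h$, where $\partial_i(Q)=\frac{Q-s_iQ}{x_i-x_{i+1}}$ (the parameter for which $\mathfrak C_i^\nu(g)$ is pure). $\mathfrak C_w^\diamond(f)=\mathfrak C_{i_1}^{\nu_1}\cdots\mathfrak C_{i_\ell}^{\nu_\ell}(f)$ for a reduced word $w=s_{i_1}\cdots s_{i_\ell}$, with each $\nu_k$ admissible for the function it is applied to; for $f=\mathcal E\ell\ell(\mathcal P^{\min}_{m,r})$ this does not depend on the reduced word. *)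

theory Defs
  imports "HOL-Analysis.Analysis" "HOL-Combinatorics.Permutations"
begin

section \<open>Theta functions\<close>

definition theta :: "complex \<Rightarrow> complex \<Rightarrow> complex" where
  "theta \<tau> x = (let q = exp (2 * of_real pi * \<i> * \<tau>); e = (\<lambda>t. exp (2 * of_real pi * \<i> * t)) in
     2 * exp (2 * of_real pi * \<i> * \<tau> / 8) * sin (of_real pi * x) *
     (\<Prod>n. (1 - q ^ Suc n) * (1 - q ^ Suc n * e x) * (1 - q ^ Suc n * e (- x))))"

definition F_ell :: "complex \<Rightarrow> complex \<Rightarrow> complex \<Rightarrow> complex" where
  "F_ell \<tau> x y = deriv (theta \<tau>) 0 * theta \<tau> (x + y) / (theta \<tau> x * theta \<tau> y)"

text \<open>The choice of logarithms in \<open>delta\<close> is immaterial on \<open>\<complex>\<^sup>* \<times> \<complex>\<^sup>*\<close>, since \<open>F_ell\<close> is 1-periodic in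
  both arguments (see \<open>delta_exp\<close>).\<close>

definition delta :: "complex \<Rightarrow> complex \<Rightarrow> complex \<Rightarrow> complex" where
  "delta \<tau> a b = F_ell \<tau> (Ln a / (2 * of_real pi * \<i>)) (Ln b / (2 * of_real pi * \<i>))"

lemma theta_plus_int: "theta \<tau> (x + of_int n) = (-1) powi n * theta \<tau> x"
proof -
  have e: "exp (2 * of_real pi * \<i> * (x + of_int n)) = exp (2 * of_real pi * \<i> * x)"
    by (rule exp_eq[THEN iffD2], rule exI[of _ n]) (simp add: algebra_simps)
  have e': "exp (2 * of_real pi * \<i> * (- x - of_int n)) = exp (2 * of_real pi * \<i> * (- x))"
    by (rule exp_eq[THEN iffD2], rule exI[of _ "- n"]) (simp add: algebra_simps)
  have c: "cos (of_int n * of_real pi :: complex) = (-1) powi n"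
  proof -
    have "cos (of_int n * of_real pi :: complex) = of_real (cos (of_int n * pi))"
      by (simp flip: cos_of_real)
    also have "cos (of_int n * pi) = (if even n then 1 else -1)"
      using cos_npi_int[of n] by (simp add: mult.commute)
    finally show ?thesis by (auto simp: power_int_minus_left)
  qed
  have s: "sin (of_int n * of_real pi :: complex) = 0"
    using sin_of_real[of "of_int n * pi", where 'a=complex] sin_npi_int[of n] by (simp add: mult.commute)
  have "sin (of_real pi * (x + of_int n) :: complex) = sin (of_real pi * x + of_int n * of_real pi)"
    by (simp add: algebra_simps)
  also have "\<dots> = (-1) powi n * sin (of_real pi * x)"
    by (simp add: sin_add c s)
  finally show ?thesis
    using e e' by (simp add: theta_def Let_def)
qed

lemma delta_exp:
  "delta \<tau> (exp (2 * of_real pi * \<i> * x)) (exp (2 * of_real pi * \<i> * y)) = F_ell \<tau> x y"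
proof -
  have ln: "\<exists>n::int. Ln (exp (2 * of_real pi * \<i> * t)) / (2 * of_real pi * \<i>) = t + of_int n" for t :: complex
  proof -
    have "exp (Ln (exp (2 * of_real pi * \<i> * t))) = exp (2 * of_real pi * \<i> * t)" by simp
    then obtain n :: int where "Ln (exp (2 * of_real pi * \<i> * t)) = 2 * of_real pi * \<i> * t + (of_int (2 * n) * pi) * \<i>"
      unfolding exp_eq by blast
    then show ?thesis by (intro exI[of _ n]) (simp add: field_simps)
  qed
  obtain n k :: int where
    n: "Ln (exp (2 * of_real pi * \<i> * x)) / (2 * of_real pi * \<i>) = x + of_int n" and
    k: "Ln (exp (2 * of_real pi * \<i> * y)) / (2 * of_real pi * \<i>) = y + of_int k"
    using ln by metis
  have a: "x + of_int n + (y + of_int k) = (x + y) + of_int (n + k)" by simp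
  show ?thesis
    unfolding delta_def n k F_ell_def a theta_plus_int
    by (simp add: power_int_add)
qed

section \<open>Variables, linear forms, meromorphic functions\<close>

datatype var = U | X nat | H | Mu nat

definition vars :: "nat \<Rightarrow> nat \<Rightarrow> var set" where
  "vars m r = {U, H} \<union> X ` {1..m} \<union> Mu ` {1..r}"

type_synonym point = "var \<Rightarrow> complex"
type_synonym lin_form = "var \<Rightarrow> int"

text \<open>An integral linear form \<open>l\<close> has a multiplicative incarnation \<open>lf_mono\<close> (a Laurent monomial
  on the torus) and an additive one \<open>lf_eval\<close>; \<open>exp_point\<close> passes from additive to multiplicative
  coordinates.\<close>

definition lf_on :: "var set \<Rightarrow> lin_form \<Rightarrow> bool" where
  "lf_on V l \<longleftrightarrow> (\<forall>v. v \<notin> V \<longrightarrow> l v = 0)"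

definition lf_eval :: "nat \<Rightarrow> nat \<Rightarrow> lin_form \<Rightarrow> point \<Rightarrow> complex" where
  "lf_eval m r l z = (\<Sum>v\<in>vars m r. of_int (l v) * z v)"

definition lf_mono :: "nat \<Rightarrow> nat \<Rightarrow> lin_form \<Rightarrow> point \<Rightarrow> complex" where
  "lf_mono m r l p = (\<Prod>v\<in>vars m r. p v powi l v)"

definition exp_point :: "point \<Rightarrow> point" where
  "exp_point z = (\<lambda>v. exp (2 * of_real pi * \<i> * z v))"

definition nontrivial_character :: "nat \<Rightarrow> lin_form \<Rightarrow> bool" where
  "nontrivial_character r \<nu> \<longleftrightarrow> lf_on ({H} \<union> Mu ` {1..r}) \<nu> \<and> (\<exists>v. \<nu> v \<noteq> 0)"

text \<open>A meromorphic function is represented by a total function on points, whose values on the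
  polar locus carry no meaning; two representatives define the same meromorphic function iff they
  agree on a dense open subset of the torus.  Coordinates outside \<open>vars m r\<close> are unused.\<close>

definition torus :: "nat \<Rightarrow> nat \<Rightarrow> point set" where
  "torus m r = {p. \<forall>v\<in>vars m r. p v \<noteq> 0}"

definition dense_open :: "nat \<Rightarrow> nat \<Rightarrow> point set \<Rightarrow> bool" where
  "dense_open m r D \<longleftrightarrow> open D \<and> D \<subseteq> torus m r \<and> torus m r \<subseteq> closure D"

definition mero_eq :: "nat \<Rightarrow> nat \<Rightarrow> (point \<Rightarrow> complex) \<Rightarrow> (point \<Rightarrow> complex) \<Rightarrow> bool" where
  "mero_eq m r f g \<longleftrightarrow> (\<exists>D. dense_open m r D \<and> (\<forall>p\<in>D. f p = g p))"

section \<open>Types and purity\<close>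

text \<open>A monomial in theta functions is a list of pairs \<open>(l, e)\<close> standing for \<open>\<theta>(l) ^ e\<close>; the forms
  \<open>l\<close> are nonzero because \<open>\<theta>(0) = 0\<close>.  A Laurent polynomial is a list of such
  monomials with complex coefficients (which have type 0).  A single \<open>\<theta>(l)\<close> is defined only up to
  sign on the torus, so its value is taken in additive coordinates.  Quadratic forms are
  represented as polynomial functions of the additive coordinates.\<close>

type_synonym theta_mono = "(lin_form \<times> int) list"
type_synonym quad_form = "point \<Rightarrow> complex"

definition tm_valid :: "nat \<Rightarrow> nat \<Rightarrow> theta_mono \<Rightarrow> bool" where
  "tm_valid m r M \<longleftrightarrow> (\<forall>(l, e)\<in>set M. lf_on (vars m r) l \<and> (\<exists>v. l v \<noteq> 0))"

definition tm_eval :: "complex \<Rightarrow> nat \<Rightarrow> nat \<Rightarrow> theta_mono \<Rightarrow> point \<Rightarrow> complex" where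
  "tm_eval \<tau> m r M z = (\<Prod>(l, e)\<leftarrow>M. theta \<tau> (lf_eval m r l z) powi e)"

definition tm_type :: "nat \<Rightarrow> nat \<Rightarrow> theta_mono \<Rightarrow> quad_form" where
  "tm_type m r M z = (\<Sum>(l, e)\<leftarrow>M. of_int e * ((lf_eval m r l z)\<^sup>2 / 2))"

definition pure_of_type ::
  "complex \<Rightarrow> nat \<Rightarrow> nat \<Rightarrow> (point \<Rightarrow> complex) \<Rightarrow> quad_form \<Rightarrow> bool" where
  "pure_of_type \<tau> m r f Q \<longleftrightarrow>
     (\<exists>L :: (complex \<times> theta_mono) list.
        L \<noteq> [] \<and> (\<forall>(c, M)\<in>set L. tm_valid m r M \<and> tm_type m r M = Q) \<and>
        (\<exists>D. dense_open m r D \<and>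
           (\<forall>z. exp_point z \<in> D \<longrightarrow>
              f (exp_point z) = (\<Sum>(c, M)\<leftarrow>L. c * tm_eval \<tau> m r M z))))"

section \<open>The operations\<close>

definition swap_x :: "nat \<Rightarrow> point \<Rightarrow> point" where
  "swap_x i p = p \<circ> Transposition.transpose (X i) (X (Suc i))"

definition C_op ::
  "complex \<Rightarrow> nat \<Rightarrow> nat \<Rightarrow> nat \<Rightarrow> lin_form \<Rightarrow> (point \<Rightarrow> complex) \<Rightarrow> point \<Rightarrow> complex" where
  "C_op \<tau> m r i \<nu> f p =
     delta \<tau> (p (X (Suc i)) / p (X i)) (lf_mono m r \<nu> p) * f p +
     delta \<tau> (p (X i) / p (X (Suc i))) (p H) * f (swap_x i p)"

text \<open>\<open>\<nu> = \<partial>\<^sub>i Q - h\<close>, with the division by \<open>x\<^sub>i - x\<^sub>i\<^sub>+\<^sub>1\<close> cleared: it is a division of polynomials.\<close>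

definition admissible ::
  "complex \<Rightarrow> nat \<Rightarrow> nat \<Rightarrow> nat \<Rightarrow> (point \<Rightarrow> complex) \<Rightarrow> lin_form \<Rightarrow> bool" where
  "admissible \<tau> m r i g \<nu> \<longleftrightarrow>
     nontrivial_character r \<nu> \<and>
     (\<exists>Q. pure_of_type \<tau> m r g Q \<and>
       (\<forall>z. Q z - Q (swap_x i z) = (z (X i) - z (X (Suc i))) * (lf_eval m r \<nu> z + z H)))"

text \<open>\<open>C_word \<tau> m r [i\<^sub>1, \<dots>, i\<^sub>l] f g\<close>: the last letter acts first, every step uses an
  admissible parameter, and the outcome is \<open>g\<close>.\<close>

inductive C_word ::
  "complex \<Rightarrow> nat \<Rightarrow> nat \<Rightarrow> nat list \<Rightarrow> (point \<Rightarrow> complex) \<Rightarrow> (point \<Rightarrow> complex) \<Rightarrow> bool"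
  for \<tau> m r where
  Nil: "C_word \<tau> m r [] f f"
| Cons: "C_word \<tau> m r is f g \<Longrightarrow> admissible \<tau> m r i g \<nu> \<Longrightarrow>
         C_word \<tau> m r (i # is) f (C_op \<tau> m r i \<nu> g)"

definition word_perm :: "nat list \<Rightarrow> nat \<Rightarrow> nat" where
  "word_perm is = foldr (\<lambda>i w. Transposition.transpose i (Suc i) \<circ> w) is id"

definition coxeter_length :: "nat \<Rightarrow> (nat \<Rightarrow> nat) \<Rightarrow> nat" where
  "coxeter_length m w =
     (LEAST l. \<exists>is. set is \<subseteq> {1..<m} \<and> word_perm is = w \<and> length is = l)"

definition reduced_word :: "nat \<Rightarrow> (nat \<Rightarrow> nat) \<Rightarrow> nat list \<Rightarrow> bool" where
  "reduced_word m w is \<longleftrightarrow>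
     set is \<subseteq> {1..<m} \<and> word_perm is = w \<and> length is = coxeter_length m w"

definition C_diamond ::
  "complex \<Rightarrow> nat \<Rightarrow> nat \<Rightarrow> (nat \<Rightarrow> nat) \<Rightarrow> (point \<Rightarrow> complex) \<Rightarrow> (point \<Rightarrow> complex) \<Rightarrow> bool" where
  "C_diamond \<tau> m r w f g \<longleftrightarrow> (\<exists>is. reduced_word m w is \<and> C_word \<tau> m r is f g)"

definition mu_act :: "(nat \<Rightarrow> nat) \<Rightarrow> (point \<Rightarrow> complex) \<Rightarrow> point \<Rightarrow> complex" where
  "mu_act \<sigma> f p = f (\<lambda>v. case v of Mu i \<Rightarrow> p (Mu (\<sigma> i)) | _ \<Rightarrow> p v)"

section \<open>Labelled link patterns\<close>

text \<open>A pattern of rank \<open>r\<close> is a function on the labels \<open>{1..r}\<close>; values outside are irrelevant.\<close>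

type_synonym pattern = "nat \<Rightarrow> nat \<times> nat"

definition link_pattern :: "nat \<Rightarrow> nat \<Rightarrow> pattern \<Rightarrow> bool" where
  "link_pattern m r P \<longleftrightarrow> 2 * r \<le> m \<and>
     fst ` P ` {1..r} \<subseteq> {1..m} \<and> snd ` P ` {1..r} \<subseteq> {1..m} \<and>
     inj_on (fst \<circ> P) {1..r} \<and> inj_on (snd \<circ> P) {1..r} \<and>
     fst ` P ` {1..r} \<inter> snd ` P ` {1..r} = {}"

definition pattern_eq :: "nat \<Rightarrow> pattern \<Rightarrow> pattern \<Rightarrow> bool" where
  "pattern_eq r P P' \<longleftrightarrow> (\<forall>i\<in>{1..r}. P i = P' i)"

definition vertex_act :: "(nat \<Rightarrow> nat) \<Rightarrow> pattern \<Rightarrow> pattern" where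
  "vertex_act w P = map_prod w w \<circ> P"

text \<open>The arrow labelled \<open>i\<close> receives the label \<open>\<sigma> i\<close>.\<close>

definition label_act :: "(nat \<Rightarrow> nat) \<Rightarrow> pattern \<Rightarrow> pattern" where
  "label_act \<sigma> P = P \<circ> inv \<sigma>"

definition P_min :: "nat \<Rightarrow> nat \<Rightarrow> pattern" where
  "P_min m r i = (m - r + i, i)"

definition Ell_min :: "complex \<Rightarrow> nat \<Rightarrow> nat \<Rightarrow> point \<Rightarrow> complex" where
  "Ell_min \<tau> m r p =
     (\<Prod>i=1..r. delta \<tau> (p U * p (X i) / p (X (m - r + i))) (p (Mu i)) *
        (\<Prod>j=m-r+i+1..m. delta \<tau> (p U * p (X i) / p (X j)) (p H)))"

definition presents :: "nat \<Rightarrow> nat \<Rightarrow> pattern \<Rightarrow> (nat \<Rightarrow> nat) \<Rightarrow> (nat \<Rightarrow> nat) \<Rightarrow> bool" where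
  "presents m r P \<sigma> w \<longleftrightarrow> \<sigma> permutes {1..r} \<and> w permutes {1..m} \<and>
     pattern_eq r P (label_act \<sigma> (vertex_act w (P_min m r)))"

definition min_presents :: "nat \<Rightarrow> nat \<Rightarrow> pattern \<Rightarrow> (nat \<Rightarrow> nat) \<Rightarrow> (nat \<Rightarrow> nat) \<Rightarrow> bool" where
  "min_presents m r P \<sigma> w \<longleftrightarrow> presents m r P \<sigma> w \<and>
     (\<forall>\<sigma>' w'. presents m r P \<sigma>' w' \<longrightarrow> coxeter_length m w \<le> coxeter_length m w')"

end

theory Submission
  imports Defs "HOL-Complex_Analysis.Complex_Analysis"
begin

text \<open>
  Write \<open>w\<close> for the permutation reached so far and attach to the positions \<open>1, \<dots>, m\<close> of the
  minimal pattern the linear forms \<open>\<mu>\<^sub>k + r h\<close> (targets), \<open>k h\<close> (free vertices) and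
  \<open>(m - r + 1) h - \<mu>\<^sub>k\<close> (sources).  These forms are pairwise distinct, and the type of
  \<open>C\<^sub>w (Ell_min)\<close> is obtained by letting \<open>w\<close> permute them; hence the admissible parameter of \<open>s\<^sub>i\<close>
  is the difference of the forms sitting at \<open>i\<close> and \<open>i + 1\<close>, which never vanishes.  A type is
  unique for a function that is not zero, because it is determined by the quasi-periodicity under
  \<open>p v \<mapsto> q p v\<close>; if an intermediate function were zero, all later ones would be, so that parameters
  would not matter.

  With these parameters the operators satisfy the braid relations, by the Fay identity for \<open>F\<close>;
  together with the word property of the symmetric group this makes \<open>C\<^sub>w (Ell_min)\<close> independent of
  the reduced word.  Two presentations of minimal length are connected by moves from
  \<open>(\<sigma>, v s\<^sub>K)\<close> to \<open>(\<sigma> s\<^sub>k, v s\<^sub>k)\<close>, where \<open>K = m - r + k\<close> and both words are longer than \<open>v\<close>.  Such a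
  move does not change the function because \<open>C\<^sub>k (Ell_min)\<close> is \<open>C\<^sub>K (Ell_min)\<close> with \<open>\<mu>\<^sub>k\<close> and
  \<open>\<mu>\<^sub>k\<^sub>+\<^sub>1\<close> exchanged.  All identities of functions reduce to the three-term identity of Weierstrass.
\<close>

section \<open>Theta functions\<close>

text \<open>The relation \<open>admissible\<close> asks only for some type of a function, and
  functions matter only up to \<open>mero_eq\<close>. This is why \<open>canon\<close> fixes its
  parameters by the permutation alone: identities are proved for this one run of the operators, and
  every other run is compared with it. Identities between functions are checked at points where no
  denominator vanishes. Such points are dense: multiplying a coordinate by e^(2 pi i t) with small
  real t changes a monomial but not its modulus, while the zeros of theta lie at the powers of q,
  whose moduli are pairwise different. At such a point a logarithm turns the claim into an identity
  for F in additive coordinates.\<close>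

definition unit_exp :: "complex \<Rightarrow> complex" where
  "unit_exp t = exp (2 * of_real pi * \<i> * t)"

text \<open>The q-Pochhammer symbol (q w; q)_infinity. Theta contains it at w = 1, e(x) and e(-x),
  where e(t) abbreviates \<open>unit_exp t\<close>, so one functional equation and one description
  of zeros serve all three products.\<close>

definition euler_prod :: "complex \<Rightarrow> complex \<Rightarrow> complex" where
  "euler_prod q w = (\<Prod>n. 1 - q ^ Suc n * w)"

lemma unit_exp_add: "unit_exp (x + y) = unit_exp x * unit_exp y"
  by (simp add: unit_exp_def exp_add distrib_left)

lemma unit_exp_nonzero [simp]: "unit_exp x \<noteq> 0"
  by (simp add: unit_exp_def)

lemma unit_exp_0 [simp]: "unit_exp 0 = 1"
  by (simp add: unit_exp_def)

lemma unit_exp_minus: "unit_exp (- x) = inverse (unit_exp x)"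
  by (simp add: unit_exp_def exp_minus)

lemma unit_exp_diff: "unit_exp (x - y) = unit_exp x / unit_exp y"
  by (simp add: unit_exp_def exp_diff algebra_simps)

lemma unit_exp_eq_iff: "unit_exp x = unit_exp y \<longleftrightarrow> (\<exists>n::int. x = y + of_int n)"
proof -
  have "2 * of_real pi * \<i> * x = 2 * of_real pi * \<i> * y + of_real (of_int (2 * n) * pi) * \<i>
      \<longleftrightarrow> x = y + of_int n" for n :: int
  proof -
    have "2 * of_real pi * \<i> * y + of_real (of_int (2 * n) * pi) * \<i> = 2 * of_real pi * \<i> * (y + of_int n)"
      by (simp add: algebra_simps)
    then show ?thesis by simp
  qed
  then show ?thesis unfolding unit_exp_def exp_eq by simp
qed

lemma unit_exp_of_int_mult: "unit_exp (of_int n * x) = unit_exp x powi n"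
proof -
  have "of_int n * (2 * of_real pi * \<i> * x) = 2 * of_real pi * \<i> * (of_int n * x)" by simp
  then show ?thesis
    unfolding unit_exp_def using exp_power_int[of "2 * of_real pi * \<i> * x" n] by metis
qed

lemma norm_unit_exp: "norm (unit_exp x) = exp (- 2 * pi * Im x)"
  by (simp add: unit_exp_def)

lemma unit_exp_holomorphic [holomorphic_intros]:
  "f holomorphic_on A \<Longrightarrow> (\<lambda>x. unit_exp (f x)) holomorphic_on A"
  unfolding unit_exp_def by (intro holomorphic_intros)

section \<open>Convergence, zeros and functional equation of the infinite product\<close>

context
  fixes q :: complex
  assumes q: "norm q < 1"
begin

lemma euler_prod_convergent: "convergent_prod (\<lambda>n. 1 - q ^ Suc n * w)"
proof -
  have "summable (\<lambda>n. norm (1 - q ^ Suc n * w - 1))"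
    using q by (simp add: norm_mult norm_power summable_mult summable_mult2 summable_geometric mult.assoc)
  then have "abs_convergent_prod (\<lambda>n. 1 - q ^ Suc n * w)"
    by (rule summable_imp_abs_convergent_prod)
  then show ?thesis by (rule abs_convergent_prod_imp_convergent_prod)
qed

lemma euler_prod_holomorphic: "euler_prod q holomorphic_on UNIV"
proof (rule holomorphic_uniform_sequence)
  show "(\<lambda>w. \<Prod>n<N. 1 - q ^ Suc n * w) holomorphic_on UNIV" for N
    by (intro holomorphic_intros)
  \<comment> \<open>On the closed unit disc around \<open>x\<close> the terms are dominated by
    |q|^(n+1) (|x| + 1), so the partial products converge uniformly there.\<close>
  fix x :: complex
  have "uniformly_convergent_on (cball x 1) (\<lambda>N w. \<Sum>n<N. norm (1 - q ^ Suc n * w - 1))"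
  proof (rule Weierstrass_m_test')
    fix n w assume "w \<in> cball x 1"
    then have "norm (w - x) \<le> 1" by (simp add: dist_norm norm_minus_commute)
    then have "norm w \<le> norm x + 1" using norm_triangle_sub[of w x] by linarith
    then show "norm (norm (1 - q ^ Suc n * w - 1)) \<le> norm q ^ Suc n * (norm x + 1)"
      by (simp add: norm_mult norm_power mult_left_mono mult.assoc)
  next
    show "summable (\<lambda>n. norm q ^ Suc n * (norm x + 1))"
      using q by (intro summable_mult2) (simp add: summable_mult summable_geometric)
  qed
  then have "uniformly_convergent_on (cball x 1) (\<lambda>N w. \<Prod>n<N. 1 - q ^ Suc n * w)"
    by (intro uniformly_convergent_on_prod' continuous_intros) auto
  then obtain l where l: "uniform_limit (cball x 1) (\<lambda>N w. \<Prod>n<N. 1 - q ^ Suc n * w) l sequentially"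
    by (auto simp: uniformly_convergent_on_def)
  have "l w = euler_prod q w" if "w \<in> cball x 1" for w
  proof -
    have "(\<lambda>N. \<Prod>n<N. 1 - q ^ Suc n * w) \<longlonglongrightarrow> l w"
      using l that by (rule tendsto_uniform_limitI)
    then have "(\<lambda>N. \<Prod>n\<le>N. 1 - q ^ Suc n * w) \<longlonglongrightarrow> l w"
      unfolding lessThan_Suc_atMost[symmetric] by (rule LIMSEQ_Suc)
    moreover have "(\<lambda>N. \<Prod>n\<le>N. 1 - q ^ Suc n * w) \<longlonglongrightarrow> euler_prod q w"
      unfolding euler_prod_def by (rule convergent_prod_LIMSEQ[OF euler_prod_convergent])
    ultimately show ?thesis by (rule LIMSEQ_unique)
  qed
  then have "uniform_limit (cball x 1) (\<lambda>N w. \<Prod>n<N. 1 - q ^ Suc n * w) (euler_prod q) sequentially"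
    using l by (subst uniform_limit_cong'[where g = "\<lambda>N w. \<Prod>n<N. 1 - q ^ Suc n * w" and i = l]) auto
  then show "\<exists>d>0. cball x d \<subseteq> UNIV \<and>
      uniform_limit (cball x d) (\<lambda>N w. \<Prod>n<N. 1 - q ^ Suc n * w) (euler_prod q) sequentially"
    by (intro exI[of _ 1]) auto
qed auto

lemma euler_prod_eq_0_iff: "euler_prod q w = 0 \<longleftrightarrow> (\<exists>n. q ^ Suc n * w = 1)"
proof -
  have "(\<lambda>n. 1 - q ^ Suc n * w) has_prod euler_prod q w"
    using euler_prod_convergent[of w] by (simp add: euler_prod_def convergent_prod_has_prod_iff)
  then show ?thesis
    using has_prod_eq_0_iff[of "\<lambda>n. 1 - q ^ Suc n * w"] by (auto simp: image_iff)
qed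

lemma euler_prod_step: "euler_prod q w = (1 - q * w) * euler_prod q (q * w)"
\<comment> \<open>Splitting off the head of an infinite product divides by it, so a vanishing first
  factor is treated apart; both sides are then 0.\<close>
proof (cases "1 - q * w = 0")
  case True
  then have "q ^ Suc 0 * w = 1" by simp
  then have "euler_prod q w = 0" unfolding euler_prod_eq_0_iff by blast
  then show ?thesis using True by simp
next
  case False
  then have "(\<Prod>n. 1 - q ^ Suc (Suc n) * w) = euler_prod q w / (1 - q * w)"
    using prodinf_split_head[OF euler_prod_convergent, of w] by (simp add: euler_prod_def)
  moreover have "(\<Prod>n. 1 - q ^ Suc (Suc n) * w) = euler_prod q (q * w)"
    by (simp add: euler_prod_def mult_ac)
  ultimately have "euler_prod q w / (1 - q * w) = euler_prod q (q * w)" by simp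
  then show ?thesis using False by (simp add: divide_eq_eq mult.commute)
qed

end


section \<open>Zeros and quasi-periods of theta\<close>

context
  fixes \<tau> :: complex
  assumes im: "Im \<tau> > 0"
begin

lemma norm_nome_less_1: "norm (unit_exp \<tau>) < 1"
  using im by (simp add: norm_unit_exp)

lemma theta_eq:
  "theta \<tau> x = 2 * unit_exp (\<tau> / 8) * sin (of_real pi * x) *
     (euler_prod (unit_exp \<tau>) 1 * euler_prod (unit_exp \<tau>) (unit_exp x) *
      euler_prod (unit_exp \<tau>) (unit_exp (- x)))"
proof -
  note c = euler_prod_convergent[OF norm_nome_less_1]
  have "(\<Prod>n. (1 - unit_exp \<tau> ^ Suc n) * (1 - unit_exp \<tau> ^ Suc n * unit_exp x) *
             (1 - unit_exp \<tau> ^ Suc n * unit_exp (- x))) =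
      euler_prod (unit_exp \<tau>) 1 * euler_prod (unit_exp \<tau>) (unit_exp x) *
      euler_prod (unit_exp \<tau>) (unit_exp (- x))"
    unfolding euler_prod_def
    using c[of 1] c[of "unit_exp x"] c[of "unit_exp (- x)"]
    by (simp only: prodinf_mult convergent_prod_mult mult_1_right)
  then show ?thesis
    by (simp add: theta_def Let_def unit_exp_def)
qed

lemma theta_holomorphic: "theta \<tau> holomorphic_on UNIV"
proof -
  have "(\<lambda>x. euler_prod (unit_exp \<tau>) (unit_exp (f x))) holomorphic_on UNIV"
    if "f holomorphic_on UNIV" for f
    using holomorphic_on_compose_gen[OF unit_exp_holomorphic[OF that]
        euler_prod_holomorphic[OF norm_nome_less_1]] by (simp add: o_def)
  note this[OF holomorphic_on_ident] this[OF holomorphic_on_minus[OF holomorphic_on_ident]]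
  moreover have "(\<lambda>x. sin (of_real pi * x :: complex)) holomorphic_on UNIV"
    by (intro holomorphic_intros)
  ultimately show ?thesis
    unfolding theta_eq[abs_def] by (intro holomorphic_on_mult holomorphic_on_const)
qed

lemma theta_holomorphic' [holomorphic_intros]:
  "f holomorphic_on A \<Longrightarrow> (\<lambda>x. theta \<tau> (f x)) holomorphic_on A"
  using holomorphic_on_compose_gen[OF _ theta_holomorphic, of f A] by (simp add: o_def)

lemma theta_continuous [continuous_intros]:
  "continuous_on A f \<Longrightarrow> continuous_on A (\<lambda>x. theta \<tau> (f x))"
  using continuous_on_compose2[OF holomorphic_on_imp_continuous_on[OF theta_holomorphic]] by auto

lemma theta_minus: "theta \<tau> (- x) = - theta \<tau> x"
  by (simp add: theta_eq)

lemma theta_0 [simp]: "theta \<tau> 0 = 0"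
  by (simp add: theta_eq)

text \<open>Write h = e(x/2) and t = e(\<tau>/2). The shift removes the factor 1 - q h^2 from one
  product and adds 1 - 1/h^2 to the other; the change of the sine, rational in h and t, absorbs both
  up to the multiplier (\<open>key\<close>).\<close>

lemma theta_plus_tau: "theta \<tau> (x + \<tau>) = - unit_exp (- x - \<tau> / 2) * theta \<tau> x"
proof -
  define q where "q = unit_exp \<tau>"
  define h where "h = unit_exp (x / 2)"
  define t where "t = unit_exp (\<tau> / 2)"
  have nz: "h \<noteq> 0" "t \<noteq> 0" by (auto simp: h_def t_def)
  have h2: "unit_exp x = h ^ 2" and t2: "q = t ^ 2"
    by (simp_all add: h_def t_def q_def power2_eq_square unit_exp_add[symmetric])
  have s: "sin (of_real pi * y) = (unit_exp (y / 2) - unit_exp (- (y / 2))) / (2 * \<i>)" for y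
    by (simp add: sin_exp_eq unit_exp_def algebra_simps)
  have e: "unit_exp (- x - \<tau> / 2) = 1 / (h ^ 2 * t)"
    unfolding unit_exp_diff unit_exp_minus h2 t_def[symmetric] by (simp add: field_simps)
  have half: "(x + \<tau>) / 2 = x / 2 + \<tau> / 2" by (simp add: add_divide_distrib)
  have sh1: "unit_exp (x + \<tau>) = q * h ^ 2" by (simp only: unit_exp_add q_def h2 mult.commute)
  have sh2: "unit_exp ((x + \<tau>) / 2) = h * t" by (simp only: half unit_exp_add h_def t_def)
  have shift: "unit_exp (x + \<tau>) = q * h ^ 2" "unit_exp (- (x + \<tau>)) = 1 / (q * h ^ 2)"
      "unit_exp (- x) = 1 / h ^ 2"
      "unit_exp ((x + \<tau>) / 2) = h * t" "unit_exp (- ((x + \<tau>) / 2)) = 1 / (h * t)"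
      "unit_exp (- (x / 2)) = 1 / h"
    by (simp_all only: unit_exp_minus sh1 sh2 h2 inverse_eq_divide h_def[symmetric])
  have qh: "q \<noteq> 0" using nz t2 by simp
  note step = euler_prod_step[OF norm_nome_less_1, folded q_def]
  have s1: "euler_prod q (h ^ 2) = (1 - q * h ^ 2) * euler_prod q (q * h ^ 2)"
    by (rule step)
  have s2: "euler_prod q (1 / (q * h ^ 2)) = (1 - 1 / h ^ 2) * euler_prod q (1 / h ^ 2)"
    using step[of "1 / (q * h ^ 2)"] qh by simp
  have key: "(h * t - 1 / (h * t)) * (1 - 1 / h ^ 2) = - (1 / (h ^ 2 * t)) * ((h - 1 / h) * (1 - q * h ^ 2))"
    using nz by (simp add: t2 field_simps power2_eq_square)
  have "sin (of_real pi * (x + \<tau>)) * (euler_prod q 1 * euler_prod q (unit_exp (x + \<tau>)) *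
           euler_prod q (unit_exp (- (x + \<tau>)))) =
        (h * t - 1 / (h * t)) * (1 - 1 / h ^ 2) / (2 * \<i>) *
        (euler_prod q 1 * euler_prod q (q * h ^ 2) * euler_prod q (1 / h ^ 2))"
    unfolding s shift s2 by simp
  also have "\<dots> = - (1 / (h ^ 2 * t)) * ((h - 1 / h) / (2 * \<i>) *
        (euler_prod q 1 * euler_prod q (h ^ 2) * euler_prod q (1 / h ^ 2)))"
    unfolding s1 key by simp
  also have "\<dots> = - unit_exp (- x - \<tau> / 2) * (sin (of_real pi * x) *
      (euler_prod q 1 * euler_prod q (unit_exp x) * euler_prod q (unit_exp (- x))))"
    unfolding s shift h2 e h_def[symmetric] by simp
  finally have fin: "sin (of_real pi * (x + \<tau>)) * (euler_prod q 1 * euler_prod q (unit_exp (x + \<tau>)) *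
      euler_prod q (unit_exp (- (x + \<tau>)))) = - unit_exp (- x - \<tau> / 2) * (sin (of_real pi * x) *
      (euler_prod q 1 * euler_prod q (unit_exp x) * euler_prod q (unit_exp (- x))))" .
  show ?thesis
    unfolding theta_eq q_def[symmetric]
    using arg_cong[OF fin, of "\<lambda>y. 2 * unit_exp (\<tau> / 8) * y"]
    by (simp only: mult.assoc mult.left_commute mult_minus_left mult_minus_right)
qed

lemma theta_minus_tau: "theta \<tau> (x - \<tau>) = - unit_exp (x - \<tau> / 2) * theta \<tau> x"
proof -
  have "theta \<tau> (x - \<tau>) = - theta \<tau> (- x + \<tau>)" using theta_minus[of "- x + \<tau>"] by simp
  then show ?thesis unfolding theta_plus_tau theta_minus by simp
qed

lemma theta_plus_int_tau:
  "theta \<tau> (x + of_int n * \<tau>) =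
     (-1) powi n * unit_exp (- of_int n * x - of_int (n\<^sup>2) * \<tau> / 2) * theta \<tau> x"
proof (induction n rule: int_induct[where k = 0])
  case base
  then show ?case by simp
next
  case (step1 i)
  have "theta \<tau> (x + of_int (i + 1) * \<tau>) = theta \<tau> ((x + of_int i * \<tau>) + \<tau>)"
    by (simp add: algebra_simps)
  also have "\<dots> = (-1) powi (i + 1) *
      (unit_exp (- (x + of_int i * \<tau>) - \<tau> / 2) * unit_exp (- of_int i * x - of_int (i\<^sup>2) * \<tau> / 2)) * theta \<tau> x"
    unfolding theta_plus_tau step1 by (simp add: power_int_add)
  also have "unit_exp (- (x + of_int i * \<tau>) - \<tau> / 2) * unit_exp (- of_int i * x - of_int (i\<^sup>2) * \<tau> / 2)
      = unit_exp (- of_int (i + 1) * x - of_int ((i + 1)\<^sup>2) * \<tau> / 2)"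
    unfolding unit_exp_add[symmetric]
    by (rule arg_cong[where f = unit_exp]) (simp add: field_simps power2_eq_square)
  finally show ?case .
next
  case (step2 i)
  have "theta \<tau> (x + of_int (i - 1) * \<tau>) = theta \<tau> ((x + of_int i * \<tau>) - \<tau>)"
    by (simp add: algebra_simps)
  also have "\<dots> = (-1) powi (i - 1) *
      (unit_exp ((x + of_int i * \<tau>) - \<tau> / 2) * unit_exp (- of_int i * x - of_int (i\<^sup>2) * \<tau> / 2)) * theta \<tau> x"
    unfolding theta_minus_tau step2 by (simp add: power_int_diff)
  also have "unit_exp ((x + of_int i * \<tau>) - \<tau> / 2) * unit_exp (- of_int i * x - of_int (i\<^sup>2) * \<tau> / 2)
      = unit_exp (- of_int (i - 1) * x - of_int ((i - 1)\<^sup>2) * \<tau> / 2)"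
    unfolding unit_exp_add[symmetric]
    by (rule arg_cong[where f = unit_exp]) (simp add: field_simps power2_eq_square)
  finally show ?case .
qed

lemma euler_prod_1_nonzero: "euler_prod (unit_exp \<tau>) 1 \<noteq> 0"
proof
  assume "euler_prod (unit_exp \<tau>) 1 = 0"
  then obtain n where "unit_exp \<tau> ^ Suc n = 1"
    using euler_prod_eq_0_iff[OF norm_nome_less_1] by auto
  then have "norm (unit_exp \<tau> ^ Suc n) = 1" by (simp del: power_Suc)
  then have "norm (unit_exp \<tau>) ^ Suc n = 1" by (simp only: norm_power)
  moreover have "norm (unit_exp \<tau>) ^ Suc n < 1"
    using norm_nome_less_1 by (intro power_Suc_less_one) auto
  ultimately show False by simp
qed

text \<open>The factors contribute disjoint sets of exponents n: the sine gives n = 0, the product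
  at e(x) the negative n, the product at e(-x) the positive n. The zeros are described through e(x)
  because genericity will be a condition on points of the torus.\<close>

lemma theta_eq_0_iff: "theta \<tau> x = 0 \<longleftrightarrow> (\<exists>n::int. unit_exp x = unit_exp \<tau> powi n)"
proof -
  define q where "q = unit_exp \<tau>"
  have q0: "q \<noteq> 0" by (simp add: q_def)
  note zero = euler_prod_eq_0_iff[OF norm_nome_less_1, folded q_def]
  have s: "sin (of_real pi * x) = 0 \<longleftrightarrow> unit_exp x = 1"
  proof -
    have "sin (of_real pi * x) = 0 \<longleftrightarrow> (\<exists>n::int. of_real pi * x = of_real pi * of_int n)"
      by (simp only: sin_eq_0 of_real_mult of_real_of_int_eq mult.commute)
    also have "\<dots> \<longleftrightarrow> (\<exists>n::int. x = of_int n)" by simp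
    finally show ?thesis using unit_exp_eq_iff[of x 0] by simp
  qed
  have p: "euler_prod q (unit_exp x) = 0 \<longleftrightarrow> (\<exists>n. unit_exp x = q powi (- int (Suc n)))"
  proof -
    have "q ^ Suc n * unit_exp x = 1 \<longleftrightarrow> unit_exp x = q powi (- int (Suc n))" for n
    proof -
      have "q powi (- int (Suc n)) = 1 / q ^ Suc n"
        by (simp only: power_int_minus power_int_of_nat inverse_eq_divide)
      moreover have "q ^ Suc n \<noteq> 0" using q0 by simp
      ultimately show ?thesis by (metis nonzero_eq_divide_eq mult.commute)
    qed
    then show ?thesis unfolding zero by blast
  qed
  have m: "euler_prod q (unit_exp (- x)) = 0 \<longleftrightarrow> (\<exists>n. unit_exp x = q powi (int (Suc n)))"
  proof -
    have "q ^ Suc n * unit_exp (- x) = 1 \<longleftrightarrow> unit_exp x = q powi (int (Suc n))" for n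
    proof -
      have "unit_exp (- x) = 1 / unit_exp x" by (simp add: unit_exp_minus inverse_eq_divide)
      then show ?thesis by (simp only: power_int_of_nat) (auto simp: divide_eq_eq)
    qed
    then show ?thesis unfolding zero by blast
  qed
  have "theta \<tau> x = 0 \<longleftrightarrow> unit_exp x = q powi 0 \<or> (\<exists>n. unit_exp x = q powi (- int (Suc n)))
      \<or> (\<exists>n. unit_exp x = q powi (int (Suc n)))"
    unfolding theta_eq q_def[symmetric] p[symmetric] m[symmetric]
    using euler_prod_1_nonzero s by (simp add: q_def)
  also have "\<dots> \<longleftrightarrow> (\<exists>n::int. unit_exp x = q powi n)"
  proof
    assume "\<exists>n::int. unit_exp x = q powi n"
    then obtain n where n: "unit_exp x = q powi n" by blast
    consider "n = 0" | k where "n = int (Suc k)" | k where "n = - int (Suc k)"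
      by (metis int_cases negD nonneg_int_cases not0_implies_Suc of_nat_0 linorder_not_less)
    then show "unit_exp x = q powi 0 \<or> (\<exists>n. unit_exp x = q powi (- int (Suc n)))
      \<or> (\<exists>n. unit_exp x = q powi (int (Suc n)))"
      using n by cases blast+
  qed blast
  finally show ?thesis by (simp add: q_def)
qed

text \<open>The zero at 0 sits in the sine, where it is simple; the cofactor \<open>g\<close> is
  holomorphic and its value at 0 is a nonzero multiple of the cube of \<open>euler_prod\<close> at
  1.\<close>

lemma deriv_theta_0_nonzero: "deriv (theta \<tau>) 0 \<noteq> 0"
proof -
  define g where "g x = 2 * unit_exp (\<tau> / 8) *
     (euler_prod (unit_exp \<tau>) 1 * euler_prod (unit_exp \<tau>) (unit_exp x) *
      euler_prod (unit_exp \<tau>) (unit_exp (- x)))" for x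
  have comp: "(\<lambda>x. euler_prod (unit_exp \<tau>) (unit_exp (f x))) holomorphic_on UNIV"
    if "f holomorphic_on UNIV" for f
    using holomorphic_on_compose_gen[OF unit_exp_holomorphic[OF that]
        euler_prod_holomorphic[OF norm_nome_less_1]] by (simp add: o_def)
  have "g holomorphic_on UNIV"
    unfolding g_def using comp[OF holomorphic_on_ident] comp[OF holomorphic_on_minus[OF holomorphic_on_ident]]
    by (intro holomorphic_on_mult holomorphic_on_const)
  then obtain g' where g': "(g has_field_derivative g') (at 0)"
    by (auto simp: holomorphic_on_def field_differentiable_def)
  have "theta \<tau> = (\<lambda>x. sin (of_real pi * x) * g x)"
    by (auto simp: theta_eq g_def)
  moreover have "((\<lambda>x. sin (of_real pi * x) * g x) has_field_derivative of_real pi * g 0) (at 0)"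
    by (rule derivative_eq_intros g' refl | simp)+
  ultimately have "deriv (theta \<tau>) 0 = of_real pi * g 0"
    by (simp add: DERIV_imp_deriv)
  then show ?thesis using euler_prod_1_nonzero by (simp add: g_def)
qed

text \<open>A real shift keeps the modulus of e(x), whereas distinct powers of q have distinct
  moduli. Two zeros would thus belong to the same power, and t would be an integer. All density
  arguments leave the zeros of theta in this direction.\<close>

lemma theta_eq_0_real_shift:
  assumes "theta \<tau> x = 0" "0 < t" "t < 1"
  shows "theta \<tau> (x + of_real t) \<noteq> 0"
proof
  assume "theta \<tau> (x + of_real t) = 0"
  with assms obtain n k :: int where nk: "unit_exp x = unit_exp \<tau> powi n"
      "unit_exp (x + of_real t) = unit_exp \<tau> powi k"
    by (auto simp: theta_eq_0_iff)
  have "norm (unit_exp (x + of_real t)) = norm (unit_exp x)" by (simp add: norm_unit_exp)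
  then have "norm (unit_exp \<tau>) powi n = norm (unit_exp \<tau>) powi k"
    unfolding nk by (simp add: norm_power_int)
  then have "n = k"
    using norm_nome_less_1 power_int_strict_decreasing[of n k "norm (unit_exp \<tau>)"]
      power_int_strict_decreasing[of k n "norm (unit_exp \<tau>)"]
    by (cases n k rule: linorder_cases) auto
  then have "unit_exp (of_real t) = unit_exp 0"
    using nk by (simp add: unit_exp_add)
  then obtain j :: int where "complex_of_real t = of_int j"
    unfolding unit_exp_eq_iff by auto
  then have "t = of_int j" by (metis of_real_eq_iff of_real_of_int_eq)
  with assms show False by auto
qed

end

section \<open>Weierstrass' three-term identity\<close>

text \<open>The zeros of \<open>D\<close> are simple and are zeros of \<open>N\<close>, so the
  singularities of N/D are removable; the value filled in is that of de l'Hospital's rule.\<close>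

lemma quotient_entire:
  assumes N: "N holomorphic_on UNIV" and D: "D holomorphic_on UNIV"
    and zero: "\<And>a. D a = 0 \<Longrightarrow> N a = 0 \<and> deriv D a \<noteq> 0"
  shows "(\<lambda>x. if D x = 0 then deriv N x / deriv D x else N x / D x) holomorphic_on UNIV"
    (is "?g holomorphic_on UNIV")
proof -
  have "?g field_differentiable (at a)" for a
  proof -
    have "\<exists>T h. open T \<and> a \<in> T \<and> h holomorphic_on T \<and> (\<forall>x\<in>T. ?g x = h x)"
    proof (cases "D a = 0")
      case False
      have "open {x. D x \<noteq> 0}"
        using holomorphic_on_imp_continuous_on[OF D] by (intro open_Collect_neq) auto
      moreover have "(\<lambda>x. N x / D x) holomorphic_on {x. D x \<noteq> 0}"
        using N D by (intro holomorphic_on_divide) (auto intro: holomorphic_on_subset)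
      ultimately show ?thesis
        using False by (intro exI[of _ "{x. D x \<noteq> 0}"] exI[of _ "\<lambda>x. N x / D x"]) auto
    next
      case True
      \<comment> \<open>Dividing numerator and denominator by z - a leaves entire functions with
        \<open>D1 a\<close> = D'(a) \<noteq> 0. Their quotient agrees with the given function
        wherever \<open>D1\<close> does not vanish, also at a itself.\<close>
      define N1 D1 where "N1 = (\<lambda>z. if z = a then deriv N a else (N z - N a) / (z - a))"
        and "D1 = (\<lambda>z. if z = a then deriv D a else (D z - D a) / (z - a))"
      have h: "N1 holomorphic_on UNIV" "D1 holomorphic_on UNIV"
        unfolding N1_def D1_def by (rule pole_lemma[OF N] pole_lemma[OF D]; simp)+
      have "open {x. D1 x \<noteq> 0}"
        using holomorphic_on_imp_continuous_on[OF h(2)] by (intro open_Collect_neq) auto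
      moreover have "(\<lambda>x. N1 x / D1 x) holomorphic_on {x. D1 x \<noteq> 0}"
        using h by (intro holomorphic_on_divide) (auto intro: holomorphic_on_subset)
      moreover have "?g x = N1 x / D1 x" if "D1 x \<noteq> 0" for x
        using that True zero[OF True] by (auto simp: N1_def D1_def)
      ultimately show ?thesis
        using zero[OF True]
        by (intro exI[of _ "{x. D1 x \<noteq> 0}"] exI[of _ "\<lambda>x. N1 x / D1 x"]) (auto simp: D1_def)
    qed
    then obtain T h where T: "open T" "a \<in> T" "h holomorphic_on T" "\<forall>x\<in>T. ?g x = h x" by blast
    then have "?g holomorphic_on T" by (simp cong: holomorphic_cong)
    then show ?thesis using T by (simp add: holomorphic_on_open field_differentiable_def)
  qed
  then show ?thesis
    by (auto simp: holomorphic_on_def field_differentiable_at_within)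
qed

text \<open>At a zero of \<open>N\<close> the derivative of \<open>u\<close> drops out of the
  product rule. So the values filled in by \<open>quotient_entire\<close> are periodic as
  well.\<close>

lemma deriv_quasiperiodic:
  assumes N: "N holomorphic_on UNIV" and u: "u holomorphic_on UNIV"
    and per: "\<And>x. N (x + p) = u x * N x" and "N x = 0"
  shows "deriv N (x + p) = u x * deriv N x"
proof -
  have N': "(N has_field_derivative deriv N y) (at y)" for y
    using N by (rule holomorphic_derivI) auto
  have u': "(u has_field_derivative deriv u y) (at y)" for y
    using u by (rule holomorphic_derivI) auto
  have "((\<lambda>x. N (x + p)) has_field_derivative deriv N (x + p)) (at x)"
    using N'[of "x + p"] by (simp add: DERIV_shift)
  moreover have "((\<lambda>x. u x * N x) has_field_derivative (deriv u x * N x + deriv N x * u x)) (at x)"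
    by (intro DERIV_mult u' N')
  ultimately show ?thesis
    unfolding per using \<open>N x = 0\<close> by (metis DERIV_unique add_0 mult.commute mult_zero_left)
qed

lemma doubly_periodic_constant:
  assumes g: "g holomorphic_on UNIV" and im: "Im \<tau> > 0"
    and per: "\<And>x. g (x + 1) = g x" "\<And>x. g (x + \<tau>) = g x"
  obtains c where "\<And>x. g x = c"
proof -
  have int_per: "g (x + of_int n * p) = g x" if "\<And>x. g (x + p) = g x" for x n p
  proof (induction n rule: int_induct[where k = 0])
    case (step1 i)
    then show ?case using that[of "x + of_int i * p"] by (simp add: algebra_simps)
  next
    case (step2 i)
    then show ?case using that[of "x + of_int i * p - p"] by (simp add: algebra_simps)
  qed simp
  \<comment> \<open>A fundamental parallelogram: its compactness makes \<open>g\<close> bounded, and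
    Liouville's theorem applies.\<close>
  define K where "K = (\<lambda>(a, b). of_real a + of_real b * \<tau>) ` ({0..1} \<times> {0..1 :: real})"
  have "compact K"
    unfolding K_def case_prod_unfold
    by (intro compact_continuous_image compact_Times continuous_intros) auto
  then have "compact (g ` K)"
    using holomorphic_on_imp_continuous_on[OF g]
    by (intro compact_continuous_image) (auto intro: continuous_on_subset)
  moreover have "range g \<subseteq> g ` K"
  proof safe
    fix x
    define b where "b = Im x / Im \<tau>"
    define a where "a = Re x - b * Re \<tau>"
    have x: "x = of_real a + of_real b * \<tau>"
      using im by (simp add: complex_eq_iff a_def b_def)
    define y where "y = of_real (frac a) + of_real (frac b) * \<tau>"
    have "x = (y + of_int \<lfloor>b\<rfloor> * \<tau>) + of_int \<lfloor>a\<rfloor> * 1"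
      unfolding x y_def frac_def by (simp add: algebra_simps)
    then have "g x = g y"
      using int_per[OF per(1)] int_per[OF per(2)] by metis
    moreover have "y \<in> K"
      unfolding K_def y_def using frac_lt_1 frac_ge_0 by (force intro: less_imp_le)
    ultimately show "g x \<in> g ` K" by blast
  qed
  ultimately have "bounded (range g)"
    using bounded_subset compact_imp_bounded by blast
  then have "g constant_on UNIV" by (rule Liouville_theorem[OF g])
  then show ?thesis using that by (auto simp: constant_on_def)
qed

text \<open>The quotient is entire and doubly periodic, hence constant. A theta identity is thereby
  reduced to comparing multipliers, zeros and one value.\<close>

lemma proportional_of_same_multipliers:
  assumes N: "N holomorphic_on UNIV" and D: "D holomorphic_on UNIV"
    and zero: "\<And>a. D a = 0 \<Longrightarrow> N a = 0 \<and> deriv D a \<noteq> 0"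
    and im: "Im \<tau> > 0"
    and u: "u holomorphic_on UNIV" "\<And>x. u x \<noteq> 0"
    and per1: "\<And>x. N (x + 1) = N x" "\<And>x. D (x + 1) = D x"
    and per2: "\<And>x. N (x + \<tau>) = u x * N x" "\<And>x. D (x + \<tau>) = u x * D x"
  obtains c where "\<And>x. N x = c * D x"
proof -
  define g where "g x = (if D x = 0 then deriv N x / deriv D x else N x / D x)" for x
  have per: "g (x + p) = g x"
    if v: "v holomorphic_on UNIV" "\<And>x. v x \<noteq> 0"
      and p: "\<And>x. N (x + p) = v x * N x" "\<And>x. D (x + p) = v x * D x" for v p x
  proof (cases "D x = 0")
    case True
    then show ?thesis
      using zero[OF True] deriv_quasiperiodic[OF N v(1) p(1), of x] deriv_quasiperiodic[OF D v(1) p(2), of x]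
        v(2)[of x] p(2)[of x] by (simp add: g_def)
  next
    case False
    then show ?thesis using v(2)[of x] p[of x] by (simp add: g_def)
  qed
  have "g holomorphic_on UNIV"
    unfolding g_def[abs_def] by (rule quotient_entire[OF N D zero])
  moreover have "g (x + 1) = g x" for x
    by (rule per[of "\<lambda>_. 1"]) (use per1 in auto)
  moreover have "g (x + \<tau>) = g x" for x
    by (rule per[of u]) (use per2 u in auto)
  ultimately obtain c where c: "\<And>x. g x = c"
    using doubly_periodic_constant[OF _ im] by metis
  have "N x = c * D x" for x
    using c[of x] zero[of x] by (auto simp: g_def field_simps split: if_splits)
  then show ?thesis by (rule that)
qed

context
  fixes \<tau> :: complex
  assumes im: "Im \<tau> > 0"
begin

private abbreviation (input) th_pair :: "complex \<Rightarrow> complex \<Rightarrow> complex" where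
  "th_pair x z \<equiv> theta \<tau> (x + z) * theta \<tau> (x - z)"

lemma theta_zero_form:
  assumes "theta \<tau> x = 0"
  obtains k n :: int where "x = of_int n * \<tau> + of_int k"
proof -
  obtain n :: int where "unit_exp x = unit_exp (of_int n * \<tau>)"
    using assms by (auto simp: theta_eq_0_iff[OF im] unit_exp_of_int_mult)
  then show ?thesis using that unfolding unit_exp_eq_iff by blast
qed

lemma theta_shift:
  fixes k n :: int
  shows "theta \<tau> (x + (of_int n * \<tau> + of_int k)) =
    (-1) powi (n + k) * unit_exp (- of_int n * x - of_int (n\<^sup>2) * \<tau> / 2) * theta \<tau> x"
proof -
  have "theta \<tau> (x + (of_int n * \<tau> + of_int k)) = theta \<tau> ((x + of_int n * \<tau>) + of_int k)"
    by (simp add: algebra_simps)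
  then show ?thesis
    unfolding theta_plus_int theta_plus_int_tau[OF im] by (simp add: power_int_add mult_ac)
qed

text \<open>The signs of the two factors cancel, and so do the parts of the exponents that are
  linear in z. The multiplier is therefore independent of z, and sums of \<open>th_pair\<close>
  terms with different z stay quasi-periodic in x.\<close>

lemma theta_pair_shift:
  fixes k n :: int
  defines "l \<equiv> of_int n * \<tau> + of_int k"
  shows "th_pair (x + l) z =
    unit_exp (- of_int (2 * n) * x - of_int (n\<^sup>2) * \<tau>) * th_pair x z"
proof -
  have s: "x + l + z = (x + z) + l" "x + l - z = (x - z) + l" by simp_all
  have sg: "(-1) powi (n + k) * (-1) powi (n + k) = (1 :: complex)"
    by (simp flip: power_int_mult_distrib)
  have e: "unit_exp (- of_int n * (x + z) - of_int (n\<^sup>2) * \<tau> / 2) *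
      unit_exp (- of_int n * (x - z) - of_int (n\<^sup>2) * \<tau> / 2) = unit_exp (- of_int (2 * n) * x - of_int (n\<^sup>2) * \<tau>)"
    unfolding unit_exp_add[symmetric] by (rule arg_cong[where f = unit_exp]) (simp add: algebra_simps)
  have "th_pair (x + l) z = ((-1) powi (n + k) * (-1) powi (n + k)) *
     (unit_exp (- of_int n * (x + z) - of_int (n\<^sup>2) * \<tau> / 2) *
      unit_exp (- of_int n * (x - z) - of_int (n\<^sup>2) * \<tau> / 2)) * th_pair x z"
    unfolding s unfolding l_def theta_shift by (simp only: mult_ac)
  then show ?thesis unfolding sg e by simp
qed

text \<open>Quasi-periodicity carries the nonzero derivative at 0 to every lattice point.\<close>

lemma theta_simple_zero:
  assumes "theta \<tau> a = 0"
  shows "deriv (theta \<tau>) a \<noteq> 0"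
proof -
  obtain k n :: int where a: "a = of_int n * \<tau> + of_int k"
    using theta_zero_form[OF assms] by metis
  define u where "u x = (-1) powi (n + k) * unit_exp (- of_int n * x - of_int (n\<^sup>2) * \<tau> / 2)" for x
  have u: "u holomorphic_on UNIV" unfolding u_def by (intro holomorphic_intros)
  have "deriv (theta \<tau>) (0 + a) = u 0 * deriv (theta \<tau>) 0"
    by (rule deriv_quasiperiodic[OF theta_holomorphic[OF im] u])
       (simp_all add: theta_shift a u_def theta_0[OF im])
  then show ?thesis using deriv_theta_0_nonzero[OF im] by (simp add: u_def)
qed

text \<open>Removes genericity hypotheses from an identity. Only small positive real displacements
  are inspected, since \<open>theta_eq_0_real_shift\<close> excludes zeros in that
  direction.\<close>

lemma eq_of_eq_generic:
  fixes f g :: "complex \<Rightarrow> complex"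
  assumes "continuous_on UNIV f" "continuous_on UNIV g"
    and eq: "\<And>t. 0 < t \<Longrightarrow> t < d \<Longrightarrow> f (x + of_real t) = g (x + of_real t)" and d: "d > (0::real)"
  shows "f x = g x"
proof -
  have *: "((\<lambda>t. x + of_real t) \<longlongrightarrow> x + of_real 0) (at_right (0::real))"
    by (intro tendsto_intros)
  have c: "isCont f x" "isCont g x" using assms by (auto simp: continuous_on_eq_continuous_at)
  have f: "((\<lambda>t. f (x + of_real t)) \<longlongrightarrow> f x) (at_right 0)"
    using isCont_tendsto_compose[OF c(1), of "\<lambda>t. x + of_real t" "at_right 0"] * by simp
  have g: "((\<lambda>t. g (x + of_real t)) \<longlongrightarrow> g x) (at_right 0)"
    using isCont_tendsto_compose[OF c(2), of "\<lambda>t. x + of_real t" "at_right 0"] * by simp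
  have "eventually (\<lambda>t. f (x + of_real t) = g (x + of_real t)) (at_right 0)"
    using eq d by (auto simp: eventually_at_right_field)
  then have "((\<lambda>t. g (x + of_real t)) \<longlongrightarrow> f x) (at_right 0)"
    using f by (simp cong: tendsto_cong)
  then show ?thesis using g tendsto_unique by (metis trivial_limit_at_right_real)
qed

text \<open>As functions of x both sides have the same multipliers. The zeros of \<open>D\<close>
  are y and -y modulo the lattice, simple because theta(2 y) \<noteq> 0, and \<open>N\<close>
  vanishes there too; hence N = c D. At x = z the factor theta(0) kills the first term of
  \<open>N\<close>, which determines c.\<close>

lemma theta_identity_generic:
  assumes y: "theta \<tau> (2 * y) \<noteq> 0" and zy: "theta \<tau> (z + y) \<noteq> 0" "theta \<tau> (z - y) \<noteq> 0"
  shows "th_pair x z * th_pair y w -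
         th_pair x w * th_pair y z =
         th_pair x y * th_pair z w"
proof -
  define N where "N x = th_pair x z * th_pair y w -
         th_pair x w * th_pair y z" for x
  define D where "D x = th_pair x y" for x
  note th = theta_holomorphic'[OF im]
  have hol: "N holomorphic_on UNIV" "D holomorphic_on UNIV"
    unfolding N_def D_def by (intro holomorphic_intros th)+
  define u where "u n x = unit_exp (- of_int (2 * n) * x - of_int (n\<^sup>2) * \<tau>)" for x and n :: int
  have per: "N (x + (of_int n * \<tau> + of_int k)) = u n x * N x"
      "D (x + (of_int n * \<tau> + of_int k)) = u n x * D x" for x and n k :: int
    unfolding N_def D_def theta_pair_shift u_def[symmetric] by (simp_all only: algebra_simps)
  have N0: "N y = 0" "N (- y) = 0"
  proof -
    have m: "th_pair (- y) v = th_pair y v" for v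
      using theta_minus[OF im, of "y - v"] theta_minus[OF im, of "y + v"] by simp
    show "N y = 0" by (simp add: N_def)
    show "N (- y) = 0" unfolding N_def m by simp
  qed
  have D': "deriv D a = deriv (theta \<tau>) (a + y) * theta \<tau> (a - y) + theta \<tau> (a + y) * deriv (theta \<tau>) (a - y)" for a
  proof -
    have t: "(theta \<tau> has_field_derivative deriv (theta \<tau>) v) (at v)" for v
      using theta_holomorphic[OF im] by (rule holomorphic_derivI) auto
    have "((\<lambda>x. theta \<tau> (x + y)) has_field_derivative deriv (theta \<tau>) (a + y)) (at a)"
      using t[of "a + y"] by (simp add: DERIV_shift)
    moreover have "((\<lambda>x. theta \<tau> (x - y)) has_field_derivative deriv (theta \<tau>) (a - y)) (at a)"
      using t[of "a - y"] DERIV_shift[of "theta \<tau>" _ a "- y"] by simp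
    ultimately show ?thesis
      unfolding D_def by (intro DERIV_imp_deriv) (auto intro!: derivative_eq_intros)
  qed
  have zero: "N a = 0 \<and> deriv D a \<noteq> 0" if Da: "D a = 0" for a
  proof -
    consider "theta \<tau> (a - y) = 0" | "theta \<tau> (a + y) = 0"
      using Da by (auto simp: D_def)
    then show ?thesis
    proof cases
      case 1
      then obtain k n :: int where kn: "a - y = of_int n * \<tau> + of_int k" by (rule theta_zero_form)
      then have a: "a = y + (of_int n * \<tau> + of_int k)" by (simp add: algebra_simps)
      have "a + y = 2 * y + (of_int n * \<tau> + of_int k)" using a by simp
      then have "theta \<tau> (a + y) \<noteq> 0" using y by (simp only: theta_shift) simp
      then show ?thesis
        using 1 theta_simple_zero[OF 1] N0 per(1)[of y n k] a by (simp add: D')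
    next
      case 2
      then obtain k n :: int where kn: "a + y = of_int n * \<tau> + of_int k" by (rule theta_zero_form)
      then have a: "a = - y + (of_int n * \<tau> + of_int k)" by (simp add: algebra_simps)
      have "a - y = - (2 * y) + (of_int n * \<tau> + of_int k)" using a by simp
      then have "theta \<tau> (a - y) \<noteq> 0" using y by (simp only: theta_shift theta_minus[OF im]) simp
      then show ?thesis
        using 2 theta_simple_zero[OF 2] N0 per(1)[of "- y" n k] a by (simp add: D')
    qed
  qed
  obtain c where c: "\<And>x. N x = c * D x"
  proof (rule proportional_of_same_multipliers[OF hol zero im, of "u 1"])
    show "u 1 holomorphic_on UNIV" unfolding u_def by (intro holomorphic_intros)
    show "N (x + 1) = N x" "D (x + 1) = D x" for x
      using per[of x 0 1] by (simp_all add: u_def)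
    show "N (x + \<tau>) = u 1 x * N x" "D (x + \<tau>) = u 1 x * D x" for x
      using per[of x 1 0] by simp_all
  qed (auto simp: u_def)
  have yz: "theta \<tau> (y - z) = - theta \<tau> (z - y)" "theta \<tau> (y + z) = theta \<tau> (z + y)"
    using theta_minus[OF im, of "z - y"] by (simp_all add: add.commute)
  have "th_pair z w * D z = c * D z"
    using c[of z] by (simp add: N_def D_def yz theta_0[OF im])
  then have "c = th_pair z w" using zy by (simp add: D_def)
  then show ?thesis using c[of x] by (simp add: N_def D_def mult_ac)
qed

theorem theta_three_term:
  "th_pair x z * th_pair y w -
   th_pair x w * th_pair y z =
   th_pair x y * th_pair z w"
proof -
  \<comment> \<open>Short segments without zeros: if a is a zero they come from the real shift,
    where t < 1/2 keeps 2 t below 1; otherwise they come from continuity.\<close>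
  have near: "\<exists>d>0. \<forall>t. 0 < t \<longrightarrow> t < d \<longrightarrow> theta \<tau> (a + c * of_real t) \<noteq> 0" 
    if "c = 1 \<or> c = 2 \<or> c = -1" for a c
  proof (cases "theta \<tau> a = 0")
    case True
    have "theta \<tau> (a + c * of_real t) \<noteq> 0" if "0 < t" "t < 1 / 2" for t :: real
    proof -
      consider "c = 1" | "c = 2" | "c = -1" using \<open>c = 1 \<or> c = 2 \<or> c = -1\<close> by blast
      then show ?thesis
      proof cases
        case 1
        then show ?thesis using theta_eq_0_real_shift[OF im True, of t] that by simp
      next
        case 2
        then show ?thesis using theta_eq_0_real_shift[OF im True, of "2 * t"] that by simp
      next
        case 3
        then show ?thesis
          using theta_eq_0_real_shift[OF im, of "- a" t] True that theta_minus[OF im, of a]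
            theta_minus[OF im, of "a + c * of_real t"] by simp
      qed
    qed
    then show ?thesis by (intro exI[of _ "1/2"]) auto
  next
    case False
    have "isCont (\<lambda>t::real. theta \<tau> (a + c * of_real t)) 0"
      using theta_continuous[OF im, of UNIV "\<lambda>t::real. a + c * of_real t"]
      by (auto simp: continuous_on_eq_continuous_at intro!: continuous_intros)
    then have "((\<lambda>t::real. theta \<tau> (a + c * of_real t)) \<longlongrightarrow> theta \<tau> a) (at 0)"
      by (simp add: isCont_def)
    then have "eventually (\<lambda>t::real. theta \<tau> (a + c * of_real t) \<noteq> 0) (at 0)"
      using False by (rule tendsto_imp_eventually_ne)
    then obtain d where "d > 0" "\<And>t. t \<noteq> 0 \<Longrightarrow> dist t 0 < d \<Longrightarrow> theta \<tau> (a + c * of_real t) \<noteq> 0"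
      unfolding eventually_at by auto
    then show ?thesis by (intro exI[of _ d]) auto
  qed
  note cont = continuous_intros theta_continuous[OF im]
  \<comment> \<open>Here only z is moved into general position; the condition on y is removed in the
    same manner afterwards.\<close>
  have *: "th_pair x z * th_pair y w -
   th_pair x w * th_pair y z =
   th_pair x y * th_pair z w"
    if y: "theta \<tau> (2 * y) \<noteq> 0" for y
  proof -
    obtain d1 where d1: "d1 > 0" "\<forall>t. 0 < t \<longrightarrow> t < d1 \<longrightarrow> theta \<tau> (z + y + 1 * of_real t) \<noteq> 0" using near by blast
    obtain d2 where d2: "d2 > 0" "\<forall>t. 0 < t \<longrightarrow> t < d2 \<longrightarrow> theta \<tau> (z - y + 1 * of_real t) \<noteq> 0" using near by blast
    show ?thesis
    proof (rule eq_of_eq_generic[where x = z and d = "min d1 d2" and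
          f = "\<lambda>z. th_pair x z * th_pair y w -
            th_pair x w * th_pair y z"
          and g = "\<lambda>z. th_pair x y * th_pair z w"])
      fix t :: real assume t: "0 < t" "t < min d1 d2"
      have "theta \<tau> (z + of_real t + y) \<noteq> 0" "theta \<tau> (z + of_real t - y) \<noteq> 0"
        using d1 d2 t by (auto simp: algebra_simps)
      from theta_identity_generic[OF y this]
      show "th_pair x (z + of_real t) * th_pair y w -
            th_pair x w * (th_pair y (z + of_real t)) =
            th_pair x y * th_pair (z + of_real t) w" .
    qed (use d1 d2 in \<open>auto intro!: cont\<close>)
  qed
  obtain d where d: "d > 0" "\<forall>t. 0 < t \<longrightarrow> t < d \<longrightarrow> theta \<tau> (2 * y + 2 * of_real t) \<noteq> 0" using near by blast
  show ?thesis
  proof (rule eq_of_eq_generic[where x = y and d = d and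
        f = "\<lambda>y. th_pair x z * th_pair y w -
            th_pair x w * th_pair y z"
        and g = "\<lambda>y. th_pair x y * th_pair z w"])
    fix t :: real assume t: "0 < t" "t < d"
    show "th_pair x z * th_pair (y + of_real t) w -
            th_pair x w * th_pair (y + of_real t) z =
            th_pair x (y + of_real t) * th_pair z w"
      by (rule *) (use d t in \<open>simp add: distrib_left\<close>)
  qed (use d in \<open>auto intro!: cont\<close>)
qed

end

section \<open>The functional equations of the Kronecker function\<close>

context
  fixes \<tau> :: complex
  assumes im: "Im \<tau> > 0"
begin

private abbreviation (input) th :: "complex \<Rightarrow> complex" where
  "th \<equiv> theta \<tau>"

private abbreviation (input) kron :: "complex \<Rightarrow> complex \<Rightarrow> complex" where
  "kron \<equiv> F_ell \<tau>"

text \<open>The arguments are the half-sums and half-differences of P, Q and of R, S. In this form a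
  product of four theta values, as it arises from clearing denominators, is matched directly by the
  choice of P, Q, R, S.\<close>

lemma theta_three_term_symmetric:
  assumes "2 * T = P + Q + R + S"
  shows "th P * th Q * th R * th S -
         th (T - P) * th (T - Q) * th (T - R) * th (T - S) =
         th T * th (P + Q - T) * th (P + R - T) * th (P + S - T)"
proof -
  have T: "T = (P + Q + R + S) / 2" using assms by (simp add: field_simps)
  have e: "(P + Q) / 2 + (P - Q) / 2 = P" "(P + Q) / 2 - (P - Q) / 2 = Q"
    "(R + S) / 2 + (R - S) / 2 = R" "(R + S) / 2 - (R - S) / 2 = S"
    "(P + Q) / 2 + (R - S) / 2 = T - S" "(P + Q) / 2 - (R - S) / 2 = T - R"
    "(R + S) / 2 + (P - Q) / 2 = T - Q" "(R + S) / 2 - (P - Q) / 2 = T - P"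
    "(P + Q) / 2 + (R + S) / 2 = T" "(P + Q) / 2 - (R + S) / 2 = P + Q - T"
    "(P - Q) / 2 + (R - S) / 2 = P + R - T" "(P - Q) / 2 - (R - S) / 2 = P + S - T"
    unfolding T by (simp_all add: field_simps)
  show ?thesis
    using theta_three_term[OF im, of "(P + Q) / 2" "(P - Q) / 2" "(R + S) / 2" "(R - S) / 2"]
    unfolding e by (simp only: mult_ac)
qed

lemma F_ell_minus_left:
  "kron (- x) y = - (deriv (th) 0 * th (y - x) / (th x * th y))"
  by (simp add: F_ell_def theta_minus[OF im])

text \<open>After clearing denominators this is the symmetric identity with T = x + y + a + b. It
  governs the coefficients of the two simple reflections in the braid relation.\<close>

lemma F_ell_fay:
  assumes nz: "th x \<noteq> 0" "th y \<noteq> 0" "th (x + y) \<noteq> 0"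
    "th a \<noteq> 0" "th b \<noteq> 0" "th (a + b) \<noteq> 0"
  shows "kron x a * kron y (a + b) + kron (x + y) (a + b) * kron (- x) b =
         kron y b * kron (x + y) a"
proof -
  define K where "K = deriv (th) 0"
  have arg: "(x + y + a + b) - (x + a) = y + b" "(x + y + a + b) - (y + a + b) = x"
    "(x + y + a + b) - (x + y) = a + b" "(x + y + a + b) - b = x + y + a"
    "(x + a) + (y + a + b) - (x + y + a + b) = a" "(x + a) + (x + y) - (x + y + a + b) = - (b - x)"
    "(x + a) + b - (x + y + a + b) = - y" by simp_all
  have four: "th (x + a) * th (y + a + b) * th (x + y) * th b -
      th (y + b) * th x * th (a + b) * th (x + y + a) =
      th (x + y + a + b) * th a * th (b - x) * th y"
    using theta_three_term_symmetric[of "x + y + a + b" "x + a" "y + a + b" "x + y" b]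
    unfolding arg theta_minus[OF im] by simp
  have ass: "y + (a + b) = y + a + b" "x + y + (a + b) = x + y + a + b" by simp_all
  show ?thesis
    unfolding F_ell_minus_left unfolding F_ell_def K_def[symmetric] ass
    using nz by (simp add: divide_simps) (use four in algebra)
qed

text \<open>The product F(x, h) F(-x, h) is wp(h) - wp(x) for the Weierstrass function wp of the
  lattice Z + \<tau> Z, so h drops out of the difference.\<close>

lemma F_ell_weierstrass_difference:
  assumes nz: "th x \<noteq> 0" "th y \<noteq> 0" "th h \<noteq> 0"
  shows "kron (- x) h * kron x h - kron (- y) h * kron y h =
    (deriv (th) 0)\<^sup>2 * th (x + y) * th (x - y) / ((th x)\<^sup>2 * (th y)\<^sup>2)"
proof -
  define K where "K = deriv (th) 0"
  have three: "th (h + y) * th (h - y) * (th x * th x) -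
      th h * th h * (th (x + y) * th (x - y)) =
      th (h + x) * th (h - x) * (th y * th y)"
    using theta_three_term[OF im, of h y x 0] by simp
  have comm: "th (x + h) = th (h + x)" "th (y + h) = th (h + y)"
    by (simp_all add: add.commute)
  show ?thesis
    unfolding F_ell_minus_left unfolding F_ell_def K_def[symmetric] comm
    using nz by (simp add: divide_simps power2_eq_square) (use three in algebra)
qed

text \<open>The coefficient of f(p) in the braid relation. Here h occurs only in the difference of
  \<open>F_ell_weierstrass_difference\<close>, so the claim becomes an identity without h.\<close>

lemma F_ell_braid:
  assumes nz: "th x \<noteq> 0" "th y \<noteq> 0" "th (x + y) \<noteq> 0" "th h \<noteq> 0"
    "th a \<noteq> 0" "th b \<noteq> 0" "th (a + b) \<noteq> 0"
  shows "kron x a * kron x b * kron y (a + b) + kron (- x) h * kron x h * kron (x + y) (a + b) =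
         kron y a * kron y b * kron x (a + b) + kron (- y) h * kron y h * kron (x + y) (a + b)"
proof -
  define K where "K = deriv (th) 0"
  have arg: "(x + y + (a + b)) - (y + a) = x + b" "(x + y + (a + b)) - (y + b) = x + a"
    "(x + y + (a + b)) - (x + (a + b)) = y" "(x + y + (a + b)) - x = y + (a + b)"
    "(y + a) + (y + b) - (x + y + (a + b)) = - (x - y)" "(y + a) + (x + (a + b)) - (x + y + (a + b)) = a"
    "(y + a) + x - (x + y + (a + b)) = - b" by simp_all
  have four: "th (y + a) * th (y + b) * th (x + (a + b)) * th x -
      th (x + b) * th (x + a) * th y * th (y + (a + b)) =
      th (x + y + (a + b)) * th (x - y) * th a * th b"
    using theta_three_term_symmetric[of "x + y + (a + b)" "y + a" "y + b" "x + (a + b)" x]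
    unfolding arg theta_minus[OF im] by simp
  have "kron y a * kron y b * kron x (a + b) - kron x a * kron x b * kron y (a + b) =
      (K\<^sup>2 * th (x + y) * th (x - y) / ((th x)\<^sup>2 * (th y)\<^sup>2)) * kron (x + y) (a + b)"
    unfolding F_ell_def K_def[symmetric]
    using nz by (simp add: divide_simps power2_eq_square) (use four in algebra)
  also have "\<dots> = (kron (- x) h * kron x h - kron (- y) h * kron y h) * kron (x + y) (a + b)"
    unfolding F_ell_weierstrass_difference[OF nz(1,2,4)] K_def ..
  finally show ?thesis by (simp add: algebra_simps)
qed

text \<open>A, B, C and D = A + C - B are the values u + x_i - x_j for two neighbouring targets and
  two neighbouring sources. Regrouping separates h from a and b: the bracket with h and the bracket
  with a, b (\<open>i\<close> and \<open>ii\<close>) are products of values of F times the same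
  \<open>W\<close>.\<close>

lemma F_ell_exchange:
  assumes nz: "th A \<noteq> 0" "th B \<noteq> 0" "th C \<noteq> 0" "th (A + C - B) \<noteq> 0"
    "th (B - A) \<noteq> 0" "th (B - C) \<noteq> 0" "th h \<noteq> 0"
    "th a \<noteq> 0" "th b \<noteq> 0" "th (a - b) \<noteq> 0"
  shows "kron (C - B) (a - b) * (kron A a * kron B h * kron C b) +
         kron (B - C) h * (kron (A + C - B) a * kron C h * kron B b) =
         kron (A - B) (a - b) * (kron A b * kron B h * kron C a) +
         kron (B - A) h * (kron B b * kron A h * kron (A + C - B) a)"
proof -
  define K where "K = deriv (th) 0"
  define D where "D = A + C - B"
  define W where "W = K * th B * th D * th (A - C) /
    (th (B - A) * th A * th (B - C) * th C)"
  note nz' = nz[folded D_def]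
  have neg: "th (C - B) = - th (B - C)" "th (A - B) = - th (B - A)"
    "th (C - A) = - th (A - C)"
    using theta_minus[OF im, of "B - C"] theta_minus[OF im, of "B - A"] theta_minus[OF im, of "A - C"] by simp_all
  have "(B + h) - (B - A + h) = A" "(B + h) - (A + h) = B - A" "(B + h) - (B - C) = C + h"
    "(B + h) - C = B - C + h" "(B - A + h) + (A + h) - (B + h) = h"
    "(B - A + h) + (B - C) - (B + h) = - D" "(B - A + h) + C - (B + h) = C - A"
    by (simp_all add: D_def)
  note arg = this
  have one: "th (B - A + h) * th (A + h) * th (B - C) * th C -
      th A * th (B - A) * th (C + h) * th (B - C + h) =
      th (B + h) * th h * th D * th (A - C)"
    using theta_three_term_symmetric[of "B + h" "B - A + h" "A + h" "B - C" C]
    unfolding arg theta_minus[OF im] neg by simp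
  have i: "kron (B - A) h * kron A h - kron (B - C) h * kron C h = kron B h * W"
    unfolding F_ell_def K_def[symmetric] W_def
    using nz' by (simp add: divide_simps) (use one in algebra)
  have "(D + a) - (A - B) = C + a" "(D + a) - (C - B + (a - b)) = A + b" "(D + a) - (A + a) = C - B"
    "(D + a) - (C + b) = A - B + (a - b)" "(A - B) + (C - B + (a - b)) - (D + a) = - (B + b)"
    "(A - B) + (A + a) - (D + a) = A - C" "(A - B) + (C + b) - (D + a) = - (a - b)"
    by (simp_all add: D_def)
  note arg = this
  have two: "th (A - B) * th (C - B + (a - b)) * th (A + a) * th (C + b) -
      th (C + a) * th (A + b) * th (C - B) * th (A - B + (a - b)) =
      th (D + a) * th (B + b) * th (A - C) * th (a - b)"
    using theta_three_term_symmetric[of "D + a" "A - B" "C - B + (a - b)" "A + a" "C + b"]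
    unfolding arg theta_minus[OF im] by (simp add: D_def)
  have ii: "kron (C - B) (a - b) * kron A a * kron C b -
      kron (A - B) (a - b) * kron A b * kron C a = kron D a * kron B b * W"
    unfolding F_ell_def K_def[symmetric] W_def
    using nz' unfolding neg by (simp add: divide_simps) (use two[unfolded neg] in algebra)
  have "kron B h * (kron (C - B) (a - b) * kron A a * kron C b -
      kron (A - B) (a - b) * kron A b * kron C a) =
      kron D a * kron B b * (kron (B - A) h * kron A h - kron (B - C) h * kron C h)"
    unfolding i ii by simp
  then show ?thesis unfolding D_def[symmetric] by (simp add: algebra_simps)
qed

end

section \<open>Dense open subsets of the torus\<close>

lemma finite_vars [simp]: "finite (vars m r)"
  by (simp add: vars_def)

lemma continuous_point_eval [continuous_intros]: "continuous_on A (\<lambda>p::point. p v)"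
  by (rule continuous_on_subset[OF continuous_on_product_coordinates]) simp

lemma open_torus: "open (torus m r)"
proof -
  have "torus m r = (\<Inter>v\<in>vars m r. {p. p v \<noteq> 0})" by (auto simp: torus_def)
  moreover have "open {p::point. p v \<noteq> 0}" for v
    by (intro open_Collect_neq continuous_intros)
  ultimately show ?thesis by (simp add: open_INT)
qed

lemma dense_open_torus: "dense_open m r (torus m r)"
  by (simp add: dense_open_def open_torus closure_subset)

lemma dense_openI:
  assumes "open D" "D \<subseteq> torus m r"
    and "\<And>p T. p \<in> torus m r \<Longrightarrow> open T \<Longrightarrow> p \<in> T \<Longrightarrow> \<exists>d\<in>D. d \<in> T"
  shows "dense_open m r D"
  using assms unfolding dense_open_def closure_iff_nhds_not_empty subset_iff
  by (metis disjoint_iff open_subset subset_iff)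

lemma dense_openD:
  assumes "dense_open m r D" "p \<in> torus m r" "open T" "p \<in> T"
  obtains d where "d \<in> D" "d \<in> T"
  using assms unfolding dense_open_def closure_iff_nhds_not_empty subset_iff
  by (metis disjoint_iff order_refl)

lemma dense_open_Int:
  assumes D: "dense_open m r D" and E: "dense_open m r E"
  shows "dense_open m r (D \<inter> E)"
proof (rule dense_openI)
  fix p T assume p: "p \<in> torus m r" "open T" "p \<in> T"
  then obtain d where d: "d \<in> D" "d \<in> T" using dense_openD[OF D] by blast
  with D have "d \<in> torus m r" "open (T \<inter> D)" "d \<in> T \<inter> D"
    using p by (auto simp: dense_open_def)
  then obtain e where "e \<in> E" "e \<in> T \<inter> D" using dense_openD[OF E] by blast
  then show "\<exists>d\<in>D \<inter> E. d \<in> T" by blast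
qed (use D E in \<open>auto simp: dense_open_def\<close>)

lemma dense_open_vimage:
  assumes D: "dense_open m r D"
    and cont: "continuous_on UNIV \<phi>" "continuous_on UNIV \<psi>"
    and inv: "\<And>p. \<phi> (\<psi> p) = p" "\<And>p. \<psi> (\<phi> p) = p"
    and torus: "\<And>p. \<phi> p \<in> torus m r \<longleftrightarrow> p \<in> torus m r"
  shows "dense_open m r (\<phi> -` D)"
proof (rule dense_openI)
  show "open (\<phi> -` D)"
    using D cont by (intro open_vimage) (auto simp: dense_open_def)
  show "\<phi> -` D \<subseteq> torus m r" using D torus by (auto simp: dense_open_def)
  fix p T assume p: "p \<in> torus m r" "open T" "p \<in> T"
  have "open (\<psi> -` T)" using p cont by (intro open_vimage)
  then obtain d where "d \<in> D" "d \<in> \<psi> -` T"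
    using dense_openD[OF D, of "\<phi> p" "\<psi> -` T"] p inv torus by auto
  then show "\<exists>d\<in>\<phi> -` D. d \<in> T" using inv by (intro bexI[of _ "\<psi> d"]) auto
qed

lemma continuous_reindex: "continuous_on UNIV (\<lambda>p::point. p \<circ> \<pi>)"
  unfolding o_def by (intro continuous_on_coordinatewise_then_product continuous_intros)

lemma dense_open_reindex:
  assumes D: "dense_open m r D" and "bij \<pi>" and "\<And>v. \<pi> v \<in> vars m r \<longleftrightarrow> v \<in> vars m r"
  shows "dense_open m r {p. p \<circ> \<pi> \<in> D}"
proof -
  have "dense_open m r ((\<lambda>p. p \<circ> \<pi>) -` D)"
  proof (rule dense_open_vimage[OF D continuous_reindex continuous_reindex[of "inv \<pi>"]])
    show "p \<circ> inv \<pi> \<circ> \<pi> = p" "p \<circ> \<pi> \<circ> inv \<pi> = p" for p :: point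
      using \<open>bij \<pi>\<close> by (simp_all add: o_assoc[symmetric] bij_is_inj bij_is_surj surj_iff[THEN iffD1])
    show "p \<circ> \<pi> \<in> torus m r \<longleftrightarrow> p \<in> torus m r" for p :: point
      using assms(3) bij_is_surj[OF \<open>bij \<pi>\<close>] unfolding torus_def by (simp, metis surjD)
  qed
  then show ?thesis by (simp add: vimage_def)
qed

section \<open>Equality of meromorphic functions and its compatibility with the operations\<close>

lemma mero_eqI:
  "dense_open m r D \<Longrightarrow> (\<And>p. p \<in> D \<Longrightarrow> f p = g p) \<Longrightarrow> mero_eq m r f g"
  by (auto simp: mero_eq_def)

lemma mero_eq_refl [simp]: "mero_eq m r f f"
  by (rule mero_eqI[OF dense_open_torus]) simp

lemma mero_eq_sym: "mero_eq m r f g \<Longrightarrow> mero_eq m r g f"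
  unfolding mero_eq_def by metis

lemma mero_eq_trans [trans]:
  assumes "mero_eq m r f g" "mero_eq m r g h" shows "mero_eq m r f h"
proof -
  obtain D E where "dense_open m r D" "\<forall>p\<in>D. f p = g p" "dense_open m r E" "\<forall>p\<in>E. g p = h p"
    using assms by (auto simp: mero_eq_def)
  then show ?thesis by (intro mero_eqI[OF dense_open_Int[of m r D E]]) auto
qed

lemma bij_transpose: "bij (Transposition.transpose a b)"
  by (simp add: bij_def)

lemma transpose_vars:
  assumes "{a, b} \<subseteq> vars m r"
  shows "Transposition.transpose a b v \<in> vars m r \<longleftrightarrow> v \<in> vars m r"
  using assms by (auto simp: Transposition.transpose_def)

lemma X_vars [simp]: "X i \<in> vars m r \<longleftrightarrow> i \<in> {1..m}"
  and Mu_vars [simp]: "Mu i \<in> vars m r \<longleftrightarrow> i \<in> {1..r}"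
  and U_vars [simp]: "U \<in> vars m r" and H_vars [simp]: "H \<in> vars m r"
  by (auto simp: vars_def)

lemma dense_open_swap_x:
  assumes "dense_open m r D" "i \<in> {1..<m}"
  shows "dense_open m r {p. swap_x i p \<in> D}"
  unfolding swap_x_def
  by (rule dense_open_reindex[OF assms(1) bij_transpose transpose_vars]) (use assms(2) in auto)

lemma C_op_cong:
  assumes "mero_eq m r f g" "i \<in> {1..<m}"
  shows "mero_eq m r (C_op \<tau> m r i \<nu> f) (C_op \<tau> m r i \<nu> g)"
proof -
  obtain D where D: "dense_open m r D" "\<forall>p\<in>D. f p = g p"
    using assms by (auto simp: mero_eq_def)
  show ?thesis
    by (rule mero_eqI[OF dense_open_Int[OF D(1) dense_open_swap_x[OF D(1) assms(2)]]])
       (use D in \<open>simp add: C_op_def\<close>)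
qed

text \<open>With the relabelling as a map on variables, \<open>mu_act\<close> is composition with it
  and falls under the lemmas on reindexing.\<close>

definition mu_relabel :: "(nat \<Rightarrow> nat) \<Rightarrow> var \<Rightarrow> var" where
  "mu_relabel \<sigma> v = (case v of Mu i \<Rightarrow> Mu (\<sigma> i) | _ \<Rightarrow> v)"

lemma mu_relabel_simps [simp]:
  "mu_relabel \<sigma> U = U" "mu_relabel \<sigma> H = H" "mu_relabel \<sigma> (X i) = X i"
  "mu_relabel \<sigma> (Mu i) = Mu (\<sigma> i)"
  by (simp_all add: mu_relabel_def)

lemma mu_act_eq: "mu_act \<sigma> f p = f (p \<circ> mu_relabel \<sigma>)"
  unfolding mu_act_def by (rule arg_cong[where f = f]) (auto simp: mu_relabel_def split: var.splits)

lemma mu_act_comp: "mu_act (\<sigma> \<circ> \<rho>) f = mu_act \<sigma> (mu_act \<rho> f)"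
proof -
  have "mu_relabel (\<sigma> \<circ> \<rho>) = mu_relabel \<sigma> \<circ> mu_relabel \<rho>"
    by (rule ext) (auto simp: mu_relabel_def split: var.splits)
  then show ?thesis by (auto simp: mu_act_eq o_assoc)
qed

lemma bij_mu_relabel: "bij \<sigma> \<Longrightarrow> bij (mu_relabel \<sigma>)"
proof -
  assume "bij \<sigma>"
  then have "mu_relabel \<sigma> \<circ> mu_relabel (inv \<sigma>) = id" "mu_relabel (inv \<sigma>) \<circ> mu_relabel \<sigma> = id"
    by (auto simp: fun_eq_iff mu_relabel_def bij_is_inj bij_is_surj surj_f_inv_f split: var.splits)
  then show ?thesis using o_bij by blast
qed

lemma mu_relabel_vars:
  assumes "\<sigma> permutes {1..r}"
  shows "mu_relabel \<sigma> v \<in> vars m r \<longleftrightarrow> v \<in> vars m r"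
  using permutes_in_image[OF assms] by (cases v) auto

lemma mu_act_cong:
  assumes "mero_eq m r f g" "\<sigma> permutes {1..r}"
  shows "mero_eq m r (mu_act \<sigma> f) (mu_act \<sigma> g)"
proof -
  obtain D where D: "dense_open m r D" "\<forall>p\<in>D. f p = g p"
    using assms by (auto simp: mero_eq_def)
  show ?thesis
    by (rule mero_eqI[OF dense_open_reindex[OF D(1) bij_mu_relabel mu_relabel_vars]])
       (use D assms(2) in \<open>auto simp: mu_act_eq permutes_bij\<close>)
qed

section \<open>Linear forms, logarithms and generic points\<close>

lemma lf_eval_add: "lf_eval m r (\<lambda>v. l v + k v) z = lf_eval m r l z + lf_eval m r k z"
  and lf_eval_diff: "lf_eval m r (\<lambda>v. l v - k v) z = lf_eval m r l z - lf_eval m r k z"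
  by (simp_all add: lf_eval_def algebra_simps sum.distrib sum_subtractf)

definition lf_var :: "var \<Rightarrow> lin_form" where
  "lf_var v = (\<lambda>u. of_bool (u = v))"

lemma lf_eval_var [simp]: "v \<in> vars m r \<Longrightarrow> lf_eval m r (lf_var v) z = z v"
proof -
  assume "v \<in> vars m r"
  have "lf_eval m r (lf_var v) z = (\<Sum>u\<in>vars m r. if u = v then z u else 0)"
    unfolding lf_eval_def lf_var_def by (rule sum.cong) auto
  with \<open>v \<in> vars m r\<close> show ?thesis by simp
qed

lemma lf_var_simps [simp]: "lf_var v v = 1" "u \<noteq> v \<Longrightarrow> lf_var v u = 0"
  by (simp_all add: lf_var_def)

lemma lf_mono_unit_exp:
  assumes "\<And>v. v \<in> vars m r \<Longrightarrow> p v = unit_exp (z v)"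
  shows "lf_mono m r l p = unit_exp (lf_eval m r l z)"
proof -
  have "unit_exp (\<Sum>v\<in>A. f v) = (\<Prod>v\<in>A. unit_exp (f v))" if "finite A" for A and f :: "var \<Rightarrow> complex"
    using that by (induction A) (simp_all add: unit_exp_add)
  then show ?thesis
    unfolding lf_mono_def lf_eval_def using assms by (simp add: unit_exp_of_int_mult)
qed

text \<open>Restricted to \<open>vars m r\<close>, because a point of the torus may vanish at other
  variables, where it has no logarithm.\<close>

definition is_log :: "nat \<Rightarrow> nat \<Rightarrow> point \<Rightarrow> point \<Rightarrow> bool" where
  "is_log m r p z \<longleftrightarrow> (\<forall>v\<in>vars m r. p v = unit_exp (z v))"

lemma exists_log:
  assumes "p \<in> torus m r"
  shows "\<exists>z. is_log m r p z"
proof -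
  have "unit_exp (Ln (p v) / (2 * of_real pi * \<i>)) = p v" if "v \<in> vars m r" for v
    using assms that by (simp add: unit_exp_def torus_def)
  then show ?thesis
    unfolding is_log_def by (intro exI[of _ "\<lambda>v. Ln (p v) / (2 * of_real pi * \<i>)"]) simp
qed

lemma lf_mono_nonzero: "p \<in> torus m r \<Longrightarrow> lf_mono m r l p \<noteq> 0"
  by (auto simp: lf_mono_def torus_def)

lemma continuous_lf_mono: "continuous_on (torus m r) (lf_mono m r l)"
  unfolding lf_mono_def
  by (intro continuous_intros) (auto simp: torus_def)

lemma tendsto_point:
  fixes f :: "'a \<Rightarrow> point"
  assumes "\<And>v. ((\<lambda>n. f n v) \<longlongrightarrow> p v) F"
  shows "(f \<longlongrightarrow> p) F"
proof -
  have "limitin (product_topology (\<lambda>i. euclidean) UNIV) f p F"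
    unfolding limitin_componentwise using assms by auto
  then show ?thesis by (simp add: euclidean_product_topology)
qed

text \<open>Multiplying the coordinate v by e(s) multiplies the monomial by e(l(v) s), which leaves
  \<open>S\<close> for small s of the right sign. The set \<open>S\<close> will be either the zeros
  of theta or a single value.\<close>

lemma dense_open_lf_mono_avoid:
  assumes l: "v \<in> vars m r" "l v \<noteq> 0"
    and op: "open {a. a \<noteq> 0 \<and> a \<notin> S}"
    and avoid: "\<And>a t::real. a \<in> S \<Longrightarrow> a \<noteq> 0 \<Longrightarrow> 0 < t \<Longrightarrow> t < 1 \<Longrightarrow> a * unit_exp (of_real t) \<notin> S"
  shows "dense_open m r {p \<in> torus m r. lf_mono m r l p \<notin> S}"
proof (rule dense_openI)
  have "{p \<in> torus m r. lf_mono m r l p \<notin> S} = torus m r \<inter> lf_mono m r l -` {a. a \<noteq> 0 \<and> a \<notin> S}"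
    using lf_mono_nonzero by auto
  then show "open {p \<in> torus m r. lf_mono m r l p \<notin> S}"
    using continuous_open_preimage[OF continuous_lf_mono open_torus op] by simp
  fix p T assume p: "p \<in> torus m r" "open T" "p \<in> T"
  show "\<exists>d\<in>{p \<in> torus m r. lf_mono m r l p \<notin> S}. d \<in> T"
  proof (cases "lf_mono m r l p \<in> S")
    case False
    then show ?thesis using p by auto
  next
    case True
    \<comment> \<open>Chosen so that l(v) c = |l(v)| / (1 + |l(v)|) lies strictly between 0 and 1.
      The factor 1/(n + 1) in \<open>s\<close> keeps it there and lets the points tend to p.\<close>
    define c where "c = (of_int (sgn (l v)) / (1 + \<bar>of_int (l v)\<bar>) :: real)"
    define s where "s n = inverse (real (Suc n)) * c" for n
    define P where "P n = p(v := p v * unit_exp (of_real (s n)))" for n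
    have "s \<longlonglongrightarrow> 0"
      using tendsto_mult_left_zero[OF LIMSEQ_inverse_real_of_nat] unfolding s_def .
    then have "(\<lambda>n. p v * unit_exp (of_real (s n))) \<longlonglongrightarrow> p v * unit_exp (of_real 0)"
      unfolding unit_exp_def by (intro tendsto_intros)
    then have "(\<lambda>n. P n u) \<longlonglongrightarrow> p u" for u
      by (cases "u = v") (simp_all add: P_def)
    then have "P \<longlonglongrightarrow> p" by (rule tendsto_point)
    then have "eventually (\<lambda>n. P n \<in> T) sequentially"
      using p by (simp add: tendsto_def)
    then obtain n where n: "P n \<in> T" by (auto simp: eventually_sequentially)
    have tor: "P n \<in> torus m r" using p(1) by (auto simp: P_def torus_def)
    have "lf_mono m r l (P n) = (\<Prod>u\<in>vars m r. p u powi l u * (if u = v then unit_exp (of_int (l v) * of_real (s n)) else 1))"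
      unfolding lf_mono_def P_def by (rule prod.cong) (auto simp: power_int_mult_distrib unit_exp_of_int_mult)
    also have "\<dots> = lf_mono m r l p * unit_exp (of_int (l v) * of_real (s n))"
      using l by (simp add: prod.distrib lf_mono_def prod.delta)
    finally have eq: "lf_mono m r l (P n) = lf_mono m r l p * unit_exp (of_real (of_int (l v) * s n))"
      by simp
    have lc: "of_int (l v) * c = \<bar>of_int (l v)\<bar> / (1 + \<bar>of_int (l v)\<bar> :: real)"
      by (simp add: c_def abs_if sgn_if)
    have bd: "0 < of_int (l v) * c" "of_int (l v) * c < 1"
      unfolding lc using l by (simp_all add: field_simps)
    have "of_int (l v) * s n = of_int (l v) * c * inverse (real (Suc n))"
      by (simp add: s_def)
    moreover have "0 < of_int (l v) * c * inverse (real (Suc n))"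
      using bd(1) by (rule mult_pos_pos) simp
    moreover have "of_int (l v) * c * inverse (real (Suc n)) \<le> of_int (l v) * c * 1"
      using bd(1) by (intro mult_left_mono) (auto simp: inverse_le_1_iff)
    ultimately have "0 < of_int (l v) * s n" "of_int (l v) * s n < 1"
      using bd by linarith+
    then have "lf_mono m r l (P n) \<notin> S"
      unfolding eq by (rule avoid[OF True lf_mono_nonzero[OF p(1)]])
    then show ?thesis using n tor by blast
  qed
qed auto

text \<open>The points where no theta(l) with l in \<open>L\<close> vanishes, expressed by monomials
  so that no logarithm has to be chosen.\<close>

definition generic :: "complex \<Rightarrow> nat \<Rightarrow> nat \<Rightarrow> lin_form set \<Rightarrow> point set" where
  "generic \<tau> m r L = {p \<in> torus m r. \<forall>l\<in>L. \<forall>n::int. lf_mono m r l p \<noteq> unit_exp \<tau> powi n}"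

context
  fixes \<tau> :: complex
  assumes im: "Im \<tau> > 0"
begin

text \<open>The set is the image under e of the open set where theta does not vanish, and a
  nonconstant holomorphic function is an open map.\<close>

lemma open_non_zeros: "open {a. a \<noteq> 0 \<and> a \<notin> range (\<lambda>n::int. unit_exp \<tau> powi n)}"
proof -
  have "unit_exp ` {x. theta \<tau> x \<noteq> 0} = {a. a \<noteq> 0 \<and> a \<notin> range (\<lambda>n::int. unit_exp \<tau> powi n)}"
  proof safe
    fix a assume a: "a \<noteq> 0" "a \<notin> range (\<lambda>n::int. unit_exp \<tau> powi n)"
    then have "unit_exp (Ln a / (2 * of_real pi * \<i>)) = a" by (simp add: unit_exp_def)
    moreover from this have "theta \<tau> (Ln a / (2 * of_real pi * \<i>)) \<noteq> 0"
      using a(2) unfolding theta_eq_0_iff[OF im] by auto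
    ultimately show "a \<in> unit_exp ` {x. theta \<tau> x \<noteq> 0}"
      by (intro image_eqI[of _ _ "Ln a / (2 * of_real pi * \<i>)"]) auto
  qed (use theta_eq_0_iff[OF im] in auto)
  moreover have "open (unit_exp ` {x. theta \<tau> x \<noteq> 0})"
  proof (rule open_mapping_thm[of unit_exp UNIV])
    show "unit_exp holomorphic_on UNIV"
      using unit_exp_holomorphic[OF holomorphic_on_ident] by simp
    show "open {x. theta \<tau> x \<noteq> 0}"
      using theta_continuous[OF im continuous_on_id]
      by (intro open_Collect_neq) (auto intro: continuous_intros)
    show "\<not> unit_exp constant_on UNIV"
    proof
      assume "unit_exp constant_on UNIV"
      then have "unit_exp (1 / 2) = unit_exp 0" by (metis constant_on_def UNIV_I)
      then obtain n :: int where "(1 / 2 :: complex) = of_int n" unfolding unit_exp_eq_iff by auto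
      then have "(of_int 1 :: complex) = of_int (2 * n)" by (simp add: field_simps)
      then have "1 = 2 * n" by (simp only: of_int_eq_iff)
      then show False by presburger
    qed
  qed auto
  ultimately show ?thesis by simp
qed

lemma dense_open_generic:
  assumes "finite L" "\<And>l. l \<in> L \<Longrightarrow> \<exists>v\<in>vars m r. l v \<noteq> 0"
  shows "dense_open m r (generic \<tau> m r L)"
  using assms
proof (induction L)
  case empty
  then show ?case by (simp add: generic_def dense_open_torus)
next
  case (insert l L)
  obtain v where v: "v \<in> vars m r" "l v \<noteq> 0" using insert.prems by blast
  have "dense_open m r {p \<in> torus m r. lf_mono m r l p \<notin> range (\<lambda>n::int. unit_exp \<tau> powi n)}"
  proof (rule dense_open_lf_mono_avoid[where v = v])
    fix a and t :: real
    assume a: "a \<in> range (\<lambda>n::int. unit_exp \<tau> powi n)" "a \<noteq> 0" "0 < t" "t < 1"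
    then have "unit_exp (Ln a / (2 * of_real pi * \<i>)) = a" by (simp add: unit_exp_def)
    then obtain x where x: "a = unit_exp x" by metis
    then have "theta \<tau> (x + of_real t) \<noteq> 0"
      using theta_eq_0_real_shift[OF im _ a(3,4)] a(1) by (auto simp: theta_eq_0_iff[OF im])
    then show "a * unit_exp (of_real t) \<notin> range (\<lambda>n::int. unit_exp \<tau> powi n)"
      by (auto simp: theta_eq_0_iff[OF im] x unit_exp_add)
  qed (use v open_non_zeros in auto)
  moreover have "generic \<tau> m r (insert l L) =
      {p \<in> torus m r. lf_mono m r l p \<notin> range (\<lambda>n::int. unit_exp \<tau> powi n)} \<inter> generic \<tau> m r L"
    by (auto simp: generic_def)
  ultimately show ?case using insert by (simp add: dense_open_Int)
qed

lemma generic_log: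
  assumes "p \<in> generic \<tau> m r L" "is_log m r p z" "l \<in> L"
  shows "theta \<tau> (lf_eval m r l z) \<noteq> 0"
proof -
  have "lf_mono m r l p = unit_exp (lf_eval m r l z)"
    using assms(2) by (intro lf_mono_unit_exp) (simp add: is_log_def)
  then show ?thesis using assms(1,3) by (auto simp: generic_def theta_eq_0_iff[OF im])
qed

end

lemma delta_unit_exp: "delta \<tau> (unit_exp x) (unit_exp y) = F_ell \<tau> x y"
  unfolding unit_exp_def by (rule delta_exp)

lemma C_op_log:
  assumes z: "is_log m r p z" and i: "i \<in> {1..<m}"
  shows "C_op \<tau> m r i \<nu> f p =
    F_ell \<tau> (z (X (Suc i)) - z (X i)) (lf_eval m r \<nu> z) * f p +
    F_ell \<tau> (z (X i) - z (X (Suc i))) (z H) * f (swap_x i p)"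
proof -
  have z': "p v = unit_exp (z v)" if "v \<in> vars m r" for v using z that by (simp add: is_log_def)
  have "p (X i) = unit_exp (z (X i))" "p (X (Suc i)) = unit_exp (z (X (Suc i)))" "p H = unit_exp (z H)"
    using z'[of "X i"] z'[of "X (Suc i)"] z'[of H] i by auto
  then show ?thesis
    unfolding C_op_def by (simp add: lf_mono_unit_exp[OF z'] unit_exp_diff[symmetric] delta_unit_exp)
qed

lemma swap_x_log:
  assumes "is_log m r p z" "i \<in> {1..<m}"
  shows "is_log m r (swap_x i p) (swap_x i z)"
  using assms transpose_vars[of "X i" "X (Suc i)" m r] by (auto simp: swap_x_def is_log_def)

section \<open>Purity\<close>

lemma exp_point_eq: "exp_point z v = unit_exp (z v)"
  by (simp add: exp_point_def unit_exp_def)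

lemma exp_point_reindex: "exp_point z \<circ> \<pi> = exp_point (z \<circ> \<pi>)"
  by (simp add: fun_eq_iff exp_point_eq)

lemma lf_eval_reindex:
  assumes "bij \<pi>" "\<And>v. \<pi> v \<in> vars m r \<longleftrightarrow> v \<in> vars m r"
  shows "lf_eval m r (l \<circ> \<pi>) (z \<circ> \<pi>) = lf_eval m r l z"
proof -
  have "bij_betw \<pi> (vars m r) (vars m r)"
    using assms by (auto simp: bij_betw_def bij_def inj_on_def image_iff) (metis surjD)
  then show ?thesis
    using sum.reindex_bij_betw[of \<pi> "vars m r" "vars m r" "\<lambda>v. of_int (l v) * z v"]
    by (simp add: lf_eval_def)
qed

lemma pure_cong:
  assumes "pure_of_type \<tau> m r f Q" "\<And>z. g (exp_point z) = f (exp_point z)"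
  shows "pure_of_type \<tau> m r g Q"
  using assms(1) unfolding pure_of_type_def assms(2) .

lemma pure_const_1: "pure_of_type \<tau> m r (\<lambda>p. 1) (\<lambda>z. 0)"
  unfolding pure_of_type_def
  by (rule exI[of _ "[(1, [])]"]) (auto simp: tm_valid_def tm_type_def tm_eval_def intro: dense_open_torus)

lemma pure_add:
  assumes "pure_of_type \<tau> m r f Q" "pure_of_type \<tau> m r g Q"
  shows "pure_of_type \<tau> m r (\<lambda>p. f p + g p) Q"
proof -
  obtain L D where L: "L \<noteq> []" "\<forall>(c, M)\<in>set L. tm_valid m r M \<and> tm_type m r M = Q" "dense_open m r D"
      "\<forall>z. exp_point z \<in> D \<longrightarrow> f (exp_point z) = (\<Sum>(c, M)\<leftarrow>L. c * tm_eval \<tau> m r M z)"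
    using assms(1) unfolding pure_of_type_def by blast
  obtain L' D' where L': "\<forall>(c, M)\<in>set L'. tm_valid m r M \<and> tm_type m r M = Q" "dense_open m r D'"
      "\<forall>z. exp_point z \<in> D' \<longrightarrow> g (exp_point z) = (\<Sum>(c, M)\<leftarrow>L'. c * tm_eval \<tau> m r M z)"
    using assms(2) unfolding pure_of_type_def by blast
  show ?thesis
    unfolding pure_of_type_def
    by (rule exI[of _ "L @ L'"], intro conjI exI[of _ "D \<inter> D'"] dense_open_Int)
       (use L L' in auto)
qed

text \<open>Up to a constant F(l, k) is the monomial theta(l + k) / (theta(l) theta(k)), of type ((l
  + k)^2 - l^2 - k^2) / 2 = l k. The three forms must be nonzero to satisfy
  \<open>tm_valid\<close>.\<close>

lemma pure_F_ell_mult: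
  assumes g: "pure_of_type \<tau> m r g Q"
    and f: "\<And>z. f (exp_point z) = F_ell \<tau> (lf_eval m r l z) (lf_eval m r k z) * g (exp_point z)"
    and on: "lf_on (vars m r) l" "lf_on (vars m r) k"
    and nz: "\<exists>v. l v \<noteq> 0" "\<exists>v. k v \<noteq> 0" "\<exists>v. l v + k v \<noteq> 0"
  shows "pure_of_type \<tau> m r f (\<lambda>z. lf_eval m r l z * lf_eval m r k z + Q z)"
proof -
  obtain L D where L: "L \<noteq> []" "\<forall>(c, M)\<in>set L. tm_valid m r M \<and> tm_type m r M = Q" "dense_open m r D"
      "\<forall>z. exp_point z \<in> D \<longrightarrow> g (exp_point z) = (\<Sum>(c, M)\<leftarrow>L. c * tm_eval \<tau> m r M z)"
    using g unfolding pure_of_type_def by blast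
  define T :: theta_mono where "T = [(\<lambda>v. l v + k v, 1), (l, -1), (k, -1)]"
  define L' where "L' = map (\<lambda>(c, M). (deriv (theta \<tau>) 0 * c, T @ M)) L"
  have T: "tm_valid m r T" "tm_type m r T = (\<lambda>z. lf_eval m r l z * lf_eval m r k z)"
      "F_ell \<tau> (lf_eval m r l z) (lf_eval m r k z) = deriv (theta \<tau>) 0 * tm_eval \<tau> m r T z" for z
  proof -
    show "tm_valid m r T" using on nz by (auto simp: T_def tm_valid_def lf_on_def)
    show "tm_type m r T = (\<lambda>z. lf_eval m r l z * lf_eval m r k z)"
      by (rule ext) (simp add: T_def tm_type_def lf_eval_add power2_eq_square field_simps)
    show "F_ell \<tau> (lf_eval m r l z) (lf_eval m r k z) = deriv (theta \<tau>) 0 * tm_eval \<tau> m r T z"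
      by (simp add: T_def tm_eval_def F_ell_def lf_eval_add power_int_minus field_simps)
  qed
  have app: "tm_valid m r (T @ M) \<longleftrightarrow> tm_valid m r T \<and> tm_valid m r M"
      "tm_type m r (T @ M) = (\<lambda>z. tm_type m r T z + tm_type m r M z)"
      "tm_eval \<tau> m r (T @ M) z = tm_eval \<tau> m r T z * tm_eval \<tau> m r M z" for M z
    by (auto simp: tm_valid_def tm_type_def tm_eval_def)
  have "(\<Sum>(c, M)\<leftarrow>L'. c * tm_eval \<tau> m r M z) =
      deriv (theta \<tau>) 0 * tm_eval \<tau> m r T z * (\<Sum>(c, M)\<leftarrow>L. c * tm_eval \<tau> m r M z)" for z
    unfolding L'_def sum_list_const_mult[symmetric]
    by (simp add: o_def case_prod_unfold app mult_ac)
  then have "\<forall>z. exp_point z \<in> D \<longrightarrow> f (exp_point z) = (\<Sum>(c, M)\<leftarrow>L'. c * tm_eval \<tau> m r M z)"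
    using L(4) f T(3) by simp
  moreover have "\<forall>(c, M)\<in>set L'. tm_valid m r M \<and>
      tm_type m r M = (\<lambda>z. lf_eval m r l z * lf_eval m r k z + Q z)"
    using L(2) T by (auto simp: L'_def app)
  moreover have "L' \<noteq> []" using L(1) by (simp add: L'_def)
  ultimately show ?thesis
    unfolding pure_of_type_def using L(3) by blast
qed

text \<open>The reindexing is transferred to the forms of each monomial; \<pi> being an involution,
  evaluating l \<circ> \<pi> at z is evaluating l at z \<circ> \<pi>.\<close>

lemma pure_reindex:
  assumes g: "pure_of_type \<tau> m r g Q"
    and \<pi>: "bij \<pi>" "\<And>v. \<pi> v \<in> vars m r \<longleftrightarrow> v \<in> vars m r" and inv: "\<pi> \<circ> \<pi> = id"
  shows "pure_of_type \<tau> m r (\<lambda>p. g (p \<circ> \<pi>)) (\<lambda>z. Q (z \<circ> \<pi>))"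
proof -
  obtain L D where L: "L \<noteq> []" "\<forall>(c, M)\<in>set L. tm_valid m r M \<and> tm_type m r M = Q" "dense_open m r D"
      "\<forall>z. exp_point z \<in> D \<longrightarrow> g (exp_point z) = (\<Sum>(c, M)\<leftarrow>L. c * tm_eval \<tau> m r M z)"
    using g unfolding pure_of_type_def by blast
  define R :: "theta_mono \<Rightarrow> theta_mono" where "R = map (\<lambda>(l, e). (l \<circ> \<pi>, e))"
  have ev: "lf_eval m r (l \<circ> \<pi>) z = lf_eval m r l (z \<circ> \<pi>)" for l z
    using lf_eval_reindex[OF \<pi>, of l "z \<circ> \<pi>"] inv by (simp add: o_assoc[symmetric])
  have R: "tm_valid m r (R M)" if "tm_valid m r M" for M
  proof -
    have "lf_on (vars m r) (l \<circ> \<pi>)" "\<exists>v. (l \<circ> \<pi>) v \<noteq> 0" if "lf_on (vars m r) l" "\<exists>v. l v \<noteq> 0" for l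
      using that \<pi> inv by (auto simp: lf_on_def fun_eq_iff) metis
    then show ?thesis using that unfolding tm_valid_def R_def by fastforce
  qed
  have Rt: "tm_type m r (R M) z = tm_type m r M (z \<circ> \<pi>)"
      and Re: "tm_eval \<tau> m r (R M) z = tm_eval \<tau> m r M (z \<circ> \<pi>)" for M z
    by (simp_all add: R_def tm_type_def tm_eval_def o_def case_prod_unfold ev[unfolded o_def])
  define L' where "L' = map (\<lambda>(c, M). (c, R M)) L"
  have "\<forall>z. exp_point z \<in> {p. p \<circ> \<pi> \<in> D} \<longrightarrow>
      g (exp_point z \<circ> \<pi>) = (\<Sum>(c, M)\<leftarrow>L'. c * tm_eval \<tau> m r M z)"
    using L(4) by (simp add: exp_point_reindex L'_def o_def[of "\<lambda>p. fst p * tm_eval \<tau> m r (snd p) z" for z] case_prod_unfold Re)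
  moreover have "\<forall>(c, M)\<in>set L'. tm_valid m r M \<and> tm_type m r M = (\<lambda>z. Q (z \<circ> \<pi>))"
    using L(2) R by (auto simp: L'_def fun_eq_iff Rt)
  moreover have "L' \<noteq> []" using L(1) by (simp add: L'_def)
  ultimately show ?thesis
    unfolding pure_of_type_def using dense_open_reindex[OF L(3) \<pi>] by blast
qed

lemma pure_swap_x:
  assumes "pure_of_type \<tau> m r g Q" "i \<in> {1..<m}"
  shows "pure_of_type \<tau> m r (\<lambda>p. g (swap_x i p)) (\<lambda>z. Q (swap_x i z))"
  unfolding swap_x_def
  by (rule pure_reindex[OF assms(1) bij_transpose transpose_vars]) (use assms(2) in auto)

lemma lf_on_add: "lf_on V l \<Longrightarrow> lf_on V k \<Longrightarrow> lf_on V (\<lambda>v. l v + k v)"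
  and lf_on_diff: "lf_on V l \<Longrightarrow> lf_on V k \<Longrightarrow> lf_on V (\<lambda>v. l v - k v)"
  and lf_on_var: "v \<in> V \<Longrightarrow> lf_on V (lf_var v)"
  by (auto simp: lf_on_def lf_var_def)

lemma swap_x_simps [simp]:
  "swap_x i z (X i) = z (X (Suc i))" "swap_x i z (X (Suc i)) = z (X i)"
  "swap_x i z H = z H" "swap_x i z U = z U" "swap_x i z (Mu j) = z (Mu j)"
  by (auto simp: swap_x_def Transposition.transpose_def)

lemma swap_x_X: "swap_x i z (X k) = z (X (Transposition.transpose i (Suc i) k))"
  by (simp add: swap_x_def Transposition.transpose_def)

lemma swap_x_twice [simp]: "swap_x i (swap_x i z) = z"
  by (simp add: swap_x_def o_assoc[symmetric])

text \<open>The two summands have types Q - (x_i - x_(i+1)) \<nu> and s_i Q + (x_i - x_(i+1)) h; the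
  last hypothesis says exactly that these coincide.\<close>

lemma pure_C_op:
  assumes g: "pure_of_type \<tau> m r g Q" and i: "i \<in> {1..<m}"
    and \<nu>: "nontrivial_character r \<nu>"
    and Q: "\<And>z. Q z - Q (swap_x i z) = (z (X i) - z (X (Suc i))) * (lf_eval m r \<nu> z + z H)"
  shows "pure_of_type \<tau> m r (C_op \<tau> m r i \<nu> g) (\<lambda>z. Q (swap_x i z) + (z (X i) - z (X (Suc i))) * z H)"
proof -
  let ?l = "\<lambda>v. lf_var (X (Suc i)) v - lf_var (X i) v" and ?l' = "\<lambda>v. lf_var (X i) v - lf_var (X (Suc i)) v"
  have v: "X i \<in> vars m r" "X (Suc i) \<in> vars m r" using i by auto
  have ev: "lf_eval m r ?l z = z (X (Suc i)) - z (X i)" "lf_eval m r ?l' z = z (X i) - z (X (Suc i))" for z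
    using v by (simp_all add: lf_eval_diff del: X_vars)
  have \<nu>0: "\<nu> (X j) = 0" for j using \<nu> by (auto simp: nontrivial_character_def lf_on_def)
  have \<nu>v: "lf_on (vars m r) \<nu>" "\<exists>v. \<nu> v \<noteq> 0"
    using \<nu> by (auto simp: nontrivial_character_def lf_on_def vars_def)
  have 1: "pure_of_type \<tau> m r (\<lambda>p. delta \<tau> (p (X (Suc i)) / p (X i)) (lf_mono m r \<nu> p) * g p)
      (\<lambda>z. lf_eval m r ?l z * lf_eval m r \<nu> z + Q z)"
  proof (rule pure_F_ell_mult[OF g _ _ \<nu>v(1) _ \<nu>v(2)])
    show "delta \<tau> (exp_point z (X (Suc i)) / exp_point z (X i)) (lf_mono m r \<nu> (exp_point z)) * g (exp_point z) =
        F_ell \<tau> (lf_eval m r ?l z) (lf_eval m r \<nu> z) * g (exp_point z)" for z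
      by (simp add: ev exp_point_eq unit_exp_diff[symmetric] lf_mono_unit_exp[OF exp_point_eq] delta_unit_exp)
    show "lf_on (vars m r) ?l" using v by (intro lf_on_diff lf_on_var)
    show "\<exists>v. ?l v \<noteq> 0" "\<exists>v. ?l v + \<nu> v \<noteq> 0" by (rule exI[of _ "X i"]; simp add: \<nu>0)+
  qed
  have 2: "pure_of_type \<tau> m r (\<lambda>p. delta \<tau> (p (X i) / p (X (Suc i))) (p H) * g (swap_x i p))
      (\<lambda>z. lf_eval m r ?l' z * lf_eval m r (lf_var H) z + Q (swap_x i z))"
  proof (rule pure_F_ell_mult[OF pure_swap_x[OF g i]])
    show "delta \<tau> (exp_point z (X i) / exp_point z (X (Suc i))) (exp_point z H) * g (swap_x i (exp_point z)) =
        F_ell \<tau> (lf_eval m r ?l' z) (lf_eval m r (lf_var H) z) * g (swap_x i (exp_point z))" for z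
      by (simp add: ev exp_point_eq unit_exp_diff[symmetric] delta_unit_exp)
    show "lf_on (vars m r) ?l'" "lf_on (vars m r) (lf_var H)"
      using v by (intro lf_on_diff lf_on_var; simp)+
    show "\<exists>v. ?l' v \<noteq> 0" "\<exists>v. ?l' v + lf_var H v \<noteq> 0" by (rule exI[of _ "X i"]; simp)+
    show "\<exists>v. lf_var H v \<noteq> 0" by (rule exI[of _ H]) simp
  qed
  have e1: "(\<lambda>z. lf_eval m r ?l z * lf_eval m r \<nu> z + Q z) =
      (\<lambda>z. Q (swap_x i z) + (z (X i) - z (X (Suc i))) * z H)"
    unfolding ev using Q by (auto simp: fun_eq_iff algebra_simps)
  have e2: "(\<lambda>z. lf_eval m r ?l' z * lf_eval m r (lf_var H) z + Q (swap_x i z)) =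
      (\<lambda>z. Q (swap_x i z) + (z (X i) - z (X (Suc i))) * z H)"
    unfolding ev by (simp add: add.commute)
  show ?thesis
    using pure_add[OF 1[unfolded e1] 2[unfolded e2]] by (rule pure_cong) (simp add: C_op_def)
qed

section \<open>The canonical parameters\<close>

text \<open>This is the coefficient of x_k in the type of \<open>Ell_min\<close>, increased by k h.
  That coefficient is \<mu>_k + (r - k) h at the target k, zero at a free vertex, and -\<mu>_i - (i
  - 1) h at the source m - r + i. The increase makes the multiple of h constant on the targets and
  constant on the sources, on which the exchange of arrows relies.\<close>

definition pos_form :: "nat \<Rightarrow> nat \<Rightarrow> nat \<Rightarrow> lin_form" where
  "pos_form m r k v = (case v of
     H \<Rightarrow> if k \<le> r then int r else if k \<le> m - r then int k else int (m - r + 1)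
   | Mu j \<Rightarrow> if k \<le> r then of_bool (j = k) else if k \<le> m - r then 0 else - of_bool (j + (m - r) = k)
   | _ \<Rightarrow> 0)"

definition step_param :: "nat \<Rightarrow> nat \<Rightarrow> (nat \<Rightarrow> nat) \<Rightarrow> nat \<Rightarrow> lin_form" where
  "step_param m r w i = (\<lambda>v. pos_form m r (inv w i) v - pos_form m r (inv w (Suc i)) v)"

text \<open>Purity is not built in: the parameters are prescribed by the permutation, and
  \<open>pure_canon\<close> shows that they are the right ones.\<close>

primrec canon :: "complex \<Rightarrow> nat \<Rightarrow> nat \<Rightarrow> nat list \<Rightarrow> point \<Rightarrow> complex" where
  "canon \<tau> m r [] = Ell_min \<tau> m r"
| "canon \<tau> m r (i # is) = C_op \<tau> m r i (step_param m r (word_perm is) i) (canon \<tau> m r is)"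

text \<open>The summand \<open>- h (\<Sum>k. k x\<^sub>k)\<close> turns the twisted action
  \<open>Q \<mapsto> s\<^sub>i Q + (x\<^sub>i - x\<^sub>i\<^sub>+\<^sub>1) h\<close> of the operators on types into the permutation action on the
  coefficients \<open>pos_form\<close>.\<close>

definition canon_type :: "nat \<Rightarrow> nat \<Rightarrow> (nat \<Rightarrow> nat) \<Rightarrow> quad_form" where
  "canon_type m r w z =
     (\<Sum>k=1..m. lf_eval m r (pos_form m r (inv w k)) z * z (X k)) - z H * (\<Sum>k=1..m. of_nat k * z (X k)) +
     z U * (\<Sum>i=1..r. z (Mu i) + of_nat (r - i) * z H)"

lemma word_perm_Nil [simp]: "word_perm [] = id"
  and word_perm_Cons [simp]: "word_perm (i # is) = Transposition.transpose i (Suc i) \<circ> word_perm is"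
  by (simp_all add: word_perm_def)

lemma word_perm_append: "word_perm (is @ js) = word_perm is \<circ> word_perm js"
  by (induction "is") (simp_all add: o_assoc)

lemma word_perm_permutes: "set is \<subseteq> {1..<m} \<Longrightarrow> word_perm is permutes {1..m}"
proof (induction "is")
  case (Cons i "is")
  then show ?case
    unfolding word_perm_Cons by (intro permutes_compose permutes_swap_id) auto
qed (simp add: permutes_id)

lemma lf_on_pos_form:
  assumes "k \<in> {1..m}" "2 * r \<le> m"
  shows "lf_on ({H} \<union> Mu ` {1..r}) (pos_form m r k)"
  unfolding lf_on_def
proof (intro allI impI)
  fix v assume v: "v \<notin> {H} \<union> Mu ` {1..r}"
  show "pos_form m r k v = 0"
  proof (cases v)
    case (Mu j)
    with v have "j < 1 \<or> r < j" by auto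
    moreover have "k \<ge> 1" "k \<le> (m - r) + r" using assms by auto
    ultimately show ?thesis using Mu by (auto simp: pos_form_def of_bool_def)
  qed (use v in \<open>simp_all add: pos_form_def\<close>)
qed

text \<open>A target is recognised by the coefficient 1 at its own \<mu>, a source by the
  coefficient -1, and a free vertex, which involves no \<mu>, by its multiple of h.\<close>

lemma pos_form_inj:
  assumes "k \<in> {1..m}" "l \<in> {1..m}" "2 * r \<le> m" "pos_form m r k = pos_form m r l"
  shows "k = l"
proof -
  have e: "pos_form m r k v = pos_form m r l v" for v using assms by simp
  have low: "l = k" if "k \<le> r" "pos_form m r l (Mu k) = 1" for k l
    using that by (auto simp: pos_form_def of_bool_def split: if_splits)
  have high: "l = k" if "m - r < k" "m - r < l" "pos_form m r l (Mu (k - (m - r))) = -1" for k l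
    using that by (auto simp: pos_form_def of_bool_def split: if_splits)
  have low_val: "pos_form m r k (Mu k) = 1" if "k \<le> r" for k
    using that by (simp add: pos_form_def)
  have high_val: "pos_form m r k (Mu (k - (m - r))) = -1" if "m - r < k" for k
    using that assms(3) by (simp add: pos_form_def)
  have high_only: "m - r < l" if "pos_form m r l (Mu j) = -1" for l j
    using that by (auto simp: pos_form_def of_bool_def split: if_splits)
  consider "k \<le> r \<or> l \<le> r" | "m - r < k \<or> m - r < l" | "r < k" "k \<le> m - r" "r < l" "l \<le> m - r"
    by linarith
  then show ?thesis
  proof cases
    case 1
    then show ?thesis using low[of k l] low[of l k] low_val e by metis
  next
    case 2
    then show ?thesis using high[of k l] high[of l k] high_val high_only e by metis
  next
    case 3
    then show ?thesis using e[of H] by (simp add: pos_form_def)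
  qed
qed

lemma step_param_nontrivial:
  assumes "w permutes {1..m}" "i \<in> {1..<m}" "2 * r \<le> m"
  shows "nontrivial_character r (step_param m r w i)"
proof -
  have k: "inv w i \<in> {1..m}" "inv w (Suc i) \<in> {1..m}"
    using permutes_in_image[OF permutes_inv[OF assms(1)]] assms(2) by auto
  have "inv w i \<noteq> inv w (Suc i)"
    using permutes_inj[OF permutes_inv[OF assms(1)]] by (simp add: inj_eq)
  then have "pos_form m r (inv w i) \<noteq> pos_form m r (inv w (Suc i))"
    using pos_form_inj[OF k assms(3)] by blast
  then show ?thesis
    using lf_on_diff[OF lf_on_pos_form[OF k(1) assms(3)] lf_on_pos_form[OF k(2) assms(3)]]
    unfolding nontrivial_character_def step_param_def by (auto simp: fun_eq_iff)
qed

lemma lf_eval_swap_x: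
  assumes "lf_on ({H} \<union> Mu ` {1..r}) l"
  shows "lf_eval m r l (swap_x i z) = lf_eval m r l z"
  unfolding lf_eval_def
proof (rule sum.cong[OF refl])
  fix v
  show "of_int (l v) * swap_x i z v = of_int (l v) * z v"
    using assms by (cases v) (auto simp: lf_on_def)
qed

lemma sum_swap_x_diff:
  assumes "i \<in> {1..<m}"
  shows "(\<Sum>k=1..m. c k * z (X k)) - (\<Sum>k=1..m. c k * swap_x i z (X k)) =
    (z (X i) - z (X (Suc i))) * (c i - c (Suc i))"
proof -
  have "(\<Sum>k=1..m. c k * z (X k)) - (\<Sum>k=1..m. c k * swap_x i z (X k)) =
      (\<Sum>k=1..m. c k * (z (X k) - swap_x i z (X k)))"
    by (simp add: sum_subtractf right_diff_distrib)
  also have "\<dots> = (\<Sum>k\<in>{i, Suc i}. c k * (z (X k) - swap_x i z (X k)))"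
    by (rule sum.mono_neutral_right) (use assms in \<open>auto simp: swap_x_X Transposition.transpose_def\<close>)
  also have "\<dots> = (z (X i) - z (X (Suc i))) * (c i - c (Suc i))"
    by (simp add: algebra_simps)
  finally show ?thesis .
qed

lemma sum_nat_swap_x_diff:
  assumes "i \<in> {1..<m}"
  shows "(\<Sum>k=1..m. of_nat k * z (X k)) - (\<Sum>k=1..m. of_nat k * swap_x i z (X k)) =
    - (z (X i) - z (X (Suc i)))"
  unfolding sum_swap_x_diff[OF assms] by (simp add: algebra_simps)

text \<open>Only the terms of x_i and x_(i+1) change. The correction by the sum of the k x_k
  contributes (x_i - x_(i+1)) h, which is the summand h on the right.\<close>

lemma canon_type_swap_x:
  assumes w: "w permutes {1..m}" and i: "i \<in> {1..<m}" and r: "2 * r \<le> m"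
  shows "canon_type m r w z - canon_type m r w (swap_x i z) =
    (z (X i) - z (X (Suc i))) * (lf_eval m r (step_param m r w i) z + z H)"
proof -
  have k: "inv w k \<in> {1..m}" if "k \<in> {1..m}" for k
    using permutes_in_image[OF permutes_inv[OF w]] that by auto
  have "(\<Sum>k=1..m. lf_eval m r (pos_form m r (inv w k)) (swap_x i z) * swap_x i z (X k)) =
      (\<Sum>k=1..m. lf_eval m r (pos_form m r (inv w k)) z * swap_x i z (X k))"
    by (intro sum.cong refl) (simp add: lf_eval_swap_x[OF lf_on_pos_form[OF k r]])
  then have swapped: "canon_type m r w (swap_x i z) =
      (\<Sum>k=1..m. lf_eval m r (pos_form m r (inv w k)) z * swap_x i z (X k)) -
      z H * (\<Sum>k=1..m. of_nat k * swap_x i z (X k)) +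
      z U * (\<Sum>i=1..r. z (Mu i) + of_nat (r - i) * z H)"
    unfolding canon_type_def swap_x_simps by (rule arg_cong)
  have diff: "A - A' = d * p \<Longrightarrow> B - B' = - d \<Longrightarrow> (A - h * B + R) - (A' - h * B' + R) = d * (p + h)"
    for A A' B B' R d p h :: complex by algebra
  show ?thesis
    unfolding step_param_def lf_eval_diff swapped unfolding canon_type_def
    by (rule diff[OF sum_swap_x_diff[OF i, of "\<lambda>k. lf_eval m r (pos_form m r (inv w k)) z" z]
        sum_nat_swap_x_diff[OF i, of z]])
qed

lemma canon_type_step:
  assumes w: "w permutes {1..m}" and i: "i \<in> {1..<m}" and r: "2 * r \<le> m"
  shows "canon_type m r (Transposition.transpose i (Suc i) \<circ> w) z =
    canon_type m r w (swap_x i z) + (z (X i) - z (X (Suc i))) * z H"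
proof -
  let ?s = "Transposition.transpose i (Suc i)"
  have k: "inv w k \<in> {1..m}" if "k \<in> {1..m}" for k
    using permutes_in_image[OF permutes_inv[OF w]] that by auto
  have inv: "inv (?s \<circ> w) k = inv w (?s k)" for k
    using o_inv_distrib[OF bij_transpose permutes_bij[OF w], of i "Suc i"] by (simp add: fun_eq_iff)
  have s: "bij_betw ?s {1..m} {1..m}"
    using i by (intro permutes_imp_bij permutes_swap_id) auto
  have "(\<Sum>k=1..m. lf_eval m r (pos_form m r (inv (?s \<circ> w) k)) z * z (X k)) =
      (\<Sum>k=1..m. lf_eval m r (pos_form m r (inv w k)) z * swap_x i z (X k))"
    unfolding inv swap_x_X
    using sum.reindex_bij_betw[OF s, of "\<lambda>k. lf_eval m r (pos_form m r (inv w (?s k))) z * z (X k)"]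
    by simp
  also have "\<dots> = (\<Sum>k=1..m. lf_eval m r (pos_form m r (inv w k)) (swap_x i z) * swap_x i z (X k))"
    by (intro sum.cong refl) (simp add: lf_eval_swap_x[OF lf_on_pos_form[OF k r]])
  finally show ?thesis
    unfolding canon_type_def swap_x_simps
    using arg_cong[OF sum_nat_swap_x_diff[OF i, of z], of "\<lambda>t. z H * t"] by (simp add: right_diff_distrib algebra_simps)
qed

section \<open>The type of the minimal function\<close>

definition ell_index :: "nat \<Rightarrow> nat \<Rightarrow> (nat \<times> nat) set" where
  "ell_index m r = Sigma {1..r} (\<lambda>i. {m - r + i..m})"

text \<open>Both kinds of factors over one index set: the diagonal j = m - r + i carries \<mu>_i,
  the entries beyond it carry h. Exchanges of variables become permutations of the indices.\<close>

definition ell_factor :: "complex \<Rightarrow> nat \<Rightarrow> nat \<Rightarrow> point \<Rightarrow> nat \<times> nat \<Rightarrow> complex" where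
  "ell_factor \<tau> m r p = (\<lambda>(i, j). delta \<tau> (p U * p (X i) / p (X j))
     (if j = m - r + i then p (Mu i) else p H))"

lemma Ell_min_eq:
  assumes "2 * r \<le> m"
  shows "Ell_min \<tau> m r p = (\<Prod>a\<in>ell_index m r. ell_factor \<tau> m r p a)"
proof -
  have "(\<Prod>a\<in>ell_index m r. ell_factor \<tau> m r p a) =
      (\<Prod>i=1..r. \<Prod>j=m-r+i..m. ell_factor \<tau> m r p (i, j))"
    unfolding ell_index_def by (simp add: prod.Sigma)
  also have "\<dots> = Ell_min \<tau> m r p"
    unfolding Ell_min_def
  proof (rule prod.cong[OF refl])
    fix i assume "i \<in> {1..r}"
    then have "{m-r+i..m} = insert (m-r+i) {m-r+i+1..m}" using assms by auto
    moreover have "(\<Prod>j=m-r+i+1..m. ell_factor \<tau> m r p (i, j)) =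
        (\<Prod>j=m-r+i+1..m. delta \<tau> (p U * p (X i) / p (X j)) (p H))"
      by (intro prod.cong) (auto simp: ell_factor_def)
    ultimately show "(\<Prod>j=m-r+i..m. ell_factor \<tau> m r p (i, j)) =
        delta \<tau> (p U * p (X i) / p (X (m - r + i))) (p (Mu i)) *
        (\<Prod>j=m-r+i+1..m. delta \<tau> (p U * p (X i) / p (X j)) (p H))"
      by (simp add: ell_factor_def)
  qed
  finally show ?thesis ..
qed

lemma pure_prod_F_ell:
  assumes "finite A"
    and f: "\<And>a z. a \<in> A \<Longrightarrow> f a (exp_point z) = F_ell \<tau> (lf_eval m r (l a) z) (lf_eval m r (k a) z)"
    and on: "\<And>a. a \<in> A \<Longrightarrow> lf_on (vars m r) (l a)" "\<And>a. a \<in> A \<Longrightarrow> lf_on (vars m r) (k a)"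
    and nz: "\<And>a. a \<in> A \<Longrightarrow> \<exists>v. l a v \<noteq> 0" "\<And>a. a \<in> A \<Longrightarrow> \<exists>v. k a v \<noteq> 0"
      "\<And>a. a \<in> A \<Longrightarrow> \<exists>v. l a v + k a v \<noteq> 0"
  shows "pure_of_type \<tau> m r (\<lambda>p. \<Prod>a\<in>A. f a p) (\<lambda>z. \<Sum>a\<in>A. lf_eval m r (l a) z * lf_eval m r (k a) z)"
  using assms
proof (induction A)
  case empty
  then show ?case by (simp add: pure_const_1)
next
  case (insert a A)
  have "pure_of_type \<tau> m r (\<lambda>p. \<Prod>a\<in>insert a A. f a p)
      (\<lambda>z. lf_eval m r (l a) z * lf_eval m r (k a) z + (\<Sum>a\<in>A. lf_eval m r (l a) z * lf_eval m r (k a) z))"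
    by (rule pure_F_ell_mult[where g = "\<lambda>p. \<Prod>a\<in>A. f a p"]) (use insert in auto)
  then show ?case using insert by simp
qed

text \<open>Count by columns: \<open>y (a + i)\<close> occurs in the rows 1, ..., i - 1.\<close>

lemma sum_triangle:
  fixes y :: "nat \<Rightarrow> complex"
  shows "(\<Sum>i=1..r. \<Sum>j=a+i+1..a+r. y j) = (\<Sum>i=1..r. of_nat (i - 1) * y (a + i))"
proof (induction r)
  case (Suc r)
  have "(\<Sum>i=1..r. \<Sum>j=a+i+1..a+Suc r. y j) = (\<Sum>i=1..r. (\<Sum>j=a+i+1..a+r. y j) + y (a + Suc r))"
  proof (rule sum.cong[OF refl])
    fix i assume "i \<in> {1..r}"
    then have "{a+i+1..a+Suc r} = insert (a + Suc r) {a+i+1..a+r}" by auto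
    then show "(\<Sum>j=a+i+1..a+Suc r. y j) = (\<Sum>j=a+i+1..a+r. y j) + y (a + Suc r)" by simp
  qed
  then show ?case using Suc by (simp add: sum.distrib)
qed simp

lemma ell_type_eq:
  assumes r: "2 * r \<le> m"
  shows "(\<Sum>(i, j)\<in>ell_index m r. (z U + z (X i) - z (X j)) * (if j = m - r + i then z (Mu i) else z H)) =
    canon_type m r id z"
proof -
  define a where "a = m - r"
  have m: "m = a + r" "r \<le> a" using r by (auto simp: a_def)
  have "(\<Sum>(i, j)\<in>ell_index m r. (z U + z (X i) - z (X j)) * (if j = m - r + i then z (Mu i) else z H)) =
      (\<Sum>i=1..r. \<Sum>j=a+i..a+r. (z U + z (X i) - z (X j)) * (if j = a + i then z (Mu i) else z H))"
    unfolding ell_index_def m by (simp add: sum.Sigma)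
  also have "\<dots> = (\<Sum>i=1..r. (z U + z (X i) - z (X (a + i))) * z (Mu i) +
      of_nat (r - i) * (z U + z (X i)) * z H - z H * (\<Sum>j=a+i+1..a+r. z (X j)))"
  proof (rule sum.cong[OF refl])
    fix i assume i: "i \<in> {1..r}"
    then have ins: "{a+i..a+r} = insert (a+i) {a+i+1..a+r}" by auto
    have "(\<Sum>j=a+i+1..a+r. (z U + z (X i) - z (X j)) * (if j = a + i then z (Mu i) else z H)) =
        (\<Sum>j=a+i+1..a+r. (z U + z (X i)) * z H - z H * z (X j))"
      by (intro sum.cong) (auto simp: algebra_simps)
    also have "\<dots> = of_nat (r - i) * (z U + z (X i)) * z H - z H * (\<Sum>j=a+i+1..a+r. z (X j))"
      by (simp add: sum_subtractf sum_distrib_left)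
    finally show "(\<Sum>j=a+i..a+r. (z U + z (X i) - z (X j)) * (if j = a + i then z (Mu i) else z H)) =
        (z U + z (X i) - z (X (a + i))) * z (Mu i) +
        of_nat (r - i) * (z U + z (X i)) * z H - z H * (\<Sum>j=a+i+1..a+r. z (X j))"
      unfolding ins by simp
  qed
  also have "\<dots> = z U * (\<Sum>i=1..r. z (Mu i) + of_nat (r - i) * z H) +
      (\<Sum>i=1..r. (z (Mu i) + of_nat (r - i) * z H) * z (X i)) -
      (\<Sum>i=1..r. z (Mu i) * z (X (a + i))) - z H * (\<Sum>i=1..r. \<Sum>j=a+i+1..a+r. z (X j))"
    by (simp add: sum.distrib sum_subtractf sum_distrib_left algebra_simps)
  also have "z H * (\<Sum>i=1..r. \<Sum>j=a+i+1..a+r. z (X j)) = (\<Sum>i=1..r. of_nat (i - 1) * z H * z (X (a + i)))"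
    unfolding sum_triangle by (simp add: sum_distrib_left mult_ac)
  finally have lhs: "(\<Sum>(i, j)\<in>ell_index m r. (z U + z (X i) - z (X j)) * (if j = m - r + i then z (Mu i) else z H)) =
      z U * (\<Sum>i=1..r. z (Mu i) + of_nat (r - i) * z H) +
      (\<Sum>i=1..r. (z (Mu i) + of_nat (r - i) * z H) * z (X i)) -
      (\<Sum>i=1..r. z (Mu i) * z (X (a + i))) - (\<Sum>i=1..r. of_nat (i - 1) * z H * z (X (a + i)))" .
  \<comment> \<open>The contribution of x_k to \<open>canon_type m r id\<close>. It is compared with
    the left-hand side on the targets (\<open>g1\<close>), the free vertices (\<open>g2\<close>,
    where it vanishes) and the sources (\<open>g3\<close>).\<close>
  define g where "g k = (lf_eval m r (pos_form m r k) z - of_nat k * z H) * z (X k)" for k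
  have form: "lf_eval m r (pos_form m r k) z = of_int (pos_form m r k H) * z H +
      (\<Sum>i=1..r. of_int (pos_form m r k (Mu i)) * z (Mu i))" for k
  proof -
    have "vars m r = insert U (insert H (X ` {1..m} \<union> Mu ` {1..r}))" by (auto simp: vars_def)
    moreover have "U \<notin> insert H (X ` {1..m} \<union> Mu ` {1..r})" "H \<notin> X ` {1..m} \<union> Mu ` {1..r}" by auto
    ultimately have "lf_eval m r (pos_form m r k) z = of_int (pos_form m r k H) * z H +
        (\<Sum>v\<in>X ` {1..m} \<union> Mu ` {1..r}. of_int (pos_form m r k v) * z v)"
      by (simp add: lf_eval_def) (simp add: pos_form_def)
    moreover have "(\<Sum>v\<in>X ` {1..m} \<union> Mu ` {1..r}. of_int (pos_form m r k v) * z v) =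
        (\<Sum>v\<in>X ` {1..m}. of_int (pos_form m r k v) * z v) + (\<Sum>v\<in>Mu ` {1..r}. of_int (pos_form m r k v) * z v)"
      by (rule sum.union_disjoint) auto
    moreover have "(\<Sum>v\<in>X ` {1..m}. of_int (pos_form m r k v) * z v) = 0"
      by (intro sum.neutral) (auto simp: pos_form_def)
    moreover have "(\<Sum>v\<in>Mu ` {1..r}. of_int (pos_form m r k v) * z v) =
        (\<Sum>i=1..r. of_int (pos_form m r k (Mu i)) * z (Mu i))"
      by (subst sum.reindex) (auto simp: inj_on_def)
    ultimately show ?thesis by simp
  qed
  have g1: "g k = (z (Mu k) + of_nat (r - k) * z H) * z (X k)" if k: "k \<in> {1..r}" for k
  proof -
    have "(\<Sum>i=1..r. of_int (pos_form m r k (Mu i)) * z (Mu i)) = (\<Sum>i=1..r. if i = k then z (Mu i) else 0)"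
      using k by (intro sum.cong) (auto simp: pos_form_def)
    then have "lf_eval m r (pos_form m r k) z = of_nat r * z H + z (Mu k)"
      using k unfolding form by (simp add: pos_form_def)
    then show ?thesis using k by (simp add: g_def of_nat_diff algebra_simps)
  qed
  have g2: "g k = 0" if k: "k \<in> {r+1..a}" for k
  proof -
    have "(\<Sum>i=1..r. of_int (pos_form m r k (Mu i)) * z (Mu i)) = 0"
      using k by (intro sum.neutral) (auto simp: pos_form_def a_def)
    then have "lf_eval m r (pos_form m r k) z = of_nat k * z H"
      using k unfolding form by (simp add: pos_form_def a_def)
    then show ?thesis by (simp add: g_def)
  qed
  have g3: "g (a + i) = - z (Mu i) * z (X (a + i)) - of_nat (i - 1) * z H * z (X (a + i))" if i: "i \<in> {1..r}" for i
  proof -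
    have ne: "\<not> a + i \<le> r" "\<not> a + i \<le> m - r" using i m by (auto simp: a_def)
    have "(\<Sum>j=1..r. of_int (pos_form m r (a + i) (Mu j)) * z (Mu j)) = (\<Sum>j=1..r. if j = i then - z (Mu j) else 0)"
      using ne by (intro sum.cong) (auto simp: pos_form_def a_def)
    then have ev: "lf_eval m r (pos_form m r (a + i)) z = of_nat (a + 1) * z H - z (Mu i)"
      using i ne unfolding form by (simp add: pos_form_def a_def)
    show ?thesis unfolding g_def ev using i by (simp add: of_nat_diff algebra_simps)
  qed
  have split: "{1..m} = {1..r} \<union> ({r+1..a} \<union> (+) a ` {1..r})"
    unfolding m(1) using m(2) by (auto simp: image_iff)
  have "(\<Sum>k=1..m. g k) = (\<Sum>k\<in>{1..r}. g k) + ((\<Sum>k\<in>{r+1..a}. g k) + (\<Sum>k\<in>(+) a ` {1..r}. g k))"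
    unfolding split using m(2) by (subst sum.union_disjoint, auto)+
  also have "(\<Sum>k\<in>{r+1..a}. g k) = 0" using g2 by simp
  also have "(\<Sum>k\<in>(+) a ` {1..r}. g k) = (\<Sum>i=1..r. - z (Mu i) * z (X (a + i)) - of_nat (i - 1) * z H * z (X (a + i)))"
    using g3 by (subst sum.reindex) auto
  also have "(\<Sum>k\<in>{1..r}. g k) = (\<Sum>i=1..r. (z (Mu i) + of_nat (r - i) * z H) * z (X i))"
    using g1 by simp
  finally have "(\<Sum>k=1..m. g k) = (\<Sum>i=1..r. (z (Mu i) + of_nat (r - i) * z H) * z (X i)) -
      (\<Sum>i=1..r. z (Mu i) * z (X (a + i))) - (\<Sum>i=1..r. of_nat (i - 1) * z H * z (X (a + i)))"
    by (simp add: sum_subtractf sum_negf)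
  moreover have "canon_type m r id z = (\<Sum>k=1..m. g k) + z U * (\<Sum>i=1..r. z (Mu i) + of_nat (r - i) * z H)"
    by (simp add: canon_type_def g_def algebra_simps sum_subtractf sum_distrib_left)
  ultimately show ?thesis unfolding lhs by simp
qed

lemma pure_Ell_min:
  assumes r: "2 * r \<le> m"
  shows "pure_of_type \<tau> m r (Ell_min \<tau> m r) (canon_type m r id)"
proof -
  define l where "l = (\<lambda>(i, j) v. (lf_var U v + lf_var (X i) v) - lf_var (X j) v)"
  define k where "k = (\<lambda>(i, j). if j = m - r + i then lf_var (Mu i) else lf_var H)"
  have idx: "i \<in> {1..m}" "j \<in> {1..m}" "i \<in> {1..r}" if "(i, j) \<in> ell_index m r" for i j
    using that r by (auto simp: ell_index_def)
  have ev: "lf_eval m r (l (i, j)) z = z U + z (X i) - z (X j)"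
      "lf_eval m r (k (i, j)) z = (if j = m - r + i then z (Mu i) else z H)" if "(i, j) \<in> ell_index m r" for i j z
    using idx[OF that] by (auto simp: l_def k_def lf_eval_diff lf_eval_add)
  have "pure_of_type \<tau> m r (\<lambda>p. \<Prod>a\<in>ell_index m r. ell_factor \<tau> m r p a)
      (\<lambda>z. \<Sum>a\<in>ell_index m r. lf_eval m r (l a) z * lf_eval m r (k a) z)"
  proof (rule pure_prod_F_ell)
    show "finite (ell_index m r)" by (simp add: ell_index_def)
    fix a assume a: "a \<in> ell_index m r"
    obtain i j where ij: "a = (i, j)" by (cases a)
    note a = a[unfolded ij]
    show "ell_factor \<tau> m r (exp_point z) a = F_ell \<tau> (lf_eval m r (l a) z) (lf_eval m r (k a) z)" for z
      unfolding ij ev[OF a]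
      by (simp add: ell_factor_def exp_point_eq unit_exp_diff[symmetric] unit_exp_add[symmetric] delta_unit_exp)
    show "lf_on (vars m r) (l a)"
      unfolding ij l_def prod.case using idx[OF a] by (intro lf_on_diff lf_on_add lf_on_var) auto
    show "lf_on (vars m r) (k a)"
      using idx[OF a] by (auto simp: ij k_def intro!: lf_on_var)
    show "\<exists>v. l a v \<noteq> 0" by (rule exI[of _ U]) (simp add: ij l_def)
    show "\<exists>v. k a v \<noteq> 0" by (rule exI[of _ "if j = m - r + i then Mu i else H"]) (simp add: ij k_def)
    show "\<exists>v. l a v + k a v \<noteq> 0" by (rule exI[of _ U]) (simp add: ij l_def k_def)
  qed
  moreover have "(\<lambda>z. \<Sum>a\<in>ell_index m r. lf_eval m r (l a) z * lf_eval m r (k a) z) = canon_type m r id"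
    by (rule ext, subst ell_type_eq[OF r, symmetric]) (rule sum.cong, auto simp: ev)
  ultimately show ?thesis
    by (simp add: Ell_min_eq[OF r, abs_def])
qed

lemma pure_canon:
  assumes "set is \<subseteq> {1..<m}" and r: "2 * r \<le> m"
  shows "pure_of_type \<tau> m r (canon \<tau> m r is) (canon_type m r (word_perm is))"
  using assms(1)
proof (induction "is")
  case Nil
  then show ?case using pure_Ell_min[OF r] by (simp only: canon.simps word_perm_Nil)
next
  case (Cons i "is")
  have w: "word_perm is permutes {1..m}" and i: "i \<in> {1..<m}"
    using Cons.prems word_perm_permutes[of "is" m] by auto
  have "pure_of_type \<tau> m r (canon \<tau> m r (i # is))
      (\<lambda>z. canon_type m r (word_perm is) (swap_x i z) + (z (X i) - z (X (Suc i))) * z H)"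
    unfolding canon.simps
    by (rule pure_C_op[OF _ i step_param_nontrivial[OF w i r] canon_type_swap_x[OF w i r]]) (use Cons in auto)
  then show ?case
    unfolding word_perm_Cons canon_type_step[OF w i r, abs_def] .
qed

text \<open>This is the existence half of the final theorem: \<open>pure_canon\<close> and
  \<open>canon_type_swap_x\<close> together make every canonical parameter admissible.\<close>

lemma C_word_canon:
  assumes "set is \<subseteq> {1..<m}" and r: "2 * r \<le> m"
  shows "C_word \<tau> m r is (Ell_min \<tau> m r) (canon \<tau> m r is)"
  using assms(1)
proof (induction "is")
  case (Cons i "is")
  have w: "word_perm is permutes {1..m}" and i: "i \<in> {1..<m}"
    using Cons.prems word_perm_permutes[of "is" m] by auto
  have "admissible \<tau> m r i (canon \<tau> m r is) (step_param m r (word_perm is) i)"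
    unfolding admissible_def
    using step_param_nontrivial[OF w i r] pure_canon[of "is" m r \<tau>] canon_type_swap_x[OF w i r] r Cons
    by auto
  then show ?case using Cons by (auto intro: C_word.intros)
qed (auto intro: C_word.intros)

section \<open>Uniqueness of types\<close>

text \<open>The Hessian of the type. Its entries are integers, so each row is again an integral
  linear form and has a monomial on the torus.\<close>

definition tm_gram :: "theta_mono \<Rightarrow> var \<Rightarrow> lin_form" where
  "tm_gram M v u = (\<Sum>(l, e)\<leftarrow>M. e * l v * l u)"

lemma lf_eval_scale: "lf_eval m r (\<lambda>u. c * l u) z = of_int c * lf_eval m r l z"
  by (simp add: lf_eval_def sum_distrib_left mult.assoc)

lemma tm_type_gram:
  "tm_type m r M z = (\<Sum>v\<in>vars m r. z v * lf_eval m r (tm_gram M v) z) / 2"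
proof (induction M)
  case Nil
  then show ?case by (simp add: tm_type_def tm_gram_def[abs_def] lf_eval_def)
next
  case (Cons a M)
  obtain l e where a: "a = (l, e)" by (cases a)
  have "tm_gram (a # M) v = (\<lambda>u. (e * l v) * l u + tm_gram M v u)" for v
    by (simp add: tm_gram_def[abs_def] a)
  then have "(\<Sum>v\<in>vars m r. z v * lf_eval m r (tm_gram (a # M) v) z) =
      (\<Sum>v\<in>vars m r. (of_int e * lf_eval m r l z) * (of_int (l v) * z v) + z v * lf_eval m r (tm_gram M v) z)"
    by (simp only: lf_eval_add lf_eval_scale) (simp add: algebra_simps)
  also have "\<dots> = of_int e * (lf_eval m r l z)\<^sup>2 + (\<Sum>v\<in>vars m r. z v * lf_eval m r (tm_gram M v) z)"
    by (simp add: sum.distrib sum_distrib_left[symmetric] lf_eval_def[of m r l z, symmetric] power2_eq_square)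
  finally show ?case
    using Cons by (simp add: tm_type_def a add_divide_distrib)
qed

lemma lf_eval_upd:
  assumes "v \<in> vars m r"
  shows "lf_eval m r l (z(v := z v + c)) = lf_eval m r l z + of_int (l v) * c"
proof -
  have "lf_eval m r l (z(v := z v + c)) = (\<Sum>u\<in>vars m r. of_int (l u) * z u + (if u = v then of_int (l v) * c else 0))"
    unfolding lf_eval_def by (intro sum.cong) (auto simp: algebra_simps)
  then show ?thesis using assms by (simp add: sum.distrib lf_eval_def)
qed

text \<open>The factor of automorphy under z_v -> z_v + \<tau>, written in terms of the type alone.
  With the unit vector e_v, Q(e_v) is half a diagonal entry of the Hessian, and the difference of
  Q-values is the polarisation of Q at z and e_v. The 1 in 1 - \<tau> accounts for the signs of
  theta.\<close>

definition tau_multiplier :: "complex \<Rightarrow> quad_form \<Rightarrow> var \<Rightarrow> point \<Rightarrow> complex" where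
  "tau_multiplier \<tau> Q v z =
     unit_exp ((1 - \<tau>) * Q (\<lambda>u. of_bool (u = v)) - (Q (z(v := z v + 1)) - Q z - Q (\<lambda>u. of_bool (u = v))))"

lemma tau_multiplier_tm_type:
  assumes v: "v \<in> vars m r"
  shows "tau_multiplier \<tau> (tm_type m r M) v z =
    unit_exp ((1 - \<tau>) / 2 * of_int (tm_gram M v v) - lf_eval m r (tm_gram M v) z)"
proof -
  have base: "lf_eval m r l (\<lambda>u. of_bool (u = v)) = of_int (l v)" for l
  proof -
    have "lf_eval m r l (\<lambda>u. of_bool (u = v)) = (\<Sum>u\<in>vars m r. if u = v then of_int (l u) else 0)"
      unfolding lf_eval_def by (intro sum.cong) auto
    then show ?thesis using v by simp
  qed
  have diag: "tm_type m r M (\<lambda>u. of_bool (u = v)) = of_int (tm_gram M v v) / 2"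
  proof -
    have "(\<Sum>x\<in>vars m r. of_bool (x = v) * complex_of_int (tm_gram M x v)) =
        (\<Sum>x\<in>vars m r. if x = v then complex_of_int (tm_gram M x v) else 0)"
      by (intro sum.cong) auto
    then show ?thesis unfolding tm_type_gram base using v by simp
  qed
  have "tm_type m r M (z(v := z v + 1)) - tm_type m r M z - tm_type m r M (\<lambda>u. of_bool (u = v)) =
      lf_eval m r (tm_gram M v) z"
  proof (induction M)
    case Nil
    then show ?case by (simp add: tm_type_def tm_gram_def[abs_def] lf_eval_def)
  next
    case (Cons a M)
    obtain l e where a: "a = (l, e)" by (cases a)
    have "tm_gram (a # M) v = (\<lambda>u. (e * l v) * l u + tm_gram M v u)"
      by (simp add: tm_gram_def[abs_def] a)
    then have G: "lf_eval m r (tm_gram (a # M) v) z =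
        of_int e * of_int (l v) * lf_eval m r l z + lf_eval m r (tm_gram M v) z"
      by (simp add: lf_eval_add lf_eval_scale)
    have T: "tm_type m r (a # M) y = of_int e * ((lf_eval m r l y)\<^sup>2 / 2) + tm_type m r M y" for y
      by (simp add: tm_type_def a)
    show ?case
      unfolding T G lf_eval_upd[OF v] base Cons[symmetric] by (simp add: power2_eq_square field_simps)
  qed
  then show ?thesis unfolding tau_multiplier_def diag by simp
qed

text \<open>n and n^2 have the same parity. With n^2 the sign becomes quadratic in the form, so that
  the multiplier of a monomial depends on its type only.\<close>

lemma minus_one_powi_eq: "(-1 :: complex) powi n = unit_exp (of_int (n\<^sup>2) / 2)"
proof -
  have half: "unit_exp (1 / 2) = -1"
    by (simp add: unit_exp_def exp_pi_i)
  have "unit_exp (of_int (n\<^sup>2) / 2) = unit_exp (of_int (n\<^sup>2) * (1 / 2))" by simp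
  also have "\<dots> = (-1) powi (n\<^sup>2)" unfolding unit_exp_of_int_mult half ..
  also have "\<dots> = (-1) powi n" by (auto simp: power_int_minus_left)
  finally show ?thesis ..
qed

lemma tm_eval_shift:
  assumes im: "Im \<tau> > 0" and v: "v \<in> vars m r"
  shows "tm_eval \<tau> m r M (z(v := z v + \<tau>)) = tau_multiplier \<tau> (tm_type m r M) v z * tm_eval \<tau> m r M z"
  unfolding tau_multiplier_tm_type[OF v]
proof (induction M)
  case Nil
  then show ?case by (simp add: tm_eval_def tm_gram_def[abs_def] lf_eval_def)
next
  case (Cons a M)
  obtain l e where a: "a = (l, e)" by (cases a)
  have "tm_gram (a # M) v = (\<lambda>u. (e * l v) * l u + tm_gram M v u)"
    by (simp add: tm_gram_def[abs_def] a)
  then have gram: "lf_eval m r (tm_gram (a # M) v) z =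
        of_int e * of_int (l v) * lf_eval m r l z + lf_eval m r (tm_gram M v) z"
      "tm_gram (a # M) v v = e * (l v)\<^sup>2 + tm_gram M v v"
    by (simp_all add: lf_eval_add lf_eval_scale power2_eq_square)
  have "theta \<tau> (lf_eval m r l z + of_int (l v) * \<tau>) =
      unit_exp (of_int ((l v)\<^sup>2) / 2 + (- of_int (l v) * lf_eval m r l z - of_int ((l v)\<^sup>2) * \<tau> / 2)) *
      theta \<tau> (lf_eval m r l z)"
    unfolding theta_plus_int_tau[OF im] minus_one_powi_eq unit_exp_add by simp
  then have "theta \<tau> (lf_eval m r l (z(v := z v + \<tau>))) powi e =
      unit_exp (of_int e * (of_int ((l v)\<^sup>2) / 2 + (- of_int (l v) * lf_eval m r l z - of_int ((l v)\<^sup>2) * \<tau> / 2))) *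
      theta \<tau> (lf_eval m r l z) powi e"
    unfolding lf_eval_upd[OF v] by (simp only: power_int_mult_distrib unit_exp_of_int_mult)
  moreover have "(1 - \<tau>) / 2 * of_int (tm_gram (a # M) v v) - lf_eval m r (tm_gram (a # M) v) z =
      of_int e * (of_int ((l v)\<^sup>2) / 2 + (- of_int (l v) * lf_eval m r l z - of_int ((l v)\<^sup>2) * \<tau> / 2)) +
      ((1 - \<tau>) / 2 * of_int (tm_gram M v v) - lf_eval m r (tm_gram M v) z)"
    unfolding gram by (simp add: field_simps)
  ultimately show ?case
    using Cons unfolding tm_eval_def a by (simp add: unit_exp_add mult_ac)
qed

lemma dense_open_shift:
  assumes "dense_open m r D" "c \<noteq> 0"
  shows "dense_open m r {p. p(v := p v * c) \<in> D}"
proof -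
  have cont: "continuous_on UNIV (\<lambda>p::point. p(v := p v * d))" for d
  proof (rule continuous_on_coordinatewise_then_product)
    show "continuous_on UNIV (\<lambda>p::point. (p(v := p v * d)) u)" for u
      by (cases "u = v") (auto intro!: continuous_intros)
  qed
  have "dense_open m r ((\<lambda>p. p(v := p v * c)) -` D)"
    by (rule dense_open_vimage[OF assms(1) cont cont[of "inverse c"]])
       (use assms(2) in \<open>auto simp: torus_def fun_eq_iff\<close>)
  then show ?thesis by (simp add: vimage_def)
qed

text \<open>Purity speaks only of points \<open>exp_point z\<close>, which vanish nowhere. Zero
  coordinates, necessarily outside \<open>vars m r\<close>, are moved slightly within the open
  set.\<close>

lemma open_torus_everywhere_nonzero:
  assumes "open D" "p \<in> D" "D \<subseteq> torus m r"
  obtains q where "q \<in> D" "\<And>v. v \<in> vars m r \<Longrightarrow> q v = p v" "\<And>v. q v \<noteq> 0"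
proof -
  define P where "P n v = (if p v = 0 then of_real (inverse (real (Suc n))) else p v)" for n v
  have "(\<lambda>n. P n v) \<longlonglongrightarrow> p v" for v
  proof (cases "p v = 0")
    case True
    then show ?thesis
      using tendsto_of_real[OF LIMSEQ_inverse_real_of_nat, where 'a = complex]
      by (simp add: P_def del: of_nat_Suc of_real_inverse)
  qed (simp add: P_def)
  then have "P \<longlonglongrightarrow> p" by (rule tendsto_point)
  then have "eventually (\<lambda>n. P n \<in> D) sequentially"
    using assms by (auto simp: tendsto_def)
  then obtain n where "P n \<in> D" by (auto simp: eventually_sequentially)
  moreover have "P n v = p v" if "v \<in> vars m r" for v
    using that assms by (auto simp: P_def torus_def)
  moreover have "P n v \<noteq> 0" for v by (simp add: P_def del: of_nat_Suc)
  ultimately show ?thesis by (rule that)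
qed

lemma tm_gram_outside: "tm_valid m r M \<Longrightarrow> u \<notin> vars m r \<Longrightarrow> tm_gram M v u = 0"
proof (induction M)
  case (Cons a M)
  then show ?case by (cases a) (auto simp: tm_gram_def tm_valid_def lf_on_def)
qed (simp add: tm_gram_def)

text \<open>If the rows v of the two Hessians differ, the two multipliers for v agree only where the
  monomial of \<open>k\<close> equals the constant \<open>c\<close>. Off this hypersurface f is
  forced to vanish, and its complement is dense.\<close>

lemma pure_type_unique:
  assumes im: "Im \<tau> > 0"
    and f: "pure_of_type \<tau> m r f Q" "pure_of_type \<tau> m r f Q'" and "Q \<noteq> Q'"
    and local: "\<And>p p'. (\<And>v. v \<in> vars m r \<Longrightarrow> p v = p' v) \<Longrightarrow> f p = f p'"
  shows "mero_eq m r f (\<lambda>_. 0)"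
proof -
  obtain L D where L: "L \<noteq> []" "\<forall>(c, M)\<in>set L. tm_valid m r M \<and> tm_type m r M = Q" "dense_open m r D"
      "\<And>z. exp_point z \<in> D \<Longrightarrow> f (exp_point z) = (\<Sum>(c, M)\<leftarrow>L. c * tm_eval \<tau> m r M z)"
    using f(1) unfolding pure_of_type_def by blast
  obtain L' D' where L': "L' \<noteq> []" "\<forall>(c, M)\<in>set L'. tm_valid m r M \<and> tm_type m r M = Q'" "dense_open m r D'"
      "\<And>z. exp_point z \<in> D' \<Longrightarrow> f (exp_point z) = (\<Sum>(c, M)\<leftarrow>L'. c * tm_eval \<tau> m r M z)"
    using f(2) unfolding pure_of_type_def by blast
  obtain M where M: "tm_valid m r M" "tm_type m r M = Q"
    using L(1,2) by (cases L) auto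
  obtain M' where M': "tm_valid m r M'" "tm_type m r M' = Q'"
    using L'(1,2) by (cases L') auto
  have "\<exists>v\<in>vars m r. tm_gram M v \<noteq> tm_gram M' v"
  proof (rule ccontr)
    assume "\<not> ?thesis"
    then have "\<forall>v\<in>vars m r. tm_gram M v = tm_gram M' v" by blast
    then have "tm_type m r M = tm_type m r M'" by (intro ext) (simp add: tm_type_gram)
    then show False using M M' \<open>Q \<noteq> Q'\<close> by simp
  qed
  then obtain v where v: "v \<in> vars m r" "tm_gram M v \<noteq> tm_gram M' v" by blast
  then obtain u where u: "tm_gram M v u \<noteq> tm_gram M' v u" by blast
  define k where "k = (\<lambda>u. tm_gram M v u - tm_gram M' v u)"
  have ku: "u \<in> vars m r" "k u \<noteq> 0"
    using u tm_gram_outside[OF M(1), of u v] tm_gram_outside[OF M'(1), of u v]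
    by (metis, simp add: k_def)
  define c where "c = unit_exp ((1 - \<tau>) / 2 * of_int (tm_gram M v v) - (1 - \<tau>) / 2 * of_int (tm_gram M' v v))"
  have K: "dense_open m r {p \<in> torus m r. lf_mono m r k p \<notin> {c}}"
  proof (rule dense_open_lf_mono_avoid[where v = u and l = k, OF ku(1) ku(2)])
    have "{a. a \<noteq> 0 \<and> a \<notin> {c}} = - {0, c}" by auto
    then show "open {a. a \<noteq> 0 \<and> a \<notin> {c}}" by (simp add: open_Compl finite_imp_closed)
    fix a :: complex and t :: real assume a: "a \<in> {c}" "a \<noteq> 0" "0 < t" "t < 1"
    show "a * unit_exp (of_real t) \<notin> {c}"
    proof
      assume "a * unit_exp (of_real t) \<in> {c}"
      then have "unit_exp (of_real t) = unit_exp 0" using a by simp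
      then obtain n :: int where "complex_of_real t = of_int n" unfolding unit_exp_eq_iff by auto
      then have "t = of_int n" by (metis of_real_eq_iff of_real_of_int_eq)
      then show False using a by auto
    qed
  qed
  \<comment> \<open>The point and its shift by \<tau> must both lie where both representations of f
    are valid.\<close>
  define E where "E = (D \<inter> D') \<inter> ({p. p(v := p v * unit_exp \<tau>) \<in> D \<inter> D'} \<inter> {p \<in> torus m r. lf_mono m r k p \<notin> {c}})"
  have E: "dense_open m r E"
    unfolding E_def by (intro dense_open_Int dense_open_shift L(3) L'(3) K unit_exp_nonzero)
  have sh: "exp_point (z(v := z v + \<tau>)) = (exp_point z)(v := exp_point z v * unit_exp \<tau>)" for z
    by (auto simp: fun_eq_iff exp_point_eq unit_exp_add)
  have quasi: "f (exp_point (z(v := z v + \<tau>))) = tau_multiplier \<tau> Q'' v z * f (exp_point z)"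
    if "exp_point z \<in> D''" "exp_point (z(v := z v + \<tau>)) \<in> D''"
      and t: "\<forall>(c, M)\<in>set L''. tm_valid m r M \<and> tm_type m r M = Q''"
      and e: "\<And>z. exp_point z \<in> D'' \<Longrightarrow> f (exp_point z) = (\<Sum>(c, M)\<leftarrow>L''. c * tm_eval \<tau> m r M z)"
    for z Q'' L'' D''
  proof -
    have "f (exp_point (z(v := z v + \<tau>))) = (\<Sum>(c, M)\<leftarrow>L''. c * tm_eval \<tau> m r M (z(v := z v + \<tau>)))"
      using e[OF that(2)] .
    also have "\<dots> = (\<Sum>(c, M)\<leftarrow>L''. tau_multiplier \<tau> Q'' v z * (c * tm_eval \<tau> m r M z))"
      by (intro arg_cong[where f = sum_list] map_cong refl) (use t tm_eval_shift[OF im v(1)] in auto)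
    also have "\<dots> = tau_multiplier \<tau> Q'' v z * f (exp_point z)"
      unfolding e[OF that(1)] sum_list_const_mult[symmetric] by (simp add: case_prod_unfold)
    finally show ?thesis .
  qed
  show ?thesis
  proof (rule mero_eqI[OF E])
    fix p assume p: "p \<in> E"
    \<comment> \<open>The point \<open>q\<close> has a full logarithm and agrees with p on
      \<open>vars m r\<close>; the hypothesis \<open>local\<close> carries the value of f back to
      p.\<close>
    obtain q where q: "q \<in> E" "\<And>v. v \<in> vars m r \<Longrightarrow> q v = p v" "\<And>v. q v \<noteq> 0"
      using open_torus_everywhere_nonzero[of E p m r] E p unfolding dense_open_def by metis
    define z where "z = (\<lambda>v. Ln (q v) / (2 * of_real pi * \<i>))"
    have z: "exp_point z = q" using q(3) by (simp add: fun_eq_iff exp_point_def z_def)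
    have "f q = 0"
    proof (rule ccontr)
      assume "f q \<noteq> 0"
      have "exp_point z \<in> D" "exp_point z \<in> D'" "exp_point (z(v := z v + \<tau>)) \<in> D"
          "exp_point (z(v := z v + \<tau>)) \<in> D'"
        using q(1) unfolding sh unfolding z E_def by auto
      then have "tau_multiplier \<tau> Q v z * f q = tau_multiplier \<tau> Q' v z * f q"
        using quasi[OF _ _ L(2) L(4)] quasi[OF _ _ L'(2) L'(4)] z by metis
      then have "tau_multiplier \<tau> (tm_type m r M) v z = tau_multiplier \<tau> (tm_type m r M') v z"
        using \<open>f q \<noteq> 0\<close> M M' by simp
      then have "unit_exp (lf_eval m r (tm_gram M v) z - lf_eval m r (tm_gram M' v) z) = c"
        unfolding tau_multiplier_tm_type[OF v(1)] c_def unit_exp_diff by (simp add: field_simps)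
      then have "lf_mono m r k q = c"
        unfolding z[symmetric] lf_mono_unit_exp[OF exp_point_eq] k_def lf_eval_diff .
      then show False using q(1) by (simp add: E_def)
    qed
    then show "f p = 0" using local[of q p] q(2) by simp
  qed
qed

lemma pure_mero_eq:
  assumes "pure_of_type \<tau> m r g Q" "mero_eq m r f g"
  shows "pure_of_type \<tau> m r f Q"
proof -
  obtain L D where L: "L \<noteq> []" "\<forall>(c, M)\<in>set L. tm_valid m r M \<and> tm_type m r M = Q" "dense_open m r D"
      "\<forall>z. exp_point z \<in> D \<longrightarrow> g (exp_point z) = (\<Sum>(c, M)\<leftarrow>L. c * tm_eval \<tau> m r M z)"
    using assms(1) unfolding pure_of_type_def by blast
  obtain E where E: "dense_open m r E" "\<forall>p\<in>E. f p = g p"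
    using assms(2) by (auto simp: mero_eq_def)
  show ?thesis
    unfolding pure_of_type_def
    by (rule exI[of _ L], intro conjI exI[of _ "D \<inter> E"] dense_open_Int) (use L E in auto)
qed

lemma canon_local:
  assumes "set is \<subseteq> {1..<m}" "2 * r \<le> m" "\<And>v. v \<in> vars m r \<Longrightarrow> p v = p' v"
  shows "canon \<tau> m r is p = canon \<tau> m r is p'"
  using assms(1,3)
proof (induction "is" arbitrary: p p')
  case Nil
  have "ell_factor \<tau> m r p a = ell_factor \<tau> m r p' a" if "a \<in> ell_index m r" for a
  proof -
    obtain i j where a: "a = (i, j)" by (cases a)
    then have "X i \<in> vars m r" "X j \<in> vars m r" "Mu i \<in> vars m r"
      using that assms(2) by (auto simp: ell_index_def)
    then show ?thesis
      using Nil(2)[of U] Nil(2)[of H] Nil(2)[of "X i"] Nil(2)[of "X j"] Nil(2)[of "Mu i"]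
      by (simp add: a ell_factor_def)
  qed
  then show ?case by (simp add: Ell_min_eq[OF assms(2)])
next
  case (Cons i "is")
  have i: "i \<in> {1..<m}" using Cons.prems by auto
  have sw: "swap_x i p v = swap_x i p' v" if "v \<in> vars m r" for v
    using Cons.prems(2) transpose_vars[of "X i" "X (Suc i)" m r v] that i
    by (auto simp: swap_x_def)
  have "canon \<tau> m r is (swap_x i p) = canon \<tau> m r is (swap_x i p')"
    by (rule Cons.IH) (use Cons.prems(1) sw in simp_all)
  moreover have "canon \<tau> m r is p = canon \<tau> m r is p'"
    by (rule Cons.IH) (use Cons.prems in simp_all)
  moreover have "lf_mono m r l p = lf_mono m r l p'" for l
    unfolding lf_mono_def using Cons.prems(2) by (intro prod.cong) auto
  moreover have "p (X i) = p' (X i)" "p (X (Suc i)) = p' (X (Suc i))" "p H = p' H"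
    using Cons.prems(2) i by auto
  ultimately show ?case by (simp add: C_op_def)
qed

lemma C_word_mero_eq_canon:
  assumes im: "Im \<tau> > 0" and r: "2 * r \<le> m"
    and "C_word \<tau> m r is (Ell_min \<tau> m r) g" "set is \<subseteq> {1..<m}"
  shows "mero_eq m r g (canon \<tau> m r is)"
  using assms(3,4)
proof (induction "is" "Ell_min \<tau> m r" g rule: C_word.induct)
  case Nil
  then show ?case by simp
next
  case (Cons "is" g i \<nu>)
  have i: "i \<in> {1..<m}" and is_sub: "set is \<subseteq> {1..<m}" using Cons.prems by auto
  define w where "w = word_perm is"
  have w: "w permutes {1..m}" unfolding w_def by (rule word_perm_permutes[OF is_sub])
  have eq: "mero_eq m r g (canon \<tau> m r is)" using Cons is_sub by blast
  obtain Q where \<nu>: "nontrivial_character r \<nu>" and Q: "pure_of_type \<tau> m r g Q"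
      "\<And>z. Q z - Q (swap_x i z) = (z (X i) - z (X (Suc i))) * (lf_eval m r \<nu> z + z H)"
    using Cons unfolding admissible_def by blast
  note pure = pure_mero_eq[OF Q(1) mero_eq_sym[OF eq]] pure_canon[OF is_sub r, of \<tau>, folded w_def]
  show ?case
  proof (cases "Q = canon_type m r w")
    case True
    have "\<nu> v = step_param m r w i v" if v: "v \<in> {H} \<union> Mu ` {1..r}" for v
    proof -
      have vv: "v \<in> vars m r" "v \<noteq> X i" "v \<noteq> X (Suc i)" using v by (auto simp: vars_def)
      \<comment> \<open>A test point with x_i - x_(i+1) = 1 and v as its only other nonzero
        coordinate: there the equation for the parameter yields the coefficient at v.\<close>
      define z :: point where "z = (\<lambda>u. of_bool (u = v) + of_bool (u = X i))"
      have zx: "z (X i) = 1" "z (X (Suc i)) = 0" using vv by (auto simp: z_def)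
      have ev: "lf_eval m r l z = of_int (l v)" if "lf_on ({H} \<union> Mu ` {1..r}) l" for l
      proof -
        have "lf_eval m r l z = (\<Sum>u\<in>vars m r. if u = v then of_int (l u) else 0)"
          unfolding lf_eval_def using that vv by (intro sum.cong) (auto simp: z_def lf_on_def)
        then show ?thesis using vv by simp
      qed
      have "lf_eval m r \<nu> z + z H = lf_eval m r (step_param m r w i) z + z H"
        using Q(2)[of z] canon_type_swap_x[OF w i r, of z] by (simp add: True zx)
      then show ?thesis
        using ev \<nu> step_param_nontrivial[OF w i r] by (simp add: nontrivial_character_def)
    qed
    then have "\<nu> = step_param m r w i"
      using \<nu> step_param_nontrivial[OF w i r]
      unfolding nontrivial_character_def lf_on_def fun_eq_iff by metis
    then show ?thesis using C_op_cong[OF eq i] by (simp add: w_def)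
  next
    case False
    \<comment> \<open>Through its equality with \<open>g\<close>, the canonical function has the
      type Q besides its own.\<close>
    have "mero_eq m r (canon \<tau> m r is) (\<lambda>_. 0)"
      by (rule pure_type_unique[OF im pure False canon_local[OF is_sub r]])
    then have zero: "mero_eq m r (C_op \<tau> m r i \<mu> (canon \<tau> m r is)) (C_op \<tau> m r i \<mu> (\<lambda>_. 0))"
        and zero': "mero_eq m r (C_op \<tau> m r i \<mu> g) (C_op \<tau> m r i \<mu> (\<lambda>_. 0))" for \<mu>
      using C_op_cong[OF _ i] mero_eq_trans[OF eq] by blast+
    have C0: "C_op \<tau> m r i \<mu> (\<lambda>_. 0) = (\<lambda>_. 0)" for \<mu> by (simp add: C_op_def fun_eq_iff)
    show ?thesis
      using mero_eq_trans[OF zero'[of \<nu>, unfolded C0] mero_eq_sym[OF zero[of "step_param m r w i", unfolded C0]]]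
      by (simp add: w_def)
  qed
qed

section \<open>Reduced words in the symmetric group\<close>

definition inversions :: "nat \<Rightarrow> (nat \<Rightarrow> nat) \<Rightarrow> (nat \<times> nat) set" where
  "inversions m w = {(p, q). 1 \<le> p \<and> p < q \<and> q \<le> m \<and> w q < w p}"

lemma finite_inversions [simp]: "finite (inversions m w)"
  by (rule finite_subset[of _ "{1..m} \<times> {1..m}"]) (auto simp: inversions_def)

abbreviation adj :: "nat \<Rightarrow> nat \<Rightarrow> nat" where
  "adj i \<equiv> Transposition.transpose i (Suc i)"

lemma adj_adj [simp]: "adj i \<circ> adj i = id" "adj i \<circ> (adj i \<circ> w) = w" "w \<circ> adj i \<circ> adj i = w"
  by (auto simp: fun_eq_iff)

lemma adj_permutes: "i \<in> {1..<m} \<Longrightarrow> adj i permutes {1..m}"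
  by (rule permutes_swap_id) auto

lemma adj_comp_permutes: "w permutes {1..m} \<Longrightarrow> i \<in> {1..<m} \<Longrightarrow> adj i \<circ> w permutes {1..m}"
  using permutes_compose adj_permutes by blast

lemma comp_adj_permutes: "w permutes {1..m} \<Longrightarrow> i \<in> {1..<m} \<Longrightarrow> w \<circ> adj i permutes {1..m}"
  using permutes_compose adj_permutes by blast

lemma inv_adj_comp:
  assumes "w permutes {1..m}"
  shows "inv (adj i \<circ> w) = inv w \<circ> adj i"
  using o_inv_distrib[OF bij_transpose permutes_bij[OF assms], of i "Suc i"] by simp

lemma inv_in_range:
  assumes "w permutes {1..m}" "k \<in> {1..m}"
  shows "inv w k \<in> {1..m}"
  using permutes_in_image[OF permutes_inv[OF assms(1)]] assms(2) by blast

text \<open>Composition with \<open>adj i\<close> on the left exchanges the values i and i + 1, so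
  the order changes only for the pair of positions that carry them.\<close>

lemma inversions_adj_comp:
  assumes w: "w permutes {1..m}" and i: "i \<in> {1..<m}" and asc: "inv w i < inv w (Suc i)"
  shows "inversions m (adj i \<circ> w) = insert (inv w i, inv w (Suc i)) (inversions m w)"
    and "(inv w i, inv w (Suc i)) \<notin> inversions m w"
proof -
  have wi: "w (inv w k) = k" for k using permutes_inverses[OF w] by simp
  have inv_eq: "p = inv w k" if "w p = k" for p k using that permutes_inverses[OF w] by auto
  have rng: "1 \<le> inv w i" "inv w (Suc i) \<le> m"
    using inv_in_range[OF w, of i] inv_in_range[OF w, of "Suc i"] i by auto
  show "(inv w i, inv w (Suc i)) \<notin> inversions m w" by (simp add: inversions_def wi)
  have flip: "adj i b < adj i a \<longleftrightarrow> b < a" if "\<not> (a = i \<and> b = Suc i)" "\<not> (a = Suc i \<and> b = i)" for a b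
    using that by (auto simp: Transposition.transpose_def)
  have "(adj i (w q) < adj i (w p)) \<longleftrightarrow> (w q < w p) \<or> (p = inv w i \<and> q = inv w (Suc i))" if "p < q" for p q
  proof (cases "w p = i \<and> w q = Suc i \<or> w p = Suc i \<and> w q = i")
    case True
    then show ?thesis
    proof
      assume a: "w p = i \<and> w q = Suc i"
      then show ?thesis using inv_eq[of p i] inv_eq[of q "Suc i"] by auto
    next
      assume a: "w p = Suc i \<and> w q = i"
      then have "p = inv w (Suc i)" "q = inv w i" using inv_eq[of p "Suc i"] inv_eq[of q i] by auto
      then show ?thesis using asc that by simp
    qed
  next
    case False
    then have "\<not> (p = inv w i \<and> q = inv w (Suc i))" using wi by auto
    then show ?thesis using False flip[of "w p" "w q"] by auto
  qed
  then show "inversions m (adj i \<circ> w) = insert (inv w i, inv w (Suc i)) (inversions m w)"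
    using rng asc by (auto simp: inversions_def)
qed

lemma card_inversions_adj_comp:
  assumes "w permutes {1..m}" "i \<in> {1..<m}" "inv w i < inv w (Suc i)"
  shows "card (inversions m (adj i \<circ> w)) = Suc (card (inversions m w))"
  using inversions_adj_comp[OF assms] by simp

lemma card_inversions_adj_comp_descent:
  assumes w: "w permutes {1..m}" and i: "i \<in> {1..<m}" and "inv w (Suc i) < inv w i"
  shows "card (inversions m w) = Suc (card (inversions m (adj i \<circ> w)))"
  using card_inversions_adj_comp[OF adj_comp_permutes[OF w i] i] assms
  by (simp add: inv_adj_comp[OF w])

lemma inv_adjacent_cases:
  assumes "w permutes {1..m}"
  shows "inv w i < inv w (Suc i) \<or> inv w (Suc i) < inv w i"
  using permutes_inj[OF permutes_inv[OF assms]] by (metis inj_eq n_not_Suc_n nat_neq_iff)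

text \<open>The inversions of \<open>w \<circ> t\<close> inject into those of \<open>w\<close>: a pair whose order \<open>t\<close> preserves is
  moved by \<open>t\<close>, any other pair is kept; the pair \<open>(a, b)\<close> is missed.\<close>

lemma inversions_comp_transpose:
  assumes ab: "1 \<le> a" "a < b" "b \<le> m" and desc: "w b < w a"
  shows "card (inversions m (w \<circ> Transposition.transpose a b)) < card (inversions m w)"
proof -
  let ?t = "Transposition.transpose a b"
  define \<phi> where "\<phi> = (\<lambda>(p, q). if ?t p < ?t q then (?t p, ?t q) else (p, q))"
  have into: "\<phi> x \<in> inversions m w - {(a, b)}" if "x \<in> inversions m (w \<circ> ?t)" for x
    using that ab desc
    by (cases x) (auto simp: \<phi>_def inversions_def Transposition.transpose_def split: if_splits)
  have "inj_on \<phi> (inversions m (w \<circ> ?t))"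
  proof (rule inj_onI)
    fix x y assume xy: "x \<in> inversions m (w \<circ> ?t)" "y \<in> inversions m (w \<circ> ?t)" "\<phi> x = \<phi> y"
    obtain p q p' q' where x: "x = (p, q)" "y = (p', q')" by (cases x, cases y)
    have lt: "p < q" "p' < q'" using xy x by (auto simp: inversions_def)
    have inj: "?t u = ?t u' \<longleftrightarrow> u = u'" for u u' by (metis transpose_involutory)
    show "x = y"
      using xy(3) lt unfolding x \<phi>_def by (auto simp: inj split: if_splits)
  qed
  moreover have "\<phi> ` inversions m (w \<circ> ?t) \<subseteq> inversions m w - {(a, b)}"
    by (rule image_subsetI) (rule into)
  ultimately have "card (inversions m (w \<circ> ?t)) \<le> card (inversions m w - {(a, b)})"
    by (rule card_inj_on_le) simp
  also have "\<dots> < card (inversions m w)"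
    using ab desc by (intro psubset_card_mono[OF finite_inversions]) (auto simp: inversions_def)
  finally show ?thesis .
qed

text \<open>Induction from the left end gives k \<le> w k, induction from the right end gives w k
  \<le> k.\<close>

lemma increasing_permutes_eq_id:
  assumes w: "w permutes {1..m}" and inc: "\<And>i. i \<in> {1..<m} \<Longrightarrow> w i < w (Suc i)"
  shows "w = id"
proof -
  have rng: "w k \<in> {1..m}" if "k \<in> {1..m}" for k
    using permutes_in_image[OF w] that by blast
  have low: "k \<le> w k" if "1 \<le> k" "k \<le> m" for k
    using that
  proof (induction k rule: nat_induct_at_least)
    case base
    then show ?case using rng[of 1] by simp
  next
    case (Suc k)
    then show ?case using inc[of k] by simp
  qed
  have high: "w (m - d) \<le> m - d" if "d < m" for d
    using that
  proof (induction d)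
    case 0
    then show ?case using rng[of m] by simp
  next
    case (Suc d)
    then have "Suc (m - Suc d) = m - d" "m - Suc d \<in> {1..<m}" by auto
    then show ?case using Suc inc[of "m - Suc d"] by auto
  qed
  have "w k = k" for k
  proof (cases "k \<in> {1..m}")
    case True
    then show ?thesis using low[of k] high[of "m - k"] by auto
  next
    case False
    then show ?thesis using permutes_not_in[OF w] by blast
  qed
  then show ?thesis by auto
qed

lemma inversions_id [simp]: "inversions m id = {}"
  by (auto simp: inversions_def)

lemma exists_word_length_inversions:
  assumes "w permutes {1..m}"
  shows "\<exists>is. set is \<subseteq> {1..<m} \<and> word_perm is = w \<and> length is = card (inversions m w)"
  using assms
proof (induction "card (inversions m w)" arbitrary: w rule: less_induct)
  case less
  note w = less.prems
  show ?case
  proof (cases "\<exists>i\<in>{1..<m}. inv w (Suc i) < inv w i")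
    case True
    then obtain i where i: "i \<in> {1..<m}" "inv w (Suc i) < inv w i" by blast
    note N = card_inversions_adj_comp_descent[OF w i]
    obtain "is" where is_word: "set is \<subseteq> {1..<m}" "word_perm is = adj i \<circ> w"
        "length is = card (inversions m (adj i \<circ> w))"
      using less.hyps[OF _ adj_comp_permutes[OF w i(1)]] N by auto
    then have "set (i # is) \<subseteq> {1..<m} \<and> word_perm (i # is) = w \<and> length (i # is) = card (inversions m w)"
      using i N by simp
    then show ?thesis by blast
  next
    case False
    then have "inv w i < inv w (Suc i)" if "i \<in> {1..<m}" for i
      using that inv_adjacent_cases[OF w, of i] by blast
    then have "inv w = id" by (rule increasing_permutes_eq_id[OF permutes_inv[OF w]])
    then have "w = id" using permutes_inv_inv[OF w] by (metis inv_id)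
    then show ?thesis by (intro exI[of _ "[]"]) simp
  qed
qed

lemma card_inversions_le_length:
  assumes "set is \<subseteq> {1..<m}"
  shows "card (inversions m (word_perm is)) \<le> length is"
  using assms
proof (induction "is")
  case (Cons i "is")
  then have w: "word_perm is permutes {1..m}" and i: "i \<in> {1..<m}"
    using word_perm_permutes[of "is" m] by auto
  then have "card (inversions m (adj i \<circ> word_perm is)) \<le> Suc (card (inversions m (word_perm is)))"
    using inv_adjacent_cases[OF w, of i] card_inversions_adj_comp[OF w i]
      card_inversions_adj_comp_descent[OF w i] by auto
  moreover have "card (inversions m (word_perm is)) \<le> length is" using Cons by simp
  ultimately show ?case unfolding word_perm_Cons list.size by linarith
qed simp

lemma coxeter_length_eq:
  assumes "w permutes {1..m}"
  shows "coxeter_length m w = card (inversions m w)"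
  unfolding coxeter_length_def
proof (rule Least_equality)
  show "\<exists>is. set is \<subseteq> {1..<m} \<and> word_perm is = w \<and> length is = card (inversions m w)"
    by (rule exists_word_length_inversions[OF assms])
qed (use card_inversions_le_length in auto)

lemma reduced_word_iff:
  assumes "w permutes {1..m}"
  shows "reduced_word m w is \<longleftrightarrow> set is \<subseteq> {1..<m} \<and> word_perm is = w \<and> length is = card (inversions m w)"
  unfolding reduced_word_def coxeter_length_eq[OF assms] ..

lemma exists_reduced_word:
  assumes "w permutes {1..m}"
  obtains "is" where "reduced_word m w is"
  using exists_word_length_inversions[OF assms] reduced_word_iff[OF assms] by blast

lemma reduced_word_ConsD:
  assumes w: "w permutes {1..m}" and red: "reduced_word m w (i # is)"
  shows "i \<in> {1..<m}" "reduced_word m (adj i \<circ> w) is" "inv w (Suc i) < inv w i"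
proof -
  have r: "i \<in> {1..<m}" "set is \<subseteq> {1..<m}" "adj i \<circ> word_perm is = w" "Suc (length is) = card (inversions m w)"
    using red unfolding reduced_word_iff[OF w] by auto
  have wp: "word_perm is = adj i \<circ> w" using r(3) by auto
  have "card (inversions m (adj i \<circ> w)) \<le> length is"
    using card_inversions_le_length[OF r(2)] wp by simp
  then show desc: "inv w (Suc i) < inv w i"
    using inv_adjacent_cases[OF w, of i] card_inversions_adj_comp[OF w r(1)] r(4) by auto
  show "i \<in> {1..<m}" by (rule r(1))
  show "reduced_word m (adj i \<circ> w) is"
    unfolding reduced_word_iff[OF adj_comp_permutes[OF w r(1)]]
    using r wp card_inversions_adj_comp_descent[OF w r(1) desc] by simp
qed

lemma reduced_word_ConsI:
  assumes w: "w permutes {1..m}" and i: "i \<in> {1..<m}" and desc: "inv w (Suc i) < inv w i"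
    and red: "reduced_word m (adj i \<circ> w) is"
  shows "reduced_word m w (i # is)"
  using red card_inversions_adj_comp_descent[OF w i desc]
  unfolding reduced_word_iff[OF w] reduced_word_iff[OF adj_comp_permutes[OF w i]] using i by auto

lemma adj_commute: "Suc i < j \<Longrightarrow> adj i \<circ> (adj j \<circ> w) = adj j \<circ> (adj i \<circ> w)"
  by (auto simp: fun_eq_iff Transposition.transpose_def)

lemma adj_braid: "adj i \<circ> (adj (Suc i) \<circ> (adj i \<circ> w)) = adj (Suc i) \<circ> (adj i \<circ> (adj (Suc i) \<circ> w))"
  by (auto simp: fun_eq_iff Transposition.transpose_def)

text \<open>Matsumoto's theorem as a principle for an equivalence \<open>R\<close>. In the premise
  on prefixing a letter the two words must have the same permutation, because the parameters of
  \<open>canon\<close> are computed from it.\<close>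

theorem word_property:
  fixes R :: "nat list \<Rightarrow> nat list \<Rightarrow> bool"
  assumes refl: "\<And>is. R is is" and sym: "\<And>is js. R is js \<Longrightarrow> R js is"
    and trans: "\<And>is js ks. R is js \<Longrightarrow> R js ks \<Longrightarrow> R is ks"
    and cong: "\<And>i is js. i \<in> {1..<m} \<Longrightarrow> word_perm is = word_perm js \<Longrightarrow> R is js \<Longrightarrow> R (i # is) (i # js)"
    and comm: "\<And>i j is. i \<in> {1..<m} \<Longrightarrow> j \<in> {1..<m} \<Longrightarrow> Suc i < j \<Longrightarrow> set is \<subseteq> {1..<m} \<Longrightarrow>
      R (i # j # is) (j # i # is)"
    and braid: "\<And>i is. i \<in> {1..<m} \<Longrightarrow> Suc i \<in> {1..<m} \<Longrightarrow> set is \<subseteq> {1..<m} \<Longrightarrow>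
      R (i # Suc i # i # is) (Suc i # i # Suc i # is)"
    and w: "w permutes {1..m}" and red: "reduced_word m w is" "reduced_word m w js"
  shows "R is js"
  using w red
proof (induction "length is" arbitrary: w "is" js rule: less_induct)
  case less
  note w = less.prems(1)
  have len_eq: "length is = length js" using less.prems by (simp add: reduced_word_iff[OF w])
  show ?case
  proof (cases "is")
    case Nil
    then have "js = []" using len_eq by simp
    then show ?thesis using Nil refl by simp
  next
    case (Cons i is')
    obtain j js' where js: "js = j # js'" using Cons len_eq by (cases js) auto
    note isi = reduced_word_ConsD[OF w less.prems(2)[unfolded Cons]]
    note jsj = reduced_word_ConsD[OF w less.prems(3)[unfolded js]]
    have wp: "word_perm is' = adj i \<circ> w" "word_perm js' = adj j \<circ> w"
      using isi(2) jsj(2) by (auto simp: reduced_word_def)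
    have len: "length is' < length is" "length js' < length is"
      using Cons js len_eq by auto
    have IHi: "R is' ks" if "reduced_word m (adj i \<circ> w) ks" for ks
      using less.hyps[OF len(1) adj_comp_permutes[OF w isi(1)] isi(2) that] .
    have IHj: "R js' ks" if "reduced_word m (adj j \<circ> w) ks" for ks
      using less.hyps[OF len(2) adj_comp_permutes[OF w jsj(1)] jsj(2) that] .
    \<comment> \<open>Both first letters are descents. Then w has reduced words starting with each
      of the two forms of the longest word in s_i and s_j, followed by a common rest
      \<open>ks\<close>; the induction hypothesis links the given words to them, and
      \<open>comm\<close> or \<open>braid\<close> links the two forms.\<close>
    have main: "R (i # is') (j # js')"
      if i: "i \<in> {1..<m}" "inv w (Suc i) < inv w i" and j: "j \<in> {1..<m}" "inv w (Suc j) < inv w j"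
        and wpi: "word_perm is' = adj i \<circ> w" and wpj: "word_perm js' = adj j \<circ> w"
        and IHi: "\<And>ks. reduced_word m (adj i \<circ> w) ks \<Longrightarrow> R is' ks"
        and IHj: "\<And>ks. reduced_word m (adj j \<circ> w) ks \<Longrightarrow> R js' ks" and less: "i < j"
      for i j is' js'
    proof (cases "Suc i < j")
      case True
      define v where "v = adj j \<circ> (adj i \<circ> w)"
      have v': "v = adj i \<circ> (adj j \<circ> w)" unfolding v_def adj_commute[OF True] ..
      note p = adj_comp_permutes[OF w i(1)] adj_comp_permutes[OF w j(1)]
      have "v permutes {1..m}" unfolding v_def by (rule adj_comp_permutes[OF p(1) j(1)])
      then obtain ks where ks: "reduced_word m v ks" by (rule exists_reduced_word)
      have a: "reduced_word m (adj i \<circ> w) (j # ks)"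
        using p(1) j(1)
        by (rule reduced_word_ConsI) (use j i True ks in \<open>auto simp: inv_adj_comp[OF w] v_def transpose_apply_other\<close>)
      have b: "reduced_word m (adj j \<circ> w) (i # ks)"
        using p(2) i(1)
        by (rule reduced_word_ConsI) (use j i True ks in \<open>auto simp: inv_adj_comp[OF w] v' transpose_apply_other\<close>)
      have ks_sub: "set ks \<subseteq> {1..<m}" using ks by (simp add: reduced_word_def)
      have "R (i # is') (i # j # ks)"
        using i(1) _ IHi[OF a] by (rule cong) (use a wpi in \<open>simp add: reduced_word_def\<close>)
      moreover have "R (i # j # ks) (j # i # ks)" by (rule comm[OF i(1) j(1) True ks_sub])
      moreover have "R (j # js') (j # i # ks)"
        using j(1) _ IHj[OF b] by (rule cong) (use b wpj in \<open>simp add: reduced_word_def\<close>)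
      ultimately show ?thesis using trans sym by blast
    next
      case False
      then have ji: "j = Suc i" using less by simp
      define v where "v = adj i \<circ> (adj j \<circ> (adj i \<circ> w))"
      have v': "v = adj j \<circ> (adj i \<circ> (adj j \<circ> w))" unfolding v_def ji adj_braid ..
      note p = adj_comp_permutes[OF w i(1)] adj_comp_permutes[OF w j(1)]
      note pp = adj_comp_permutes[OF p(1) j(1)] adj_comp_permutes[OF p(2) i(1)]
      have "v permutes {1..m}" unfolding v_def by (rule adj_comp_permutes[OF pp(1) i(1)])
      then obtain ks where ks: "reduced_word m v ks" by (rule exists_reduced_word)
      have ij: "inv w (Suc (Suc i)) < inv w (Suc i)" "inv w (Suc i) < inv w i" using i j ji by auto
      have e: "adj i (Suc (Suc i)) = Suc (Suc i)" "adj (Suc i) i = i"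
        by (simp_all add: Transposition.transpose_def)
      have a1: "reduced_word m (adj j \<circ> (adj i \<circ> w)) (i # ks)"
        using pp(1) i(1)
        by (rule reduced_word_ConsI) (use ij ks in \<open>simp_all add: inv_adj_comp[OF p(1)] inv_adj_comp[OF w] v_def ji e\<close>)
      have a: "reduced_word m (adj i \<circ> w) (j # i # ks)"
        using p(1) j(1)
        by (rule reduced_word_ConsI) (use ij a1 in \<open>simp_all add: inv_adj_comp[OF w] ji e\<close>)
      have b1: "reduced_word m (adj i \<circ> (adj j \<circ> w)) (j # ks)"
        using pp(2) j(1)
        by (rule reduced_word_ConsI) (use ij ks in \<open>simp_all add: inv_adj_comp[OF p(2)[unfolded ji]] inv_adj_comp[OF w] v' ji e\<close>)
      have b: "reduced_word m (adj j \<circ> w) (i # j # ks)"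
        using p(2) i(1)
        by (rule reduced_word_ConsI) (use ij b1 in \<open>simp_all add: inv_adj_comp[OF w] ji e\<close>)
      have ks_sub: "set ks \<subseteq> {1..<m}" using ks by (simp add: reduced_word_def)
      have "R (i # is') (i # j # i # ks)"
        using i(1) _ IHi[OF a] by (rule cong) (use a wpi in \<open>simp add: reduced_word_def\<close>)
      moreover have "R (i # j # i # ks) (j # i # j # ks)"
        unfolding ji using i(1) j(1)[unfolded ji] ks_sub by (rule braid)
      moreover have "R (j # js') (j # i # j # ks)"
        using j(1) _ IHj[OF b] by (rule cong) (use b wpj in \<open>simp add: reduced_word_def\<close>)
      ultimately show ?thesis using trans sym by blast
    qed
    consider "i = j" | "i < j" | "j < i" by linarith
    then show ?thesis
    proof cases
      case 1
      then show ?thesis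
        unfolding Cons js using cong[OF isi(1)] IHi jsj(2) wp by auto
    next
      case 2
      show ?thesis
        unfolding Cons js by (rule main[OF isi(1,3) jsj(1,3) wp IHi IHj 2])
    next
      case 3
      show ?thesis
        unfolding Cons js by (rule sym[OF main[OF jsj(1,3) isi(1,3) wp(2,1) IHj IHi 3]])
    qed
  qed
qed

section \<open>Minimal presentations of a link pattern\<close>

text \<open>The drop is strict by \<open>inversions_comp_transpose\<close>; that it is only one
  follows by appending k to a shortest word of w \<circ> adj k.\<close>

lemma card_inversions_comp_adj_descent:
  assumes w: "w permutes {1..m}" and k: "k \<in> {1..<m}" and desc: "w (Suc k) < w k"
  shows "card (inversions m w) = Suc (card (inversions m (w \<circ> adj k)))"
proof -
  have "card (inversions m (w \<circ> adj k)) < card (inversions m w)"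
    using k desc by (intro inversions_comp_transpose) auto
  moreover obtain "is" where is_word: "set is \<subseteq> {1..<m}" "word_perm is = w \<circ> adj k"
      "length is = card (inversions m (w \<circ> adj k))"
    using exists_word_length_inversions[OF comp_adj_permutes[OF w k]] by blast
  moreover have "word_perm (is @ [k]) = w"
    unfolding word_perm_append is_word(2) word_perm_Cons word_perm_Nil comp_id by (rule adj_adj)
  then have "card (inversions m w) \<le> length (is @ [k])"
    using card_inversions_le_length[of "is @ [k]" m] is_word k by simp
  ultimately show ?thesis by simp
qed

lemma presents_iff:
  "presents m r P \<sigma> w \<longleftrightarrow> \<sigma> permutes {1..r} \<and> w permutes {1..m} \<and>
     (\<forall>k\<in>{1..r}. P (\<sigma> k) = (w (m - r + k), w k))"
proof -
  have "pattern_eq r P (label_act \<sigma> (vertex_act w (P_min m r))) \<longleftrightarrow>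
      (\<forall>k\<in>{1..r}. P (\<sigma> k) = (w (m - r + k), w k))" if \<sigma>: "\<sigma> permutes {1..r}"
  proof -
    have "pattern_eq r P (label_act \<sigma> (vertex_act w (P_min m r))) \<longleftrightarrow>
        (\<forall>i\<in>{1..r}. P i = (w (m - r + inv \<sigma> i), w (inv \<sigma> i)))"
      by (simp add: pattern_eq_def label_act_def vertex_act_def P_min_def)
    also have "\<dots> \<longleftrightarrow> (\<forall>i\<in>\<sigma> ` {1..r}. P i = (w (m - r + inv \<sigma> i), w (inv \<sigma> i)))"
      unfolding permutes_image[OF \<sigma>] ..
    also have "\<dots> \<longleftrightarrow> (\<forall>k\<in>{1..r}. P (\<sigma> k) = (w (m - r + k), w k))"
      using permutes_inverses[OF \<sigma>] by simp
    finally show ?thesis .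
  qed
  then show ?thesis unfolding presents_def by blast
qed

abbreviation pair_swap :: "nat \<Rightarrow> nat \<Rightarrow> nat \<Rightarrow> nat \<Rightarrow> nat \<Rightarrow> nat" where
  "pair_swap m r a b \<equiv> Transposition.transpose a b \<circ> Transposition.transpose (m - r + a) (m - r + b)"

text \<open>Exchanging two targets together with their sources merely permutes the arrows, which the
  change of \<sigma> undoes.\<close>

lemma presents_pair_swap:
  assumes p: "presents m r P \<sigma> w" and ab: "a \<in> {1..r}" "b \<in> {1..r}" and r: "2 * r \<le> m"
  shows "presents m r P (\<sigma> \<circ> Transposition.transpose a b) (w \<circ> pair_swap m r a b)"
proof -
  let ?t = "Transposition.transpose a b"
  have t: "?t permutes {1..r}" by (rule permutes_swap_id[OF ab])
  have pt: "pair_swap m r a b permutes {1..m}"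
    using ab r by (intro permutes_compose permutes_swap_id) auto
  have "P ((\<sigma> \<circ> ?t) k) = ((w \<circ> pair_swap m r a b) (m - r + k), (w \<circ> pair_swap m r a b) k)"
    if k: "k \<in> {1..r}" for k
  proof -
    have "?t k \<in> {1..r}" using permutes_in_image[OF t] k by blast
    then have P: "P (\<sigma> (?t k)) = (w (m - r + ?t k), w (?t k))"
      using p unfolding presents_iff by blast
    have "pair_swap m r a b k = ?t k"
      using k ab r by (auto simp: Transposition.transpose_def)
    moreover have "pair_swap m r a b (m - r + k) = m - r + ?t k"
      using k ab r by (auto simp: Transposition.transpose_def)
    ultimately show ?thesis using P by simp
  qed
  then show ?thesis
    using p permutes_compose[OF t, of \<sigma>] permutes_compose[OF pt, of w] unfolding presents_iff by blast
qed

lemma min_presents_iff: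
  "min_presents m r P \<sigma> w \<longleftrightarrow> presents m r P \<sigma> w \<and>
     (\<forall>\<sigma>' w'. presents m r P \<sigma>' w' \<longrightarrow> card (inversions m w) \<le> card (inversions m w'))"
proof -
  have "coxeter_length m w = card (inversions m w)" if "presents m r P \<sigma> w" for \<sigma> w
    using that coxeter_length_eq by (simp add: presents_iff)
  then show ?thesis unfolding min_presents_def by metis
qed

text \<open>Otherwise each of the two transpositions in \<open>pair_swap\<close> would lower the
  length, contradicting minimality.\<close>

lemma min_presents_not_both_inverted:
  assumes "min_presents m r P \<sigma> w" and ab: "1 \<le> a" "a < b" "b \<le> r" and r: "2 * r \<le> m"
  shows "\<not> (w b < w a \<and> w (m - r + b) < w (m - r + a))"
proof
  assume d: "w b < w a \<and> w (m - r + b) < w (m - r + a)"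
  let ?t = "Transposition.transpose a b"
  have "card (inversions m ((w \<circ> ?t) \<circ> Transposition.transpose (m - r + a) (m - r + b))) <
      card (inversions m (w \<circ> ?t))"
    using ab r d by (intro inversions_comp_transpose) (auto simp: Transposition.transpose_def)
  also have "\<dots> < card (inversions m w)"
    using ab r d by (intro inversions_comp_transpose) auto
  finally have "card (inversions m (w \<circ> pair_swap m r a b)) < card (inversions m w)"
    by (simp only: o_assoc)
  moreover have "presents m r P (\<sigma> \<circ> ?t) (w \<circ> pair_swap m r a b)"
    using assms by (intro presents_pair_swap) (auto simp: min_presents_def)
  ultimately show False using assms(1) unfolding min_presents_iff by (meson not_le)
qed

text \<open>The pattern does not see the free vertices, so an inversion among them could be removed
  without changing it.\<close>

lemma min_presents_middle_increasing:
  assumes "min_presents m r P \<sigma> w" and ab: "r < a" "a < b" "b \<le> m - r"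
  shows "w a < w b"
proof (rule ccontr)
  assume n: "\<not> w a < w b"
  let ?t = "Transposition.transpose a b"
  have p: "presents m r P \<sigma> w" using assms(1) by (simp add: min_presents_def)
  then have w: "w permutes {1..m}" by (simp add: presents_iff)
  have "w a \<noteq> w b" using permutes_inj[OF w] ab by (auto dest: injD)
  then have "card (inversions m (w \<circ> ?t)) < card (inversions m w)"
    using n ab by (intro inversions_comp_transpose) auto
  moreover have "presents m r P \<sigma> (w \<circ> ?t)"
  proof -
    have "?t permutes {1..m}" using ab by (intro permutes_swap_id) auto
    moreover have "?t k = k" "?t (m - r + k) = m - r + k" if "k \<in> {1..r}" for k
      using that ab by (auto simp: Transposition.transpose_def)
    ultimately show ?thesis
      using p permutes_compose[of ?t "{1..m}" w] unfolding presents_iff by simp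
  qed
  ultimately show False using assms(1) unfolding min_presents_iff by (meson not_le)
qed

text \<open>Two presentations differ by \<open>t\<close>, which permutes targets and sources by the
  same \<pi> and preserves the three blocks. A descent of t yields a descent k of \<pi>. By
  minimality of both presentations w' inverts exactly one of the pairs (k, k + 1) and (K, K + 1), so
  exchanging both pairs is a move that keeps the length and lowers the inversions of t. In
  \<open>trans\<close> the middle term is a permutation, since T will quantify over its reduced
  words and one must exist.\<close>

theorem minimal_presentations_connected:
  fixes T :: "(nat \<Rightarrow> nat) \<Rightarrow> (nat \<Rightarrow> nat) \<Rightarrow> (nat \<Rightarrow> nat) \<Rightarrow> (nat \<Rightarrow> nat) \<Rightarrow> bool"
  assumes r: "2 * r \<le> m"
    and reflexive: "\<And>\<sigma> w. \<sigma> permutes {1..r} \<Longrightarrow> w permutes {1..m} \<Longrightarrow> T \<sigma> w \<sigma> w"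
    and sym: "\<And>\<sigma> w \<sigma>' w'. T \<sigma> w \<sigma>' w' \<Longrightarrow> T \<sigma>' w' \<sigma> w"
    and trans: "\<And>\<sigma> w \<sigma>' w' \<sigma>'' w''. w' permutes {1..m} \<Longrightarrow> T \<sigma> w \<sigma>' w' \<Longrightarrow> T \<sigma>' w' \<sigma>'' w'' \<Longrightarrow> T \<sigma> w \<sigma>'' w''"
    and step: "\<And>\<sigma> v k. \<sigma> permutes {1..r} \<Longrightarrow> v permutes {1..m} \<Longrightarrow> 1 \<le> k \<Longrightarrow> k < r \<Longrightarrow>
      card (inversions m (v \<circ> adj k)) = Suc (card (inversions m v)) \<Longrightarrow>
      card (inversions m (v \<circ> adj (m - r + k))) = Suc (card (inversions m v)) \<Longrightarrow>
      T \<sigma> (v \<circ> adj (m - r + k)) (\<sigma> \<circ> adj k) (v \<circ> adj k)"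
    and min: "min_presents m r P \<sigma> w" and min': "min_presents m r P \<sigma>' w'"
  shows "T \<sigma> w \<sigma>' w'"
  using min'
proof (induction "card (inversions m (inv w \<circ> w'))" arbitrary: \<sigma>' w' rule: less_induct)
  case less
  define t where "t = inv w \<circ> w'"
  have p: "presents m r P \<sigma> w" "presents m r P \<sigma>' w'"
    using min less.prems by (auto simp: min_presents_def)
  have w: "w permutes {1..m}" and w': "w' permutes {1..m}"
      and \<sigma>: "\<sigma> permutes {1..r}" and \<sigma>': "\<sigma>' permutes {1..r}"
    using p by (auto simp: presents_iff)
  define \<pi> where "\<pi> = inv \<sigma> \<circ> \<sigma>'"
  have \<pi>: "\<pi> permutes {1..r}" unfolding \<pi>_def by (rule permutes_compose[OF \<sigma>' permutes_inv[OF \<sigma>]])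
  have t: "t permutes {1..m}" unfolding t_def by (rule permutes_compose[OF w' permutes_inv[OF w]])
  have wt: "w' k = w (t k)" for k unfolding t_def using permutes_inverses[OF w] by simp
  have \<pi>_rng: "\<pi> k \<in> {1..r}" if "k \<in> {1..r}" for k using permutes_in_image[OF \<pi>] that by blast
  have t\<pi>: "t k = \<pi> k" "t (m - r + k) = m - r + \<pi> k" if k: "k \<in> {1..r}" for k
  proof -
    have "P (\<sigma>' k) = (w' (m - r + k), w' k)" using p(2) k by (auto simp: presents_iff)
    moreover have "P (\<sigma> (\<pi> k)) = (w (m - r + \<pi> k), w (\<pi> k))" using p(1) \<pi>_rng[OF k] by (auto simp: presents_iff)
    moreover have "\<sigma> (\<pi> k) = \<sigma>' k" unfolding \<pi>_def using permutes_inverses[OF \<sigma>] by simp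
    ultimately have "w (t (m - r + k)) = w (m - r + \<pi> k)" "w (t k) = w (\<pi> k)" by (auto simp: wt)
    then show "t k = \<pi> k" "t (m - r + k) = m - r + \<pi> k" using permutes_inj[OF w] by (auto dest: injD)
  qed
  have t_inj: "t x = t y \<longleftrightarrow> x = y" for x y using permutes_inj[OF t] by (simp add: inj_eq)
  have low: "t k \<in> {1..r} \<longleftrightarrow> k \<in> {1..r}" for k
  proof
    assume a: "t k \<in> {1..r}"
    then have "t k \<in> \<pi> ` {1..r}" using permutes_image[OF \<pi>] by simp
    then obtain j where j: "j \<in> {1..r}" "t k = \<pi> j" by blast
    then have "t k = t j" using t\<pi>(1)[OF j(1)] by simp
    then have "k = j" using t_inj by blast
    then show "k \<in> {1..r}" using j(1) by simp
  qed (use t\<pi>(1) \<pi>_rng in simp)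
  have high: "m - r < t k \<longleftrightarrow> m - r < k" if k: "k \<in> {1..m}" for k
  proof -
    have tk: "t k \<in> {1..m}" using permutes_in_image[OF t] k by blast
    show ?thesis
    proof
      assume a: "m - r < t k"
      then have "t k - (m - r) \<in> {1..r}" using tk by auto
      then have "t k - (m - r) \<in> \<pi> ` {1..r}" using permutes_image[OF \<pi>] by simp
      then obtain j where j: "j \<in> {1..r}" "t k - (m - r) = \<pi> j" by blast
      then have "t k = t (m - r + j)" using t\<pi>(2)[OF j(1)] a by simp
      then have "k = m - r + j" using t_inj by blast
      then show "m - r < k" using j(1) by auto
    next
      assume a: "m - r < k"
      then have j: "k - (m - r) \<in> {1..r}" using k by auto
      then show "m - r < t k" using t\<pi>(2)[OF j] \<pi>_rng[OF j] a by simp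
    qed
  qed
  show ?case
  proof (cases "\<exists>i\<in>{1..<m}. t (Suc i) < t i")
    case False
    have "t i < t (Suc i)" if "i \<in> {1..<m}" for i
    proof -
      have "t i \<noteq> t (Suc i)" using t_inj[of i "Suc i"] by simp
      then show ?thesis using False that by (meson linorder_neqE_nat)
    qed
    then have "t = id" by (rule increasing_permutes_eq_id[OF t])
    then have "w' = w" using wt by auto
    moreover have "\<sigma>' k = \<sigma> k" for k
    proof (cases "k \<in> {1..r}")
      case True
      then have "\<pi> k = k" using t\<pi>(1)[OF True] \<open>t = id\<close> by simp
      then show ?thesis unfolding \<pi>_def using permutes_inverses[OF \<sigma>] by (metis comp_apply)
    next
      case False
      then show ?thesis using permutes_not_in[OF \<sigma>] permutes_not_in[OF \<sigma>'] by metis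
    qed
    ultimately show ?thesis using reflexive[OF \<sigma> w] by (metis ext)
  next
    case True
    then obtain i where i: "i \<in> {1..<m}" "t (Suc i) < t i" by blast
    \<comment> \<open>On the free vertices w and w' are both increasing, so t has no descent
      there.\<close>
    have "\<not> (r < i \<and> Suc i \<le> m - r)"
    proof
      assume mid: "r < i \<and> Suc i \<le> m - r"
      then have "r < t (Suc i)" "t i \<le> m - r"
        using low[of "Suc i"] high[of i] i permutes_in_image[OF t, of "Suc i"] by auto
      then have "w (t (Suc i)) < w (t i)"
        using i(2) by (intro min_presents_middle_increasing[OF min]) auto
      moreover have "w' i < w' (Suc i)"
        using mid by (intro min_presents_middle_increasing[OF less.prems]) auto
      ultimately show False by (simp add: wt)
    qed
    moreover have "i \<noteq> r"
    proof
      assume "i = r"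
      then have "t i \<le> r" "\<not> t (Suc i) \<le> r"
        using low[of i] low[of "Suc i"] i permutes_in_image[OF t, of "Suc i"] by auto
      then show False using i(2) by simp
    qed
    moreover have "i \<noteq> m - r"
      using high[of i] high[of "Suc i"] i by auto
    ultimately have "i < r \<or> m - r < i" using i by linarith
    then obtain k where k: "1 \<le> k" "k < r" "\<pi> (Suc k) < \<pi> k"
    proof
      assume "i < r"
      then show ?thesis using that[of i] i t\<pi>(1)[of i] t\<pi>(1)[of "Suc i"] by auto
    next
      assume hi: "m - r < i"
      define k where "k = i - (m - r)"
      have ik: "i = m - r + k" "Suc i = m - r + Suc k" "1 \<le> k" "k < r" using hi i by (auto simp: k_def)
      then show ?thesis using that[of k] i(2) t\<pi>(2)[of k] t\<pi>(2)[of "Suc k"] by simp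
    qed
    define K where "K = m - r + k"
    have kr: "k \<in> {1..r}" "Suc k \<in> {1..r}" using k by auto
    have kK: "k \<in> {1..<m}" "K \<in> {1..<m}" "Suc k < K \<or> Suc k = K" "Suc k \<noteq> K" using k r by (auto simp: K_def)
    then have kK': "Suc k < K" by simp
    have SK: "Suc K = m - r + Suc k" by (simp add: K_def)
    have wk: "w' k = w (\<pi> k)" "w' (Suc k) = w (\<pi> (Suc k))"
        "w' K = w (m - r + \<pi> k)" "w' (Suc K) = w (m - r + \<pi> (Suc k))"
      unfolding wt SK unfolding K_def t\<pi>(1)[OF kr(1)] t\<pi>(1)[OF kr(2)] t\<pi>(2)[OF kr(1)] t\<pi>(2)[OF kr(2)]
      by (rule refl)+
    have not_both: "\<not> (w' (Suc k) < w' k \<and> w' (Suc K) < w' K)"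
      using min_presents_not_both_inverted[OF less.prems, of k "Suc k"] k r by (simp add: K_def)
    \<comment> \<open>As w' is w after t and \<pi> reverses k and k + 1, a w' that inverts neither
      pair would mean that w inverts two such pairs at once.\<close>
    have not_neither: "\<not> (w' k < w' (Suc k) \<and> w' K < w' (Suc K))"
      unfolding wk using min_presents_not_both_inverted[OF min, of "\<pi> (Suc k)" "\<pi> k"] k r
        \<pi>_rng[OF kr(1)] \<pi>_rng[OF kr(2)] by simp
    have neq: "w' k \<noteq> w' (Suc k)" "w' K \<noteq> w' (Suc K)"
      using permutes_inj[OF w'] by (auto simp: inj_eq)
    define w1 where "w1 = w' \<circ> (adj k \<circ> adj K)"
    define \<sigma>1 where "\<sigma>1 = \<sigma>' \<circ> adj k"
    have comm: "adj k \<circ> adj K = adj K \<circ> adj k"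
      using adj_commute[OF kK', of id] by simp
    have p1: "presents m r P \<sigma>1 w1"
      using presents_pair_swap[OF p(2) kr r] by (simp add: \<sigma>1_def w1_def K_def)
    have adjk: "adj k permutes {1..r}" using k by (intro permutes_swap_id) auto
    have \<sigma>1: "\<sigma>1 permutes {1..r}" unfolding \<sigma>1_def by (rule permutes_compose[OF adjk \<sigma>'])
    have w1: "w1 permutes {1..m}" using p1 by (simp add: presents_iff)
    have fix_K: "adj k K = K" "adj k (Suc K) = Suc K" "adj K k = k" "adj K (Suc k) = Suc k"
      using kK' by (auto simp: Transposition.transpose_def)
    have "T \<sigma>1 w1 \<sigma>' w' \<and> card (inversions m w1) = card (inversions m w')"
    proof (cases "w' k < w' (Suc k)")
      case True
      then have dK: "w' (Suc K) < w' K" using not_neither neq by simp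
      \<comment> \<open>Undoing the single inverted pair gives \<open>v\<close>; both w' and
        \<open>w1\<close> are one longer than it, as \<open>step\<close> requires.\<close>
      define v where "v = w' \<circ> adj K"
      have v: "v permutes {1..m}" unfolding v_def by (rule comp_adj_permutes[OF w' kK(2)])
      have w1v: "w1 = v \<circ> adj k" "w' = v \<circ> adj K" by (simp_all add: w1_def v_def comm o_assoc)
      have c1: "card (inversions m (v \<circ> adj K)) = Suc (card (inversions m v))"
        using card_inversions_comp_adj_descent[OF w' kK(2) dK] by (simp add: v_def)
      have c2: "card (inversions m (v \<circ> adj k)) = Suc (card (inversions m v))"
        using card_inversions_comp_adj_descent[OF comp_adj_permutes[OF v kK(1)] kK(1)] True
        by (simp add: v_def fix_K)
      have "T \<sigma>' (v \<circ> adj K) (\<sigma>' \<circ> adj k) (v \<circ> adj k)"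
        using step[OF \<sigma>' v k(1,2) c2] c1 by (simp add: K_def)
      then show ?thesis using c1 c2 sym by (simp add: w1v \<sigma>1_def)
    next
      case False
      then have dk: "w' (Suc k) < w' k" "w' K < w' (Suc K)" using not_both neq by auto
      define v where "v = w' \<circ> adj k"
      have v: "v permutes {1..m}" unfolding v_def by (rule comp_adj_permutes[OF w' kK(1)])
      have w1v: "w1 = v \<circ> adj K" "w' = v \<circ> adj k" by (simp_all add: w1_def v_def o_assoc)
      have c1: "card (inversions m (v \<circ> adj k)) = Suc (card (inversions m v))"
        using card_inversions_comp_adj_descent[OF w' kK(1) dk(1)] by (simp add: v_def)
      have c2: "card (inversions m (v \<circ> adj K)) = Suc (card (inversions m v))"
        using card_inversions_comp_adj_descent[OF comp_adj_permutes[OF v kK(2)] kK(2)] dk(2)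
        by (simp add: v_def fix_K)
      have "T \<sigma>1 (v \<circ> adj K) (\<sigma>1 \<circ> adj k) (v \<circ> adj k)"
        using step[OF \<sigma>1 v k(1,2) c1] c2 by (simp add: K_def)
      then show ?thesis using c1 c2 by (simp add: w1v \<sigma>1_def)
    qed
    note T1 = this
    have min1: "min_presents m r P \<sigma>1 w1"
      using p1 T1 less.prems unfolding min_presents_iff by simp
    have "card (inversions m (inv w \<circ> w1)) < card (inversions m (inv w \<circ> w'))"
    proof -
      have eq: "inv w \<circ> w1 = (t \<circ> adj k) \<circ> adj K" by (simp add: w1_def t_def o_assoc)
      have "card (inversions m ((t \<circ> adj k) \<circ> adj K)) < card (inversions m (t \<circ> adj k))"
        using kK(2) k t\<pi>(2)[OF kr(1)] t\<pi>(2)[OF kr(2)]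
        by (intro inversions_comp_transpose) (auto simp: fix_K SK[symmetric] K_def[symmetric])
      also have "card (inversions m (t \<circ> adj k)) < card (inversions m t)"
        using kK(1) k t\<pi>(1)[OF kr(1)] t\<pi>(1)[OF kr(2)]
        by (intro inversions_comp_transpose) auto
      finally show ?thesis unfolding eq t_def .
    qed
    then have "T \<sigma> w \<sigma>1 w1" using less.hyps min1 by blast
    then show ?thesis using T1 trans[OF w1] by blast
  qed
qed

section \<open>The braid relations and the exchange relation\<close>

lemma swap_x_other: "k \<noteq> i \<Longrightarrow> k \<noteq> Suc i \<Longrightarrow> swap_x i p (X k) = p (X k)"
  by (simp add: swap_x_X Transposition.transpose_def)

lemma swap_x_commute: "Suc i < j \<Longrightarrow> swap_x i (swap_x j p) = swap_x j (swap_x i p)"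
  by (auto simp: swap_x_def fun_eq_iff Transposition.transpose_def)

lemma swap_x_braid: "swap_x i (swap_x (Suc i) (swap_x i p)) = swap_x (Suc i) (swap_x i (swap_x (Suc i) p))"
  by (auto simp: swap_x_def fun_eq_iff Transposition.transpose_def)

lemma lf_mono_swap_x:
  assumes "lf_on ({H} \<union> Mu ` {1..r}) l"
  shows "lf_mono m r l (swap_x i p) = lf_mono m r l p"
  unfolding lf_mono_def
proof (rule prod.cong[OF refl])
  fix v
  have "l (X j) = 0" for j using assms by (auto simp: lf_on_def)
  then show "swap_x i p v powi l v = p v powi l v"
    by (cases v) simp_all
qed

lemma step_param_cong:
  assumes "inv w i = inv w' i'" "inv w (Suc i) = inv w' (Suc i')"
  shows "step_param m r w i = step_param m r w' i'"
  using assms by (simp add: step_param_def)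

lemma step_param_on:
  assumes "w permutes {1..m}" "i \<in> {1..<m}" "2 * r \<le> m"
  shows "lf_on ({H} \<union> Mu ` {1..r}) (step_param m r w i)"
  using step_param_nontrivial[OF assms] by (simp add: nontrivial_character_def)

lemma canon_cong:
  assumes "i \<in> {1..<m}" "word_perm is = word_perm js" "mero_eq m r (canon \<tau> m r is) (canon \<tau> m r js)"
  shows "mero_eq m r (canon \<tau> m r (i # is)) (canon \<tau> m r (i # js))"
  using C_op_cong[OF assms(3,1)] assms(2) by simp

text \<open>The parameters of one letter do not see the other, whose transposition fixes the two
  positions concerned. The equality holds at every point.\<close>

lemma canon_commute:
  assumes i: "i \<in> {1..<m}" and j: "j \<in> {1..<m}" and ij: "Suc i < j"
    and ks: "set ks \<subseteq> {1..<m}" and r: "2 * r \<le> m"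
  shows "canon \<tau> m r (i # j # ks) = canon \<tau> m r (j # i # ks)"
proof
  fix p
  define w where "w = word_perm ks"
  have w: "w permutes {1..m}" unfolding w_def by (rule word_perm_permutes[OF ks])
  have params: "step_param m r (adj j \<circ> w) i = step_param m r w i"
      "step_param m r (adj i \<circ> w) j = step_param m r w j"
    using ij by (auto intro!: step_param_cong simp: inv_adj_comp[OF w] transpose_apply_other)
  note sw = swap_x_other[of i j] swap_x_other[of "Suc i" j] swap_x_other[of j i] swap_x_other[of "Suc j" i]
    lf_mono_swap_x[OF step_param_on[OF w _ r]] swap_x_commute[OF ij]
  show "canon \<tau> m r (i # j # ks) p = canon \<tau> m r (j # i # ks) p"
    using i j ij by (simp add: w_def[symmetric] params C_op_def sw algebra_simps)
qed

text \<open>The parameters are differences of three forms, so the middle one is the sum of the outer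
  ones. The claim compares the coefficients of the six functions f(s p), s in the group generated by
  s_i and s_(i+1).\<close>

lemma canon_braid:
  assumes im: "Im \<tau> > 0" and i: "i \<in> {1..<m}" and j: "Suc i \<in> {1..<m}"
    and ks: "set ks \<subseteq> {1..<m}" and r: "2 * r \<le> m"
  shows "mero_eq m r (canon \<tau> m r (i # Suc i # i # ks)) (canon \<tau> m r (Suc i # i # Suc i # ks))"
proof -
  define j where "j = Suc i"
  note j' = j[folded j_def]
  define w where "w = word_perm ks"
  have w: "w permutes {1..m}" unfolding w_def by (rule word_perm_permutes[OF ks])
  define f where "f = canon \<tau> m r ks"
  define \<alpha> where "\<alpha> = step_param m r w j"
  define \<beta> where "\<beta> = step_param m r w i"
  define \<gamma> where "\<gamma> = step_param m r (adj i \<circ> w) j"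
  have e: "adj i (Suc (Suc i)) = Suc (Suc i)" "adj (Suc i) i = i"
    by (simp_all add: Transposition.transpose_def)
  note perms = adj_comp_permutes[OF w i] adj_comp_permutes[OF w j']
  have lhs: "canon \<tau> m r (i # j # i # ks) = C_op \<tau> m r i \<alpha> (C_op \<tau> m r j \<gamma> (C_op \<tau> m r i \<beta> f))"
    unfolding canon.simps word_perm_Cons w_def[symmetric] f_def[symmetric]
    by (intro arg_cong2[where f = "C_op \<tau> m r i"] arg_cong2[where f = "C_op \<tau> m r j"])
       (auto simp: \<alpha>_def \<beta>_def \<gamma>_def j_def e inv_adj_comp[OF w]
          inv_adj_comp[OF perms(1)] intro!: step_param_cong)
  have rhs: "canon \<tau> m r (j # i # j # ks) = C_op \<tau> m r j \<beta> (C_op \<tau> m r i \<gamma> (C_op \<tau> m r j \<alpha> f))"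
    unfolding canon.simps word_perm_Cons w_def[symmetric] f_def[symmetric]
    by (intro arg_cong2[where f = "C_op \<tau> m r i"] arg_cong2[where f = "C_op \<tau> m r j"])
       (auto simp: \<alpha>_def \<beta>_def \<gamma>_def j_def e inv_adj_comp[OF w]
          inv_adj_comp[OF perms(2)[unfolded j_def]] intro!: step_param_cong)
  have \<gamma>: "\<gamma> = (\<lambda>v. \<alpha> v + \<beta> v)"
    by (simp add: \<gamma>_def \<alpha>_def \<beta>_def step_param_def inv_adj_comp[OF w] j_def e)
  have nt: "nontrivial_character r \<alpha>" "nontrivial_character r \<beta>" "nontrivial_character r \<gamma>"
    unfolding \<alpha>_def \<beta>_def \<gamma>_def by (intro step_param_nontrivial w perms i j' r)+
  then have on: "lf_on ({H} \<union> Mu ` {1..r}) \<alpha>" "lf_on ({H} \<union> Mu ` {1..r}) \<beta>" "lf_on ({H} \<union> Mu ` {1..r}) \<gamma>"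
    by (auto simp: nontrivial_character_def)
  let ?l = "\<lambda>a b v. lf_var (X a) v - lf_var (X b) v"
  \<comment> \<open>The forms whose theta values occur in denominators of the coefficients.\<close>
  define L where "L = {?l j i, ?l (Suc j) j, ?l (Suc j) i, lf_var H, \<alpha>, \<beta>, \<gamma>}"
  have dense: "dense_open m r (generic \<tau> m r L)"
  proof (rule dense_open_generic[OF im])
    fix l assume "l \<in> L"
    moreover have "\<exists>v\<in>vars m r. l v \<noteq> 0" if "nontrivial_character r l" for l
      using that unfolding nontrivial_character_def lf_on_def vars_def by blast
    moreover have "\<exists>v\<in>vars m r. ?l a b v \<noteq> 0" if "a \<noteq> b" "a \<in> {1..m}" for a b
      using that by (intro bexI[of _ "X a"]) auto
    moreover have "\<exists>v\<in>vars m r. lf_var H v \<noteq> 0" by (intro bexI[of _ H]) auto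
    ultimately show "\<exists>v\<in>vars m r. l v \<noteq> 0"
      using nt i j' by (auto simp: L_def j_def)
  qed (simp add: L_def)
  have "C_op \<tau> m r i \<alpha> (C_op \<tau> m r j \<gamma> (C_op \<tau> m r i \<beta> f)) p =
      C_op \<tau> m r j \<beta> (C_op \<tau> m r i \<gamma> (C_op \<tau> m r j \<alpha> f)) p" if p: "p \<in> generic \<tau> m r L" for p
  proof -
    have "p \<in> torus m r" using p by (simp add: generic_def)
    then obtain z where z: "is_log m r p z" using exists_log by blast
    define x where "x = z (X j) - z (X i)"
    define y where "y = z (X (Suc j)) - z (X j)"
    define a where "a = lf_eval m r \<alpha> z"
    define b where "b = lf_eval m r \<beta> z"
    define h where "h = z H"
    have rng: "X i \<in> vars m r" "X j \<in> vars m r" "X (Suc j) \<in> vars m r" using i j' by auto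
    have ev: "lf_eval m r (?l j i) z = x" "lf_eval m r (?l (Suc j) j) z = y"
        "lf_eval m r (?l (Suc j) i) z = x + y" "lf_eval m r (lf_var H) z = h" "lf_eval m r \<gamma> z = a + b"
      using rng by (simp_all add: lf_eval_diff lf_eval_add x_def y_def h_def \<gamma> a_def b_def del: X_vars)
    have nz: "theta \<tau> x \<noteq> 0" "theta \<tau> y \<noteq> 0" "theta \<tau> (x + y) \<noteq> 0" "theta \<tau> h \<noteq> 0"
        "theta \<tau> a \<noteq> 0" "theta \<tau> b \<noteq> 0" "theta \<tau> (a + b) \<noteq> 0"
      using generic_log[OF im p z, of "?l j i"] generic_log[OF im p z, of "?l (Suc j) j"]
        generic_log[OF im p z, of "?l (Suc j) i"] generic_log[OF im p z, of "lf_var H"]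
        generic_log[OF im p z, of \<alpha>] generic_log[OF im p z, of \<beta>]
        generic_log[OF im p z, of \<gamma>]
      unfolding ev a_def[symmetric] b_def[symmetric] by (simp_all add: L_def)
    have sw: "swap_x i u (X (Suc j)) = u (X (Suc j))" "swap_x j u (X i) = u (X i)"
        "swap_x i u (X i) = u (X j)" "swap_x i u (X j) = u (X i)"
        "swap_x j u (X j) = u (X (Suc j))" "swap_x j u (X (Suc j)) = u (X j)" for u
      by (simp_all add: swap_x_other j_def)
    have lf: "lf_eval m r \<alpha> (swap_x k u) = lf_eval m r \<alpha> u" "lf_eval m r \<beta> (swap_x k u) = lf_eval m r \<beta> u"
        "lf_eval m r \<gamma> (swap_x k u) = lf_eval m r \<gamma> u" for k u
      using on by (simp_all add: lf_eval_swap_x)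
    note z1 = swap_x_log[OF z i] swap_x_log[OF z j']
    note z2 = swap_x_log[OF z1(1) j'] swap_x_log[OF z1(2) i]
    note Ci = C_op_log[OF _ i, folded j_def] and Cj = C_op_log[OF _ j']
    have d: "z (X j) - z (X i) = x" "z (X i) - z (X j) = - x" "z (X (Suc j)) - z (X j) = y"
        "z (X j) - z (X (Suc j)) = - y" "z (X (Suc j)) - z (X i) = x + y" "z (X i) - z (X (Suc j)) = - (x + y)"
      by (simp_all add: x_def y_def)
    let ?F = "F_ell \<tau>"
    have L1: "C_op \<tau> m r i \<alpha> (C_op \<tau> m r j \<gamma> (C_op \<tau> m r i \<beta> f)) p =
        ?F x a * (?F y (a + b) * (?F x b * f p + ?F (- x) h * f (swap_x i p)) +
                  ?F (- y) h * (?F (x + y) b * f (swap_x j p) + ?F (- (x + y)) h * f (swap_x i (swap_x j p)))) +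
        ?F (- x) h * (?F (x + y) (a + b) * (?F (- x) b * f (swap_x i p) + ?F x h * f p) +
                  ?F (- (x + y)) h * (?F y b * f (swap_x j (swap_x i p)) + ?F (- y) h * f (swap_x i (swap_x j (swap_x i p)))))"
      unfolding Ci[OF z] Cj[OF z] Ci[OF z1(1)] Ci[OF z1(2)] Cj[OF z1(1)] Cj[OF z1(2)]
        Ci[OF z2(1)] Ci[OF z2(2)] Cj[OF z2(1)] Cj[OF z2(2)]
      by (simp only: sw lf d ev a_def[symmetric] b_def[symmetric] h_def[symmetric]
          swap_x_simps(3) swap_x_twice)
    have R1: "C_op \<tau> m r j \<beta> (C_op \<tau> m r i \<gamma> (C_op \<tau> m r j \<alpha> f)) p =
        ?F y b * (?F x (a + b) * (?F y a * f p + ?F (- y) h * f (swap_x j p)) +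
                  ?F (- x) h * (?F (x + y) a * f (swap_x i p) + ?F (- (x + y)) h * f (swap_x j (swap_x i p)))) +
        ?F (- y) h * (?F (x + y) (a + b) * (?F (- y) a * f (swap_x j p) + ?F y h * f p) +
                  ?F (- (x + y)) h * (?F x a * f (swap_x i (swap_x j p)) + ?F (- x) h * f (swap_x j (swap_x i (swap_x j p)))))"
      unfolding Ci[OF z] Cj[OF z] Ci[OF z1(1)] Ci[OF z1(2)] Cj[OF z1(1)] Cj[OF z1(2)]
        Ci[OF z2(1)] Ci[OF z2(2)] Cj[OF z2(1)] Cj[OF z2(2)]
      by (simp only: sw lf d ev a_def[symmetric] b_def[symmetric] h_def[symmetric]
          swap_x_simps(3) swap_x_twice)
    have br: "f (swap_x i (swap_x j (swap_x i p))) = f (swap_x j (swap_x i (swap_x j p)))"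
      unfolding j_def swap_x_braid ..
    have id1: "?F x a * ?F x b * ?F y (a + b) + ?F (- x) h * ?F x h * ?F (x + y) (a + b) =
         ?F y a * ?F y b * ?F x (a + b) + ?F (- y) h * ?F y h * ?F (x + y) (a + b)"
      by (rule F_ell_braid[OF im nz])
    have id2: "?F x a * ?F y (a + b) + ?F (x + y) (a + b) * ?F (- x) b = ?F y b * ?F (x + y) a"
      by (rule F_ell_fay[OF im nz(1-3,5-7)])
    have id3: "?F y b * ?F x (a + b) + ?F (x + y) (a + b) * ?F (- y) a = ?F x a * ?F (x + y) b"
      using F_ell_fay[OF im nz(2,1) _ nz(6,5)] nz(3,7) by (simp add: add.commute)
    \<comment> \<open>The coefficient of \<open>f0\<close>, the value at p, is the first premise;
      those of \<open>f1\<close> and \<open>f2\<close>, at the simple reflections, are the other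
      two; those of \<open>f3\<close>, \<open>f4\<close>, \<open>f5\<close> agree
      identically.\<close>
    have comb: "A1 * (C2 * (A2 * f0 + nx * f1) + ny * (A3 * f2 + N * f4)) +
        nx * (C3 * (A4 * f1 + hx * f0) + N * (A5 * f3 + ny * f5)) =
        A5 * (C1 * (B2 * f0 + ny * f2) + nx * (B3 * f1 + N * f3)) +
        ny * (C3 * (B4 * f2 + hy * f0) + N * (A1 * f4 + nx * f5))"
      if "A1 * A2 * C2 + nx * hx * C3 = B2 * A5 * C1 + ny * hy * C3"
        "A1 * C2 + C3 * A4 = A5 * B3" "A5 * C1 + C3 * B4 = A1 * A3"
      for A1 A2 A3 A4 A5 B2 B3 B4 C1 C2 C3 nx ny hx hy N f0 f1 f2 f3 f4 f5 :: complex
      using that by algebra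
    show ?thesis unfolding L1 R1 br by (rule comb[OF id1 id2 id3])
  qed
  then show ?thesis
    using dense lhs rhs unfolding j_def by (intro mero_eqI[OF dense]) (simp add: lhs rhs)
qed

lemma canon_reduced_word:
  assumes im: "Im \<tau> > 0" and r: "2 * r \<le> m" and w: "w permutes {1..m}"
    and "reduced_word m w is" "reduced_word m w js"
  shows "mero_eq m r (canon \<tau> m r is) (canon \<tau> m r js)"
proof (rule word_property[where R = "\<lambda>is js. mero_eq m r (canon \<tau> m r is) (canon \<tau> m r js)", OF _ _ _ _ _ _ w assms(4,5)])
  show "mero_eq m r (canon \<tau> m r (i # j # ks)) (canon \<tau> m r (j # i # ks))"
    if "i \<in> {1..<m}" "j \<in> {1..<m}" "Suc i < j" "set ks \<subseteq> {1..<m}" for i j ks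
    unfolding canon_commute[OF that r] by (rule mero_eq_refl)
  show "mero_eq m r (canon \<tau> m r (i # Suc i # i # ks)) (canon \<tau> m r (Suc i # i # Suc i # ks))"
    if "i \<in> {1..<m}" "Suc i \<in> {1..<m}" "set ks \<subseteq> {1..<m}" for i ks
    by (rule canon_braid[OF im that r])
qed (auto intro: mero_eq_sym mero_eq_trans canon_cong simp del: canon.simps)

section \<open>Exchange of two neighbouring arrows\<close>

lemma mu_relabel_id: "mu_relabel id = id"
  by (rule ext) (simp add: mu_relabel_def split: var.splits)

lemma mu_relabel_swap_x: "swap_x i (p \<circ> mu_relabel \<sigma>) = swap_x i p \<circ> mu_relabel \<sigma>"
  by (rule ext) (auto simp: swap_x_def mu_relabel_def Transposition.transpose_def split: var.splits)

lemma mu_relabel_involution: "mu_relabel (adj k) (mu_relabel (adj k) v) = v"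
  by (cases v) auto

lemma mu_act_C_op:
  assumes k: "k \<in> {1..<r}" and \<nu>: "\<And>v. \<nu>' v = \<nu> (mu_relabel (adj k) v)"
  shows "mu_act (adj k) (C_op \<tau> m r i \<nu> f) = C_op \<tau> m r i \<nu>' (mu_act (adj k) f)"
proof
  fix p
  have "adj k permutes {1..r}" using k by (intro permutes_swap_id) auto
  then have bij: "bij_betw (mu_relabel (adj k)) (vars m r) (vars m r)"
    using mu_relabel_vars[of "adj k" r _ m] mu_relabel_involution
    by (intro bij_betwI[of _ _ _ "mu_relabel (adj k)"]) auto
  have "lf_mono m r \<nu> (p \<circ> mu_relabel (adj k)) = lf_mono m r \<nu>' p"
    unfolding lf_mono_def
    using prod.reindex_bij_betw[OF bij, of "\<lambda>v. p v powi \<nu>' v"] by (simp add: \<nu> mu_relabel_involution)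
  then show "mu_act (adj k) (C_op \<tau> m r i \<nu> f) p = C_op \<tau> m r i \<nu>' (mu_act (adj k) f) p"
    by (simp add: mu_act_eq C_op_def mu_relabel_swap_x)
qed

text \<open>As h has one coefficient at all targets and one at all sources, exchanging \<mu>_k and
  \<mu>_(k+1) amounts to exchanging the positions k, k + 1 and also K, K + 1, where K = m - r + k.
  One of the two exchanges is moved to the other side.\<close>

lemma pos_form_relabel:
  assumes k: "1 \<le> k" "k < r" and r: "2 * r \<le> m"
  shows "pos_form m r (adj k l) v = pos_form m r (adj (m - r + k) l) (mu_relabel (adj k) v)"
proof -
  define K where "K = m - r + k"
  have idx: "r < K" using k r by (simp add: K_def)
  have mu: "adj k j = l \<longleftrightarrow> j = adj k l" for j by (metis transpose_involutory)
  consider "l \<le> r" | "r < l" "l \<le> m - r" | "m - r < l" by linarith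
  then have "pos_form m r (adj k l) v = pos_form m r (adj K l) (mu_relabel (adj k) v)"
  proof cases
    case 1
    then have "adj K l = l" "adj k l \<le> r" using idx k by (auto simp: Transposition.transpose_def)
    then show ?thesis using 1 by (cases v) (simp_all add: pos_form_def mu)
  next
    case 2
    then have "adj K l = l" "adj k l = l" using k by (auto simp: K_def Transposition.transpose_def)
    then show ?thesis using 2 by (cases v) (simp_all add: pos_form_def)
  next
    case 3
    then have *: "adj k l = l" "m - r < adj K l" "r < l" "r < adj K l"
      using k r by (auto simp: K_def Transposition.transpose_def)
    have "adj k j + (m - r) = adj K l \<longleftrightarrow> j + (m - r) = l" for j
      using 3 by (auto simp: K_def Transposition.transpose_def split: if_splits)
    then show ?thesis using 3 * by (cases v) (simp_all add: pos_form_def)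
  qed
  then show ?thesis by (simp add: K_def)
qed

lemma step_param_relabel:
  assumes k: "1 \<le> k" "k < r" and r: "2 * r \<le> m" and w: "w permutes {1..m}"
  shows "step_param m r (w \<circ> adj k) i v =
    step_param m r (w \<circ> adj (m - r + k)) i (mu_relabel (adj k) v)"
proof -
  have "inv (w \<circ> adj l) = adj l \<circ> inv w" for l
    using o_inv_distrib[OF permutes_bij[OF w] bij_transpose, of l "Suc l"] by simp
  then show ?thesis
    by (simp add: step_param_def pos_form_relabel[OF k r])
qed

lemma prod_ell_factor_invariant:
  assumes bij: "bij_betw \<phi> A A" and eq: "\<And>a. a \<in> A \<Longrightarrow> ell_factor \<tau> m r q a = ell_factor \<tau> m r p (\<phi> a)"
  shows "(\<Prod>a\<in>A. ell_factor \<tau> m r q a) = (\<Prod>a\<in>A. ell_factor \<tau> m r p a)"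
  using prod.reindex_bij_betw[OF bij, of "ell_factor \<tau> m r p"] eq by simp

text \<open>Apart from the three factors in \<open>S\<close>, \<open>Ell_min\<close> is invariant under all the exchanges involved, so
  that the claim is the identity \<open>F_ell_exchange\<close>.\<close>

lemma Ell_min_exchange:
  assumes im: "Im \<tau> > 0" and k: "1 \<le> k" "k < r" and r: "2 * r \<le> m"
  shows "mero_eq m r (canon \<tau> m r [k]) (mu_act (adj k) (canon \<tau> m r [m - r + k]))"
proof -
  define K where "K = m - r + k"
  have kK: "k \<in> {1..<m}" "K \<in> {1..<m}" "Suc k < K \<or> Suc k = K" "r < K" "Suc K \<le> m"
    using k r by (auto simp: K_def)
  \<comment> \<open>Rows k, k + 1 and columns K, K + 1. The fourth corner (k + 1, K) lies before the
    diagonal and is not an index.\<close>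
  define S where "S = {(k, K), (k, Suc K), (Suc k, Suc K)}"
  define R where "R = ell_index m r - S"
  have S: "S \<subseteq> ell_index m r" using k r by (auto simp: S_def ell_index_def K_def)
  have fin: "finite (ell_index m r)" by (simp add: ell_index_def)
  have split: "Ell_min \<tau> m r p = (\<Prod>a\<in>R. ell_factor \<tau> m r p a) *
      (ell_factor \<tau> m r p (k, K) * ell_factor \<tau> m r p (k, Suc K) * ell_factor \<tau> m r p (Suc k, Suc K))" for p
  proof -
    have "Ell_min \<tau> m r p = (\<Prod>a\<in>R. ell_factor \<tau> m r p a) * (\<Prod>a\<in>S. ell_factor \<tau> m r p a)"
      unfolding Ell_min_eq[OF r] R_def by (rule prod.subset_diff[OF S fin])
    also have "(\<Prod>a\<in>S. ell_factor \<tau> m r p a) =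
        ell_factor \<tau> m r p (k, K) * ell_factor \<tau> m r p (k, Suc K) * ell_factor \<tau> m r p (Suc k, Suc K)"
      unfolding S_def by (simp add: mult.assoc)
    finally show ?thesis .
  qed
  \<comment> \<open>Outside \<open>S\<close> the rows k and k + 1 have entries only beyond column K
    + 1, and the columns K and K + 1 only in rows before k. None of these is diagonal, so exchanging
    rows or columns permutes factors that all carry h.\<close>
  have inR: "i \<in> {1..r}" "m - r + i \<le> j" "j \<le> m"
      "i = k \<Longrightarrow> Suc K < j" "i = Suc k \<Longrightarrow> Suc K < j" "j = K \<Longrightarrow> i < k" "j = Suc K \<Longrightarrow> i < k"
    if "(i, j) \<in> R" for i j
    using that by (auto simp: R_def S_def ell_index_def K_def)
  have R_intro: "(i, j) \<in> R" if "i \<in> {1..r}" "m - r + i \<le> j" "j \<le> m" "(i, j) \<notin> S" for i j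
    using that by (auto simp: R_def ell_index_def)
  have bij1: "bij_betw (\<lambda>(i, j). (adj k i, j)) R R"
  proof (rule bij_betwI[of _ _ _ "\<lambda>(i, j). (adj k i, j)"])
    show "(\<lambda>(i, j). (adj k i, j)) \<in> R \<rightarrow> R"
    proof safe
      fix i j assume ij: "(i, j) \<in> R"
      show "(adj k i, j) \<in> R"
        by (rule R_intro) (use inR[OF ij] k in \<open>auto simp: K_def S_def Transposition.transpose_def\<close>)
    qed
    then show "(\<lambda>(i, j). (adj k i, j)) \<in> R \<rightarrow> R" .
  qed auto
  have bij2: "bij_betw (\<lambda>(i, j). (i, adj K j)) R R"
  proof (rule bij_betwI[of _ _ _ "\<lambda>(i, j). (i, adj K j)"])
    show "(\<lambda>(i, j). (i, adj K j)) \<in> R \<rightarrow> R"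
    proof safe
      fix i j assume ij: "(i, j) \<in> R"
      show "(i, adj K j) \<in> R"
        by (rule R_intro) (use inR[OF ij] k kK in \<open>auto simp: K_def S_def Transposition.transpose_def\<close>)
    qed
    then show "(\<lambda>(i, j). (i, adj K j)) \<in> R \<rightarrow> R" .
  qed auto
  have G1: "(\<Prod>a\<in>R. ell_factor \<tau> m r (swap_x k p) a) = (\<Prod>a\<in>R. ell_factor \<tau> m r p a)" for p
  proof (rule prod_ell_factor_invariant[OF bij1])
    fix a assume a: "a \<in> R"
    obtain i j where ij: "a = (i, j)" by (cases a)
    note q = inR[OF a[unfolded ij]]
    have "j \<noteq> k" "j \<noteq> Suc k" using q k r by auto
    moreover have "(j = m - r + i) = (j = m - r + adj k i)" "j = m - r + i \<Longrightarrow> adj k i = i"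
      using q by (auto simp: Transposition.transpose_def K_def)
    ultimately show "ell_factor \<tau> m r (swap_x k p) a = ell_factor \<tau> m r p ((\<lambda>(i, j). (adj k i, j)) a)"
      by (cases "j = m - r + i") (simp_all add: ij ell_factor_def swap_x_other swap_x_X[of k p i])
  qed
  have G2: "(\<Prod>a\<in>R. ell_factor \<tau> m r (swap_x K p) a) = (\<Prod>a\<in>R. ell_factor \<tau> m r p a)" for p
  proof (rule prod_ell_factor_invariant[OF bij2])
    fix a assume a: "a \<in> R"
    obtain i j where ij: "a = (i, j)" by (cases a)
    note q = inR[OF a[unfolded ij]]
    have "i \<noteq> K" "i \<noteq> Suc K" using q kK by auto
    moreover have "(j = m - r + i) = (adj K j = m - r + i)"
      using q by (auto simp: Transposition.transpose_def K_def)
    ultimately show "ell_factor \<tau> m r (swap_x K p) a = ell_factor \<tau> m r p ((\<lambda>(i, j). (i, adj K j)) a)"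
      by (simp add: ij ell_factor_def swap_x_other swap_x_X[of K p j])
  qed
  have G3: "(\<Prod>a\<in>R. ell_factor \<tau> m r (p \<circ> mu_relabel (adj k)) a) = (\<Prod>a\<in>R. ell_factor \<tau> m r p a)" for p
  proof (rule prod.cong[OF refl])
    fix a assume a: "a \<in> R"
    obtain i j where ij: "a = (i, j)" by (cases a)
    note q = inR[OF a[unfolded ij]]
    have "j = m - r + i \<Longrightarrow> adj k i = i"
      using q by (auto simp: Transposition.transpose_def K_def)
    then show "ell_factor \<tau> m r (p \<circ> mu_relabel (adj k)) a = ell_factor \<tau> m r p a"
      by (simp add: ij ell_factor_def)
  qed
  let ?l = "\<lambda>i j v. (lf_var U v + lf_var (X i) v) - lf_var (X j) v"
  let ?d = "\<lambda>a b v. lf_var a v - lf_var b v"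
  \<comment> \<open>The absent corner (k + 1, K) is included, since the swaps of variables move a
    factor of \<open>S\<close> there.\<close>
  define L where "L = {?l k K, ?l k (Suc K), ?l (Suc k) K, ?l (Suc k) (Suc K), ?d (X K) (X (Suc K)), ?d (X k) (X (Suc k)),
    lf_var H, lf_var (Mu k), lf_var (Mu (Suc k)), ?d (Mu k) (Mu (Suc k))}"
  have vars: "X k \<in> vars m r" "X (Suc k) \<in> vars m r" "X K \<in> vars m r" "X (Suc K) \<in> vars m r"
      "Mu k \<in> vars m r" "Mu (Suc k) \<in> vars m r"
    using k r kK by auto
  have dense: "dense_open m r (generic \<tau> m r L)"
  proof (rule dense_open_generic[OF im])
    fix l assume "l \<in> L"
    moreover have "\<exists>v\<in>vars m r. ?l i j v \<noteq> 0" for i j by (intro bexI[of _ U]) auto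
    moreover have "\<exists>v\<in>vars m r. ?d a b v \<noteq> 0" if "a \<in> vars m r" "a \<noteq> b" for a b
      using that by (intro bexI[of _ a]) auto
    moreover have "\<exists>v\<in>vars m r. lf_var a v \<noteq> 0" if "a \<in> vars m r" for a
      using that by (intro bexI[of _ a]) auto
    ultimately show "\<exists>v\<in>vars m r. l v \<noteq> 0"
      using vars unfolding L_def by (elim insertE emptyE) (simp_all del: X_vars Mu_vars)
  qed (simp add: L_def)
  show ?thesis
  proof (rule mero_eqI[OF dense])
    fix p assume p: "p \<in> generic \<tau> m r L"
    have "p \<in> torus m r" using p by (simp add: generic_def)
    then obtain z where z: "is_log m r p z" using exists_log by blast
    define A B C where "A = z U + z (X k) - z (X K)" and "B = z U + z (X k) - z (X (Suc K))"
      and "C = z U + z (X (Suc k)) - z (X (Suc K))"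
    define a b h where "a = z (Mu k)" and "b = z (Mu (Suc k))" and "h = z H"
    have ev: "lf_eval m r (?l k K) z = A" "lf_eval m r (?l k (Suc K)) z = B"
        "lf_eval m r (?l (Suc k) (Suc K)) z = C" "lf_eval m r (?l (Suc k) K) z = A + C - B"
        "lf_eval m r (?d (X K) (X (Suc K))) z = B - A" "lf_eval m r (?d (X k) (X (Suc k))) z = B - C"
        "lf_eval m r (lf_var H) z = h" "lf_eval m r (lf_var (Mu k)) z = a"
        "lf_eval m r (lf_var (Mu (Suc k))) z = b" "lf_eval m r (?d (Mu k) (Mu (Suc k))) z = a - b"
      using vars by (simp_all add: lf_eval_diff lf_eval_add A_def B_def C_def a_def b_def h_def del: X_vars Mu_vars)
    have "\<forall>l\<in>L. theta \<tau> (lf_eval m r l z) \<noteq> 0"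
      using generic_log[OF im p z] by blast
    note gen = this[unfolded L_def ball_simps ev]
    have nz: "theta \<tau> A \<noteq> 0" "theta \<tau> B \<noteq> 0" "theta \<tau> C \<noteq> 0" "theta \<tau> (A + C - B) \<noteq> 0"
        "theta \<tau> (B - A) \<noteq> 0" "theta \<tau> (B - C) \<noteq> 0" "theta \<tau> h \<noteq> 0"
        "theta \<tau> a \<noteq> 0" "theta \<tau> b \<noteq> 0" "theta \<tau> (a - b) \<noteq> 0"
      using gen by blast+
    define G where "G = (\<Prod>a\<in>R. ell_factor \<tau> m r p a)"
    let ?F = "F_ell \<tau>"
    have fac: "ell_factor \<tau> m r q (i, j) = ?F (y U + y (X i) - y (X j)) (if j = m - r + i then y (Mu i) else y H)"
      if "is_log m r q y" "i \<in> {1..r}" "j \<in> {1..m}" for q y i j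
      using that r by (simp add: is_log_def ell_factor_def unit_exp_add[symmetric] unit_exp_diff[symmetric] delta_unit_exp)
    have kr: "k \<in> {1..r}" "Suc k \<in> {1..r}" "K \<in> {1..m}" "Suc K \<in> {1..m}" using k kK by auto
    have E: "Ell_min \<tau> m r q = (\<Prod>a\<in>R. ell_factor \<tau> m r q a) *
        (?F (y U + y (X k) - y (X K)) (y (Mu k)) * ?F (y U + y (X k) - y (X (Suc K))) (y H) *
         ?F (y U + y (X (Suc k)) - y (X (Suc K))) (y (Mu (Suc k))))"
      if "is_log m r q y" for q y
      unfolding split fac[OF that kr(1,3)] fac[OF that kr(1,4)] fac[OF that kr(2,4)] by (simp add: K_def)
    define z' where "z' = z \<circ> mu_relabel (adj k)"
    have adjk: "adj k permutes {1..r}" using k by (intro permutes_swap_id) auto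
    have z': "is_log m r (p \<circ> mu_relabel (adj k)) z'"
      using z mu_relabel_vars[OF adjk] by (simp add: z'_def is_log_def)
    note zs = swap_x_log[OF z kK(1)] swap_x_log[OF z' kK(2)]
    have z'_simps: "z' U = z U" "z' H = z H" "z' (X i) = z (X i)" "z' (Mu k) = b" "z' (Mu (Suc k)) = a" for i
      by (simp_all add: z'_def a_def b_def)
    have sw: "swap_x k z (X K) = z (X K)" "swap_x k z (X (Suc K)) = z (X (Suc K))"
        "swap_x K z' (X k) = z' (X k)" "swap_x K z' (X (Suc k)) = z' (X (Suc k))"
      using k kK r by (auto intro!: swap_x_other simp: K_def)
    have pk: "step_param m r id k = ?d (Mu k) (Mu (Suc k))"
      using k r by (auto simp: step_param_def pos_form_def lf_var_def fun_eq_iff split: var.splits)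
    \<comment> \<open>At the sources the \<mu> enter with a negative sign; the relabelling
      compensates this, so that both sides have the parameter a - b.\<close>
    have pK: "step_param m r id K = ?d (Mu (Suc k)) (Mu k)"
      using k r by (auto simp: step_param_def pos_form_def lf_var_def fun_eq_iff K_def split: var.splits)
    have evk: "lf_eval m r (step_param m r id k) z = a - b"
      unfolding pk ev ..
    have evK: "lf_eval m r (step_param m r id K) z' = a - b"
      using vars unfolding pK by (simp add: lf_eval_diff z'_simps del: X_vars Mu_vars)
    have dif: "z (X (Suc k)) - z (X k) = C - B" "z (X k) - z (X (Suc k)) = B - C"
        "z (X (Suc K)) - z (X K) = A - B" "z (X K) - z (X (Suc K)) = B - A"
        "z U + z (X k) - z (X K) = A" "z U + z (X k) - z (X (Suc K)) = B"
        "z U + z (X (Suc k)) - z (X (Suc K)) = C" "z U + z (X (Suc k)) - z (X K) = A + C - B"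
      by (simp_all add: A_def B_def C_def)
    have lhs: "canon \<tau> m r [k] p = G * (?F (C - B) (a - b) * (?F A a * ?F B h * ?F C b) +
         ?F (B - C) h * (?F (A + C - B) a * ?F C h * ?F B b))"
      unfolding canon.simps word_perm_Nil C_op_log[OF z kK(1)] E[OF z] E[OF zs(1)] G1 G_def[symmetric]
        evk swap_x_simps sw dif a_def[symmetric] b_def[symmetric] h_def[symmetric]
      by (simp add: algebra_simps)
    have rhs: "mu_act (adj k) (canon \<tau> m r [K]) p = G * (?F (A - B) (a - b) * (?F A b * ?F B h * ?F C a) +
         ?F (B - A) h * (?F B b * ?F A h * ?F (A + C - B) a))"
      unfolding mu_act_eq canon.simps word_perm_Nil C_op_log[OF z' kK(2)] E[OF z'] E[OF zs(2)] G2 G3 G_def[symmetric]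
        evK swap_x_simps sw z'_simps dif h_def[symmetric]
      by (simp add: algebra_simps)
    show "canon \<tau> m r [k] p = mu_act (adj k) (canon \<tau> m r [m - r + k]) p"
      unfolding K_def[symmetric] lhs rhs F_ell_exchange[OF im nz] ..
  qed
qed

text \<open>The operators applied after the exchange pass through the relabelling once their
  parameters are relabelled, and \<open>step_param_relabel\<close> says that these are the canonical
  ones.\<close>

lemma canon_exchange:
  assumes im: "Im \<tau> > 0" and k: "1 \<le> k" "k < r" and r: "2 * r \<le> m" and "set is \<subseteq> {1..<m}"
  shows "mero_eq m r (canon \<tau> m r (is @ [k])) (mu_act (adj k) (canon \<tau> m r (is @ [m - r + k])))"
  using assms(5)
proof (induction "is")
  case Nil
  then show ?case using Ell_min_exchange[OF im k r] by simp
next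
  case (Cons i "is")
  then have i: "i \<in> {1..<m}" and w: "word_perm is permutes {1..m}"
    using word_perm_permutes[of "is" m] by auto
  have "mero_eq m r (canon \<tau> m r (is @ [k])) (mu_act (adj k) (canon \<tau> m r (is @ [m - r + k])))"
    using Cons by simp
  from C_op_cong[OF this i]
  have "mero_eq m r (canon \<tau> m r ((i # is) @ [k]))
      (C_op \<tau> m r i (step_param m r (word_perm is \<circ> adj k) i) (mu_act (adj k) (canon \<tau> m r (is @ [m - r + k]))))"
    by (simp add: word_perm_append)
  also have "C_op \<tau> m r i (step_param m r (word_perm is \<circ> adj k) i) (mu_act (adj k) (canon \<tau> m r (is @ [m - r + k]))) =
      mu_act (adj k) (canon \<tau> m r ((i # is) @ [m - r + k]))"
    using mu_act_C_op[of k r "step_param m r (word_perm is \<circ> adj k) i"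
        "step_param m r (word_perm is \<circ> adj (m - r + k)) i", OF _ step_param_relabel[OF k r w]] k
    by (simp add: word_perm_append)
  finally show ?case .
qed

theorem canon_min_presents:
  assumes im: "Im \<tau> > 0" and r: "2 * r \<le> m"
    and "min_presents m r P \<sigma> w" "min_presents m r P \<sigma>' w'"
    and "reduced_word m w is" "reduced_word m w' js"
  shows "mero_eq m r (mu_act \<sigma> (canon \<tau> m r is)) (mu_act \<sigma>' (canon \<tau> m r js))"
proof -
  \<comment> \<open>Quantifying over all reduced words allows each move to be carried out on words
    whose last letter is the one in question.\<close>
  define T where "T \<sigma> w \<sigma>' w' \<longleftrightarrow> (\<forall>is js. reduced_word m w is \<longrightarrow> reduced_word m w' js \<longrightarrow>
      mero_eq m r (mu_act \<sigma> (canon \<tau> m r is)) (mu_act \<sigma>' (canon \<tau> m r js)))" for \<sigma> w \<sigma>' w'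
  have "T \<sigma> w \<sigma>' w'"
  proof (rule minimal_presentations_connected[where T = T, OF r _ _ _ _ assms(3,4)])
    show "T \<sigma> w \<sigma> w" if "\<sigma> permutes {1..r}" "w permutes {1..m}" for \<sigma> w
      unfolding T_def using mu_act_cong[OF canon_reduced_word[OF im r that(2)] that(1)] by blast
    show "T \<sigma>' w' \<sigma> w" if "T \<sigma> w \<sigma>' w'" for \<sigma> w \<sigma>' w'
      using that mero_eq_sym unfolding T_def by blast
    show "T \<sigma> w \<sigma>'' w''" if w': "w' permutes {1..m}" and 1: "T \<sigma> w \<sigma>' w'" and 2: "T \<sigma>' w' \<sigma>'' w''"
      for \<sigma> w \<sigma>' w' \<sigma>'' w''
    proof -
      obtain ks where "reduced_word m w' ks" by (rule exists_reduced_word[OF w'])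
      then show ?thesis using 1 2 mero_eq_trans unfolding T_def by blast
    qed
  next
    fix \<sigma> v k
    assume \<sigma>: "\<sigma> permutes {1..r}" and v: "v permutes {1..m}" and k: "1 \<le> k" "k < r"
      and c: "card (inversions m (v \<circ> adj k)) = Suc (card (inversions m v))"
        "card (inversions m (v \<circ> adj (m - r + k))) = Suc (card (inversions m v))"
    obtain ks where ks: "reduced_word m v ks" by (rule exists_reduced_word[OF v])
    have kK: "k \<in> {1..<m}" "m - r + k \<in> {1..<m}" using k r by auto
    note perms = comp_adj_permutes[OF v kK(1)] comp_adj_permutes[OF v kK(2)]
    have ks': "set ks \<subseteq> {1..<m}" "word_perm ks = v" "length ks = card (inversions m v)"
      using ks unfolding reduced_word_iff[OF v] by auto
    have red: "reduced_word m (v \<circ> adj k) (ks @ [k])" "reduced_word m (v \<circ> adj (m - r + k)) (ks @ [m - r + k])"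
      unfolding reduced_word_iff[OF perms(1)] reduced_word_iff[OF perms(2)]
      using ks' c kK by (auto simp: word_perm_append)
    have adjk: "adj k permutes {1..r}" using k by (intro permutes_swap_id) auto
    have invol: "mu_act (adj k) (mu_act (adj k) f) = f" for f
      unfolding mu_act_comp[symmetric] adj_adj by (rule ext) (simp only: mu_act_eq mu_relabel_id comp_id)
    show "T \<sigma> (v \<circ> adj (m - r + k)) (\<sigma> \<circ> adj k) (v \<circ> adj k)"
      unfolding T_def mu_act_comp
    proof (intro allI impI mu_act_cong[OF _ \<sigma>])
      fix "is" js assume "reduced_word m (v \<circ> adj (m - r + k)) is" "reduced_word m (v \<circ> adj k) js"
      then have "mero_eq m r (canon \<tau> m r is) (canon \<tau> m r (ks @ [m - r + k]))"
          "mero_eq m r (canon \<tau> m r (ks @ [k])) (canon \<tau> m r js)"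
        using canon_reduced_word[OF im r] perms red by blast+
      moreover have "mero_eq m r (mu_act (adj k) (canon \<tau> m r (ks @ [k]))) (canon \<tau> m r (ks @ [m - r + k]))"
        using mu_act_cong[OF canon_exchange[OF im k r ks'(1)] adjk] unfolding invol .
      ultimately show "mero_eq m r (canon \<tau> m r is) (mu_act (adj k) (canon \<tau> m r js))"
        using mu_act_cong[OF _ adjk] mero_eq_sym mero_eq_trans by metis
    qed
  qed
  then show ?thesis using assms(5,6) unfolding T_def by blast
qed

text \<open>The first conjunct provides admissible parameters along every reduced word, so the
  second, which ranges over all choices of words and parameters, is not vacuous.\<close>

theorem theorem17p3:
  fixes \<tau> :: complex and m r :: nat and P :: pattern
  assumes "Im \<tau> > 0"
    and "link_pattern m r P"
  shows "(\<forall>\<sigma> w is. min_presents m r P \<sigma> w \<longrightarrow> reduced_word m w is \<longrightarrow>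
            (\<exists>g. C_word \<tau> m r is (Ell_min \<tau> m r) g)) \<and>
         (\<forall>\<sigma> w g \<sigma>' w' g'.
            min_presents m r P \<sigma> w \<longrightarrow> C_diamond \<tau> m r w (Ell_min \<tau> m r) g \<longrightarrow>
            min_presents m r P \<sigma>' w' \<longrightarrow> C_diamond \<tau> m r w' (Ell_min \<tau> m r) g' \<longrightarrow>
            mero_eq m r (mu_act \<sigma> g) (mu_act \<sigma>' g'))"
proof (intro conjI allI impI)
  have r: "2 * r \<le> m" using assms(2) by (simp add: link_pattern_def)
  show "\<exists>g. C_word \<tau> m r is (Ell_min \<tau> m r) g" if "reduced_word m w is" for w "is"
    using C_word_canon[OF _ r] that unfolding reduced_word_def by blast
  fix \<sigma> w g \<sigma>' w' g'
  assume min: "min_presents m r P \<sigma> w" "min_presents m r P \<sigma>' w'"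
    and g: "C_diamond \<tau> m r w (Ell_min \<tau> m r) g" and g': "C_diamond \<tau> m r w' (Ell_min \<tau> m r) g'"
  obtain "is" js where "is": "reduced_word m w is" "C_word \<tau> m r is (Ell_min \<tau> m r) g"
      and js: "reduced_word m w' js" "C_word \<tau> m r js (Ell_min \<tau> m r) g'"
    using g g' unfolding C_diamond_def by blast
  have \<sigma>: "\<sigma> permutes {1..r}" "\<sigma>' permutes {1..r}"
    using min by (auto simp: min_presents_def presents_def)
  have "mero_eq m r g (canon \<tau> m r is)" "mero_eq m r g' (canon \<tau> m r js)"
    using C_word_mero_eq_canon[OF assms(1) r] "is" js by (auto simp: reduced_word_def)
  then have "mero_eq m r (mu_act \<sigma> g) (mu_act \<sigma> (canon \<tau> m r is))"
      "mero_eq m r (mu_act \<sigma>' (canon \<tau> m r js)) (mu_act \<sigma>' g')"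
    using mu_act_cong \<sigma> mero_eq_sym by blast+
  moreover have "mero_eq m r (mu_act \<sigma> (canon \<tau> m r is)) (mu_act \<sigma>' (canon \<tau> m r js))"
    by (rule canon_min_presents[OF assms(1) r min "is"(1) js(1)])
  ultimately show "mero_eq m r (mu_act \<sigma> g) (mu_act \<sigma>' g')"
    using mero_eq_trans by blast
qed

end
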